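(* Let $X_{n,1},\dots,X_{n,k_n}$ be a triangular array of $\mathbb R^d$-valued random variables, with components $X_{n,i}^{(l)}$, $l=1,\dots,d$. For some $\gamma>2$ and $\alpha<\frac{\gamma-2}{2(\gamma-1)}$ assume: (i) there is a constant $K$ with $k_n^{-1}\sum_{i,j=1}^{k_n}\bigl|\mathrm{Cov}[X_{n,i}^{(l_1)},X_{n,j}^{(l_2)}]\bigr|\le K$ for all $n$ and all $l_1,l_2=1,\dots,d$; (ii) $\sup_{n,i}\mathbb E\bigl[|X_{n,i}^{(l)}|^\gamma\bigr]<\infty$ for all $l=1,\dots,d$; (iii) $k_n\,\beta_n(k_n^\alpha)^{\frac{\gamma-2}{\gamma}}\to0$. Then the scaled sample average $k_n^{-1/2}\sum_{i=1}^{k_n}(X_{n,i}-\mathbb E[X_{n,i}])$ satisfies a relative central limit theorem.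
   Context: Throughout $k_n\to\infty$, and $k_n^\alpha$ as an argument of $\beta_n$ is read as its integer part. Mixing: for sub-$\sigma$-algebras, $\beta(\mathcal A_1,\mathcal A_2)=\frac12\sup\sum_{(i,j)\in I\times J}|\mathbb P(A_i\cap B_j)-\mathbb P(A_i)\mathbb P(B_j)|$, the supremum being over all finite partitions $(A_i)_{i\in I}\subset\mathcal A_1$, $(B_j)_{j\in J}\subset\mathcal A_2$ of $\Omega$; $\beta_n(p)=\sup_{k\le k_n-p}\beta(\sigma(X_{n,1},\dots,X_{n,k}),\sigma(X_{n,k+p},\dots,X_{n,k_n}))$. Relative CLT for $\mathbb R^d$-valued random variables: two sequences $X_n,Y_n$ of random vectors are relatively weakly convergent, $X_n\leftrightarrow_dY_n$, if $|\mathbb E[f(X_n)]-\mathbb E[f(Y_n)]|\to0$ for all bounded continuous $f:\mathbb R^d\to\mathbb R$. A sequence is relatively compact if every subsequence contains a further subsequence converging weakly to a tight Borel law. A sequence $Y_n$ of $\mathbb R^d$-valued random variables with finite second moments satisfies a relative central limit theorem if the sequence of centered Gaussian vectors $N_{Y_n}$ with the same covariance matrix as $Y_n$ is relatively compact and $Y_n\leftrightarrow_dN_{Y_n}$. *)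

theory Defs
  imports "HOL-Probability.Probability"
begin

section \<open>Absolute regularity (beta-mixing)\<close>

text \<open>Sub-\<sigma>-algebras are represented by their sets of events.  Partitions in the sense of
  \<^const>\<open>partition_on\<close> have no empty blocks; empty blocks would not contribute to the sum.\<close>

definition beta_coeff :: "'w measure \<Rightarrow> 'w set set \<Rightarrow> 'w set set \<Rightarrow> real" where
  "beta_coeff M \<A>1 \<A>2 =
     (1/2) * (SUP (P, Q) \<in> {(P, Q). finite P \<and> partition_on (space M) P \<and> P \<subseteq> \<A>1 \<and>
                                     finite Q \<and> partition_on (space M) Q \<and> Q \<subseteq> \<A>2}.
                \<Sum>(A, B) \<in> P \<times> Q. \<bar>measure M (A \<inter> B) - measure M A * measure M B\<bar>)"

definition sigma_rv :: "'w measure \<Rightarrow> ('i \<Rightarrow> 'w \<Rightarrow> 'a::topological_space) \<Rightarrow> 'i set \<Rightarrow> 'w set set" where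
  "sigma_rv M X I =
     sigma_sets (space M) (\<Union>i\<in>I. {X i -` B \<inter> space M | B. B \<in> sets borel})"

text \<open>The coefficient at lag \<open>p\<close> of a single row \<open>X 1, \<dots>, X m\<close>.  For \<open>p \<ge> m\<close> there is no
  admissible split point and the supremum of the empty set of nonnegative numbers is \<open>0\<close>.\<close>

definition row_beta :: "'w measure \<Rightarrow> (nat \<Rightarrow> 'w \<Rightarrow> 'a::topological_space) \<Rightarrow> nat \<Rightarrow> nat \<Rightarrow> real" where
  "row_beta M X m p =
     (if p < m
      then SUP j\<in>{1..m - p}. beta_coeff M (sigma_rv M X {1..j}) (sigma_rv M X {j + p..m})
      else 0)"

section \<open>Covariances and centered Gaussian laws\<close>

definition covar :: "'w measure \<Rightarrow> ('w \<Rightarrow> real) \<Rightarrow> ('w \<Rightarrow> real) \<Rightarrow> real" where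
  "covar M U V =
     integral\<^sup>L M (\<lambda>w. (U w - integral\<^sup>L M U) * (V w - integral\<^sup>L M V))"

definition cov_matrix :: "'w measure \<Rightarrow> ('w \<Rightarrow> real ^ 'd) \<Rightarrow> real ^ 'd ^ 'd" where
  "cov_matrix M Y = (\<chi> l1 l2. covar M (\<lambda>w. Y w $ l1) (\<lambda>w. Y w $ l2))"

text \<open>\<open>\<sigma>\<close> is the standard deviation; \<open>\<sigma> = 0\<close> gives the degenerate normal law.\<close>

definition normal_law :: "real \<Rightarrow> real \<Rightarrow> real measure" where
  "normal_law \<mu> \<sigma> =
     (if \<sigma> = 0 then return borel \<mu> else density lborel (\<lambda>x. ennreal (normal_density \<mu> \<sigma> x)))"

definition centered_gaussian_law :: "(real ^ 'd) measure \<Rightarrow> bool" where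
  "centered_gaussian_law \<nu> \<longleftrightarrow>
     prob_space \<nu> \<and> sets \<nu> = sets borel \<and>
     (\<forall>a. \<exists>\<sigma>\<ge>0. distr \<nu> borel (\<lambda>x. a \<bullet> x) = normal_law 0 \<sigma>)"

section \<open>Relative weak convergence and relative central limit theorems\<close>

text \<open>These notions depend on random vectors only through their laws, so they are stated for
  sequences of Borel probability measures.\<close>

definition relatively_weakly_convergent ::
    "(nat \<Rightarrow> 'a::topological_space measure) \<Rightarrow> (nat \<Rightarrow> 'a measure) \<Rightarrow> bool" where
  "relatively_weakly_convergent \<mu> \<nu> \<longleftrightarrow>
     (\<forall>f :: 'a \<Rightarrow> real. continuous_on UNIV f \<and> bounded (range f) \<longrightarrow>
        (\<lambda>n. \<bar>integral\<^sup>L (\<mu> n) f - integral\<^sup>L (\<nu> n) f\<bar>) \<longlonglongrightarrow> 0)"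

definition converges_weakly ::
    "(nat \<Rightarrow> 'a::topological_space measure) \<Rightarrow> 'a measure \<Rightarrow> bool" where
  "converges_weakly \<mu> \<nu> \<longleftrightarrow>
     (\<forall>f :: 'a \<Rightarrow> real. continuous_on UNIV f \<and> bounded (range f) \<longrightarrow>
        (\<lambda>n. integral\<^sup>L (\<mu> n) f) \<longlonglongrightarrow> integral\<^sup>L \<nu> f)"

definition tight_borel_law :: "'a::topological_space measure \<Rightarrow> bool" where
  "tight_borel_law \<nu> \<longleftrightarrow>
     prob_space \<nu> \<and> sets \<nu> = sets borel \<and>
     (\<forall>\<epsilon>>0. \<exists>C\<in>sets borel. compact C \<and> measure \<nu> (UNIV - C) < \<epsilon>)"

definition relatively_compact_laws :: "(nat \<Rightarrow> 'a::topological_space measure) \<Rightarrow> bool" where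
  "relatively_compact_laws \<mu> \<longleftrightarrow>
     (\<forall>r. strict_mono (r :: nat \<Rightarrow> nat) \<longrightarrow>
        (\<exists>s \<nu>. strict_mono (s :: nat \<Rightarrow> nat) \<and> tight_borel_law \<nu> \<and>
               converges_weakly (\<lambda>n. \<mu> (r (s n))) \<nu>))"

text \<open>The \<open>n\<close>-th vector may live on its own probability space \<open>M n\<close>.  \<open>G n\<close> is the law of the
  centered Gaussian vector with the covariance matrix of \<open>Y n\<close>, which determines it.\<close>

definition relative_CLT :: "(nat \<Rightarrow> 'w measure) \<Rightarrow> (nat \<Rightarrow> 'w \<Rightarrow> real ^ 'd) \<Rightarrow> bool" where
  "relative_CLT M Y \<longleftrightarrow>
     (\<forall>n. Y n \<in> borel_measurable (M n) \<and> integrable (M n) (\<lambda>w. (norm (Y n w))\<^sup>2)) \<and>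
     (\<exists>G. (\<forall>n. centered_gaussian_law (G n) \<and> cov_matrix (G n) (\<lambda>x. x) = cov_matrix (M n) (Y n)) \<and>
          relatively_compact_laws G \<and>
          relatively_weakly_convergent (\<lambda>n. distr (M n) borel (Y n)) G)"

end

theory Submission
  imports Defs
begin

text \<open>By Weierstrass approximation with polynomials in the sines of the rescaled coordinates, relative
  weak convergence of laws with bounded second moments follows from the pointwise vanishing of the
  difference of the characteristic functions, so everything reduces to the real-valued sums
  \<open>t \<bullet> X i\<close>.  The index range is cut into blocks of length \<open>q\<close>, with
  \<open>q\<close> of the order of a power of \<open>k\<close> whose exponent lies strictly between \<open>\<alpha>\<close> and
  \<open>(\<gamma> - 2) / (2 * (\<gamma> - 1))\<close>, separated by gaps of length \<open>p\<close>, the integer part of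
  \<open>k powr \<alpha>\<close>.  Shifting the pattern suitably makes the gaps carry at most the
  proportion \<open>p / (p + q)\<close> of the covariances, hence they are negligible.  Mixing
  factorizes the characteristic function over the blocks and makes the covariances between distinct
  blocks negligible, and a second order expansion with a Lindeberg-type remainder replaces each factor by
  that of a centered Gaussian; the upper bound on the exponent of \<open>q\<close> is the Lyapunov condition for
  the block sums.  The Gaussian laws are linear images of a product of standard normal laws,
  and the compactness of bounded sets of matrices gives their relative compactness.\<close>

section \<open>Covariance inequalities for mixing events\<close>

text \<open>The covariance matrices need not converge, so there is no limit law to aim at: the bound
  for a single row is explicit, its constants do not depend on the row, and the Gaussian of that
  same row is the object of comparison. A free parameter \<open>\<epsilon>\<close> remains in the
  bound, both for deleting the gaps and as Lindeberg threshold; it tends to 0 only after the row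
  index has gone to infinity. The two exponents of the hypotheses have separate sources. Truncation
  at level T costs T^(2-\<gamma>) in the tails and T^2 b in the mixing bound; these balance at T =
  b^(-1/\<gamma>) and leave b^((\<gamma>-2)/\<gamma>) per pair of indices. There are at most m^2
  pairs and the normalization divides by m, hence the factor k_n in the mixing hypothesis. The
  \<gamma>-th moment of a block sum is estimated by convexity alone, at most a constant times
  q^\<gamma>; over about m/q blocks and after normalization this is q^(\<gamma>-1) m^(1-\<gamma>/2),
  which vanishes for q = m^d exactly when d < (\<gamma>-2)/(2(\<gamma>-1)). Blocks must outgrow the
  gaps, which puts the same bound on \<alpha>.\<close>

lemma (in prob_space) cov_bound_unit:
  assumes FA: "space FA = space M" "sets FA \<subseteq> sets M"
    and FB: "space FB = space M" "sets FB \<subseteq> sets M"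
    and a: "\<And>A B. A \<in> sets FA \<Longrightarrow> B \<in> sets FB \<Longrightarrow> \<bar>prob (A \<inter> B) - prob A * prob B\<bar> \<le> a"
    and U: "U \<in> borel_measurable FA" "\<And>w. 0 \<le> U w" "\<And>w. U w \<le> (1::real)"
    and V: "V \<in> borel_measurable FB" "\<And>w. 0 \<le> V w" "\<And>w. V w \<le> (1::real)"
  shows "\<bar>expectation (\<lambda>w. U w * V w) - expectation U * expectation V\<bar> \<le> a"
proof -
  have subA: "subalgebra M FA" and subB: "subalgebra M FB"
    using FA FB by (auto simp: subalgebra_def)
  have UM: "U \<in> borel_measurable M" and VM: "V \<in> borel_measurable M"
    using measurable_from_subalg[OF subA U(1)] measurable_from_subalg[OF subB V(1)] by auto
  \<comment> \<open>Discrete layer cake: \<open>Un'\<close> is \<open>U\<close> rounded down to a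
    multiple of \<open>1 / N\<close>, hence the average of the indicators of the level sets
    \<open>A j\<close>; likewise \<open>Vn'\<close>. The covariance of the roundings is an average
    of event covariances, so at most \<open>a\<close>, and rounding costs \<open>2 / N\<close> in
    each of the two terms.\<close>
  have step: "\<bar>expectation (\<lambda>w. U w * V w) - expectation U * expectation V\<bar> \<le> a + 4 / real N"
    if N: "N \<ge> 1" for N :: nat
  proof -
    define A where "A j = {w \<in> space M. U w \<ge> real j / real N}" for j
    define B where "B j = {w \<in> space M. V w \<ge> real j / real N}" for j
    have AF: "A j \<in> sets FA" for j
      using borel_measurable_le[OF borel_measurable_const U(1)] FA by (auto simp: A_def)
    have BF: "B j \<in> sets FB" for j
      using borel_measurable_le[OF borel_measurable_const V(1)] FB by (auto simp: B_def)
    have [measurable]: "A j \<in> sets M" "B j \<in> sets M" for j using AF BF FA FB by auto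
    define Un' where "Un' w = (1 / real N) * (\<Sum>j\<in>{1..N}. indicator (A j) w)" for w
    define Vn' where "Vn' w = (1 / real N) * (\<Sum>j\<in>{1..N}. indicator (B j) w)" for w
    have fl: "(1 / real N) * (\<Sum>j\<in>{1..N}. indicator {w \<in> space M. g w \<ge> real j / real N} w)
        = real (nat \<lfloor>g w * real N\<rfloor>) / real N"
      if w: "w \<in> space M" and g: "0 \<le> g w" "g w \<le> (1::real)" for g w
    proof -
      have "(\<Sum>j\<in>{1..N}. indicator {w \<in> space M. g w \<ge> real j / real N} w)
          = (\<Sum>j\<in>{1..N}. if j \<le> nat \<lfloor>g w * real N\<rfloor> then 1 else (0::real))"
      proof (rule sum.cong)
        fix j assume "j \<in> {1..N}"
        have "real j / real N \<le> g w \<longleftrightarrow> real j \<le> g w * real N"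
          using N by (simp add: field_simps)
        also have "\<dots> \<longleftrightarrow> j \<le> nat \<lfloor>g w * real N\<rfloor>"
          using g by (simp add: le_nat_floor le_nat_iff le_floor_iff)
        finally show "indicator {w \<in> space M. g w \<ge> real j / real N} w =
            (if j \<le> nat \<lfloor>g w * real N\<rfloor> then 1 else (0::real))"
          using w by (simp add: indicator_def)
      qed simp
      also have "\<dots> = real (card ({1..N} \<inter> {j. j \<le> nat \<lfloor>g w * real N\<rfloor>}))"
        by (simp add: sum.If_cases)
      also have "{1..N} \<inter> {j. j \<le> nat \<lfloor>g w * real N\<rfloor>} = {1..nat \<lfloor>g w * real N\<rfloor>}"
      proof -
        have "g w * real N \<le> real N" using g by (simp add: mult_left_le_one_le)
        then have "nat \<lfloor>g w * real N\<rfloor> \<le> N" by linarith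
        then show ?thesis by auto
      qed
      finally show ?thesis by simp
    qed
    have fl2: "\<bar>real (nat \<lfloor>x * real N\<rfloor>) / real N - x\<bar> \<le> 1 / real N \<and>
        0 \<le> real (nat \<lfloor>x * real N\<rfloor>) / real N \<and> real (nat \<lfloor>x * real N\<rfloor>) / real N \<le> 1"
      if x: "0 \<le> x" "x \<le> 1" for x
    proof -
      define y where "y = real (nat \<lfloor>x * real N\<rfloor>)"
      have "0 \<le> x * real N" using x by simp
      then have y: "0 \<le> y" "y \<le> x * real N" "x * real N \<le> y + 1"
        unfolding y_def by linarith+
      have "y / real N \<le> x" "x \<le> y / real N + 1 / real N"
        using y N by (simp_all add: field_simps)
      then show ?thesis unfolding y_def[symmetric] using x y(1) by (auto simp: abs_le_iff)
    qed
    have Un': "\<bar>Un' w - U w\<bar> \<le> 1 / real N" "0 \<le> Un' w" "Un' w \<le> 1" if "w \<in> space M" for w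
      using fl[of w U, OF that] fl2[of "U w"] U unfolding Un'_def A_def by auto
    have Vn': "\<bar>Vn' w - V w\<bar> \<le> 1 / real N" "0 \<le> Vn' w" "Vn' w \<le> 1" if "w \<in> space M" for w
      using fl[of w V, OF that] fl2[of "V w"] V unfolding Vn'_def B_def by auto
    have mN[measurable]: "Un' \<in> borel_measurable M" "Vn' \<in> borel_measurable M"
      unfolding Un'_def Vn'_def by measurable
    note [measurable] = UM VM
    have bi: "integrable M f" if "f \<in> borel_measurable M" "\<And>w. w \<in> space M \<Longrightarrow> \<bar>f w\<bar> \<le> 1"
      for f :: "'a \<Rightarrow> real"
      by (rule integrable_const_bound[of _ 1]) (use that in auto)
    have abs1: "\<bar>x * y\<bar> \<le> 1" if "0 \<le> x" "x \<le> 1" "0 \<le> y" "y \<le> 1" for x y :: real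
      using that by (simp add: abs_mult mult_le_one)
    have iU: "integrable M U" "integrable M V" "integrable M Un'" "integrable M Vn'"
      "integrable M (\<lambda>w. U w * V w)" "integrable M (\<lambda>w. Un' w * Vn' w)"
      using U V Un' Vn' abs1 by (auto intro!: bi)
    have E1: "expectation Un' = (1 / real N) * (\<Sum>j\<in>{1..N}. prob (A j))"
      "expectation Vn' = (1 / real N) * (\<Sum>j\<in>{1..N}. prob (B j))"
      unfolding Un'_def Vn'_def by (simp_all add: emeasure_eq_measure)
    have E2: "expectation (\<lambda>w. Un' w * Vn' w) =
       (1 / real N)^2 * (\<Sum>j\<in>{1..N}. \<Sum>l\<in>{1..N}. prob (A j \<inter> B l))"
    proof -
      have "expectation (\<lambda>w. Un' w * Vn' w) = expectation (\<lambda>w. (1 / real N)^2 *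
          (\<Sum>j\<in>{1..N}. \<Sum>l\<in>{1..N}. indicator (A j \<inter> B l) w))"
        unfolding Un'_def Vn'_def
        by (simp add: sum_product power2_eq_square indicator_inter_arith)
      also have "\<dots> = (1 / real N)^2 * (\<Sum>j\<in>{1..N}. \<Sum>l\<in>{1..N}. prob (A j \<inter> B l))"
        by (simp add: emeasure_eq_measure Bochner_Integration.integral_sum)
      finally show ?thesis .
    qed
    have "expectation (\<lambda>w. Un' w * Vn' w) - expectation Un' * expectation Vn' =
       (1 / real N)^2 * (\<Sum>j\<in>{1..N}. \<Sum>l\<in>{1..N}. prob (A j \<inter> B l) - prob (A j) * prob (B l))"
      unfolding E1 E2 by (simp add: sum_subtractf sum_product power2_eq_square algebra_simps)
    also have "\<bar>\<dots>\<bar> \<le> (1 / real N)^2 * (\<Sum>j\<in>{1..N}. \<Sum>l\<in>{1..N}. a)"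
      unfolding abs_mult
      by (intro mult_mono order_trans[OF sum_abs] sum_mono a AF BF) (auto intro: sum_nonneg)
    also have "\<dots> = a" using N by (simp add: power2_eq_square)
    finally have c1: "\<bar>expectation (\<lambda>w. Un' w * Vn' w) - expectation Un' * expectation Vn'\<bar> \<le> a" .
    have dle: "\<bar>expectation f - expectation g\<bar> \<le> c"
      if "integrable M f" "integrable M g" "\<And>w. w \<in> space M \<Longrightarrow> \<bar>f w - g w\<bar> \<le> c" for f g and c :: real
    proof -
      have "\<bar>expectation f - expectation g\<bar> = \<bar>expectation (\<lambda>w. f w - g w)\<bar>" using that by simp
      also have "\<dots> \<le> expectation (\<lambda>w. \<bar>f w - g w\<bar>)" by (rule integral_abs_bound)
      also have "\<dots> \<le> expectation (\<lambda>w. c)"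
        by (rule integral_mono) (use that in auto)
      finally show ?thesis by (simp add: prob_space)
    qed
    have pr: "\<bar>x * y - x' * y'\<bar> \<le> 2 / real N"
      if "0 \<le> x" "x \<le> 1" "0 \<le> y'" "y' \<le> 1" "\<bar>x' - x\<bar> \<le> 1 / real N" "\<bar>y' - y\<bar> \<le> 1 / real N"
      for x y x' y' :: real
    proof -
      have "x * y - x' * y' = x * (y - y') + (x - x') * y'" by (simp add: algebra_simps)
      also have "\<bar>\<dots>\<bar> \<le> 1 * (1 / real N) + (1 / real N) * 1"
        by (intro order_trans[OF abs_triangle_ineq] add_mono; unfold abs_mult; intro mult_mono)
          (use that in auto)
      finally show ?thesis by simp
    qed
    have d1: "\<bar>expectation (\<lambda>w. U w * V w) - expectation (\<lambda>w. Un' w * Vn' w)\<bar> \<le> 2 / real N"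
      by (rule dle) (use iU U V Un' Vn' in \<open>auto intro!: pr\<close>)
    have dU: "\<bar>expectation Un' - expectation U\<bar> \<le> 1 / real N" "\<bar>expectation Vn' - expectation V\<bar> \<le> 1 / real N"
      by (rule dle; use iU Un' Vn' in auto)+
    have e01: "0 \<le> expectation f \<and> expectation f \<le> 1"
      if "integrable M f" "\<And>w. w \<in> space M \<Longrightarrow> 0 \<le> f w \<and> f w \<le> 1" for f :: "'a \<Rightarrow> real"
    proof -
      have "expectation f \<le> expectation (\<lambda>w. 1)" by (rule integral_mono) (use that in auto)
      moreover have "0 \<le> expectation f" by (rule Bochner_Integration.integral_nonneg) (use that in auto)
      ultimately show ?thesis by (simp add: prob_space)
    qed
    have d2: "\<bar>expectation U * expectation V - expectation Un' * expectation Vn'\<bar> \<le> 2 / real N"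
      by (rule pr) (use dU e01[OF iU(1)] e01[OF iU(4)] U Vn' in auto)
    show ?thesis using c1 d1 d2 by linarith
  qed
  show ?thesis
  proof (rule LIMSEQ_le_const)
    show "(\<lambda>N. a + 4 / real N) \<longlonglongrightarrow> a" by real_asymp
    show "\<exists>N0. \<forall>N\<ge>N0. \<bar>expectation (\<lambda>w. U w * V w) - expectation U * expectation V\<bar> \<le> a + 4 / real N"
      using step by blast
  qed
qed

text \<open>The affine map sending \<open>[-T, T]\<close> onto \<open>[0, 1]\<close> divides
  covariances by (2T)^2, which is where the constant comes from.\<close>

lemma (in prob_space) cov_bound_bounded:
  assumes FA: "space FA = space M" "sets FA \<subseteq> sets M"
    and FB: "space FB = space M" "sets FB \<subseteq> sets M"
    and a: "\<And>A B. A \<in> sets FA \<Longrightarrow> B \<in> sets FB \<Longrightarrow> \<bar>prob (A \<inter> B) - prob A * prob B\<bar> \<le> a"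
    and U: "U \<in> borel_measurable FA" "\<And>w. \<bar>U w\<bar> \<le> (T::real)"
    and V: "V \<in> borel_measurable FB" "\<And>w. \<bar>V w\<bar> \<le> T"
    and T: "T > 0"
  shows "\<bar>expectation (\<lambda>w. U w * V w) - expectation U * expectation V\<bar> \<le> 4 * T\<^sup>2 * a"
proof -
  define U' where "U' w = (U w + T) / (2 * T)" for w
  define V' where "V' w = (V w + T) / (2 * T)" for w
  have subA: "subalgebra M FA" and subB: "subalgebra M FB"
    using FA FB by (auto simp: subalgebra_def)
  have [measurable]: "U \<in> borel_measurable M" "V \<in> borel_measurable M"
    using measurable_from_subalg[OF subA U(1)] measurable_from_subalg[OF subB V(1)] by auto
  have [simp]: "integrable M U" "integrable M V"
    by (rule integrable_const_bound[of _ T]; use U V in auto)+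
  have [simp]: "integrable M (\<lambda>w. U w * V w)"
    by (rule integrable_const_bound[of _ "T * T"]) (use U V T in \<open>auto simp: abs_mult intro!: mult_mono\<close>)
  have bd: "0 \<le> (x + T) / (2 * T) \<and> (x + T) / (2 * T) \<le> 1" if "\<bar>x\<bar> \<le> T" for x
    using that T by (auto simp: field_simps abs_le_iff)
  have "\<bar>expectation (\<lambda>w. U' w * V' w) - expectation U' * expectation V'\<bar> \<le> a"
    by (rule cov_bound_unit[OF FA FB a])
      (use U V bd[OF U(2)] bd[OF V(2)] in \<open>auto simp: U'_def V'_def intro!: borel_measurable_divide borel_measurable_add\<close>)
  moreover have "expectation (\<lambda>w. U' w * V' w) - expectation U' * expectation V' =
     (expectation (\<lambda>w. U w * V w) - expectation U * expectation V) / (4 * T\<^sup>2)"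
  proof -
    have e: "expectation U' = (expectation U + T) / (2 * T)"
      "expectation V' = (expectation V + T) / (2 * T)"
      unfolding U'_def V'_def by (simp_all add: prob_space)
    have "expectation (\<lambda>w. U' w * V' w) =
        expectation (\<lambda>w. (U w * V w + T * U w + T * V w + T * T) / (4 * T\<^sup>2))"
      unfolding U'_def V'_def by (simp add: power2_eq_square algebra_simps)
    also have "\<dots> = (expectation (\<lambda>w. U w * V w) + T * expectation U + T * expectation V + T * T) / (4 * T\<^sup>2)"
      by (simp add: prob_space)
    finally have e2: "expectation (\<lambda>w. U' w * V' w) =
       (expectation (\<lambda>w. U w * V w) + T * expectation U + T * expectation V + T * T) / (4 * T\<^sup>2)" .
    show ?thesis unfolding e e2 using T by (simp add: divide_simps power2_eq_square algebra_simps)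
  qed
  ultimately show ?thesis using T by (simp add: field_simps abs_mult)
qed

text \<open>By the addition formulas the real and the imaginary part of the difference are each a
  combination of two covariances of sines and cosines, and each covariance is at most
  \<open>4 * a\<close> by the bounded case with level 1; hence 8a + 8a.\<close>

lemma (in prob_space) iexp_product_bound:
  assumes FA: "space FA = space M" "sets FA \<subseteq> sets M"
    and FB: "space FB = space M" "sets FB \<subseteq> sets M"
    and a: "\<And>A B. A \<in> sets FA \<Longrightarrow> B \<in> sets FB \<Longrightarrow> \<bar>prob (A \<inter> B) - prob A * prob B\<bar> \<le> a"
    and U: "U \<in> borel_measurable FA" and V: "V \<in> borel_measurable FB"
  shows "cmod (expectation (\<lambda>w. iexp (U w + V w)) - expectation (\<lambda>w. iexp (U w)) * expectation (\<lambda>w. iexp (V w)))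
           \<le> 16 * a"
proof -
  have subA: "subalgebra M FA" and subB: "subalgebra M FB"
    using FA FB by (auto simp: subalgebra_def)
  have m: "U \<in> borel_measurable M" "V \<in> borel_measurable M"
    using measurable_from_subalg[OF subA U] measurable_from_subalg[OF subB V] by auto
  then have m': "(\<lambda>w. U w + V w) \<in> borel_measurable M" by simp
  note [measurable] = m
  have I: "integrable M (\<lambda>w. iexp (f w))" if "f \<in> borel_measurable M" for f
    using that by (intro integrable_const_bound[of _ 1]) auto
  have ReE: "Re (expectation (\<lambda>w. iexp (f w))) = expectation (\<lambda>w. cos (f w))"
    and ImE: "Im (expectation (\<lambda>w. iexp (f w))) = expectation (\<lambda>w. sin (f w))"
    if "f \<in> borel_measurable M" for f
    using integral_Re[OF I[OF that]] integral_Im[OF I[OF that]]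
    by (simp_all add: cis_conv_exp[symmetric] Re_exp Im_exp)
  have b: "\<bar>expectation (\<lambda>w. f (U w) * g (V w)) - expectation (\<lambda>w. f (U w)) * expectation (\<lambda>w. g (V w))\<bar> \<le> 4 * a"
    if "f \<in> borel_measurable borel" "g \<in> borel_measurable borel" "\<And>x. \<bar>f x\<bar> \<le> 1" "\<And>x. \<bar>g x\<bar> \<le> 1"
    for f g :: "real \<Rightarrow> real"
  proof -
    have "\<bar>expectation (\<lambda>w. f (U w) * g (V w)) - expectation (\<lambda>w. f (U w)) * expectation (\<lambda>w. g (V w))\<bar> \<le> 4 * 1\<^sup>2 * a"
      by (rule cov_bound_bounded[OF FA FB])
        (use a that in \<open>auto intro: measurable_compose[OF U] measurable_compose[OF V]\<close>)
    then show ?thesis by simp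
  qed
  have J: "integrable M (\<lambda>w. f (U w) * g (V w))"
    if [measurable]: "f \<in> borel_measurable borel" "g \<in> borel_measurable borel" and "\<And>x. \<bar>f x\<bar> \<le> 1" "\<And>x. \<bar>g x\<bar> \<le> 1"
    for f g :: "real \<Rightarrow> real"
    using that by (intro integrable_const_bound[of _ 1]) (auto simp: abs_mult intro!: mult_le_one)
  have sc: "sin \<in> borel_measurable (borel :: real measure)" "cos \<in> borel_measurable (borel :: real measure)"
    by (auto intro!: borel_measurable_continuous_onI continuous_at_imp_continuous_on)
  note bb = b[OF sc(1) sc(1)] b[OF sc(1) sc(2)] b[OF sc(2) sc(1)] b[OF sc(2) sc(2)]
  note JJ = J[OF sc(1) sc(1)] J[OF sc(1) sc(2)] J[OF sc(2) sc(1)] J[OF sc(2) sc(2)]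
  let ?z = "expectation (\<lambda>w. iexp (U w + V w)) - expectation (\<lambda>w. iexp (U w)) * expectation (\<lambda>w. iexp (V w))"
  have "Re ?z = expectation (\<lambda>w. cos (U w + V w)) -
      (expectation (\<lambda>w. cos (U w)) * expectation (\<lambda>w. cos (V w)) - expectation (\<lambda>w. sin (U w)) * expectation (\<lambda>w. sin (V w)))"
    unfolding minus_complex.sel times_complex.sel ReE[OF m'] ReE[OF m(1)] ReE[OF m(2)] ImE[OF m(1)] ImE[OF m(2)] ..
  also have "expectation (\<lambda>w. cos (U w + V w)) = expectation (\<lambda>w. cos (U w) * cos (V w)) - expectation (\<lambda>w. sin (U w) * sin (V w))"
    using JJ by (simp add: cos_add)
  finally have R: "\<bar>Re ?z\<bar> \<le> 8 * a" using bb by (simp add: abs_le_iff)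
  have "Im ?z = expectation (\<lambda>w. sin (U w + V w)) -
      (expectation (\<lambda>w. cos (U w)) * expectation (\<lambda>w. sin (V w)) + expectation (\<lambda>w. sin (U w)) * expectation (\<lambda>w. cos (V w)))"
    unfolding minus_complex.sel times_complex.sel ImE[OF m'] ReE[OF m(1)] ReE[OF m(2)] ImE[OF m(1)] ImE[OF m(2)] ..
  also have "expectation (\<lambda>w. sin (U w + V w)) = expectation (\<lambda>w. sin (U w) * cos (V w)) + expectation (\<lambda>w. cos (U w) * sin (V w))"
    using JJ by (simp add: sin_add)
  finally have Im: "\<bar>Im ?z\<bar> \<le> 8 * a" using bb by (simp add: abs_le_iff)
  show ?thesis using cmod_le[of ?z] R Im by linarith
qed

text \<open>Davydov's inequality up to the value of the constant; the truncation level is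
  \<open>b powr (- 1 / \<gamma>)\<close>.\<close>

lemma (in prob_space) covariance_bound_truncation:
  assumes FA: "space FA = space M" "sets FA \<subseteq> sets M"
    and FB: "space FB = space M" "sets FB \<subseteq> sets M"
    and b: "\<And>A B. A \<in> sets FA \<Longrightarrow> B \<in> sets FB \<Longrightarrow> \<bar>prob (A \<inter> B) - prob A * prob B\<bar> \<le> b" "0 < b"
    and \<gamma>: "\<gamma> > 2"
    and U: "U \<in> borel_measurable FA" "integrable M (\<lambda>w. \<bar>U w\<bar> powr \<gamma>)" "expectation (\<lambda>w. \<bar>U w\<bar> powr \<gamma>) \<le> C"
    and V: "V \<in> borel_measurable FB" "integrable M (\<lambda>w. \<bar>V w\<bar> powr \<gamma>)" "expectation (\<lambda>w. \<bar>V w\<bar> powr \<gamma>) \<le> C"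
    and U0: "integrable M U" "expectation U = (0::real)"
  shows "\<bar>expectation (\<lambda>w. U w * V w)\<bar> \<le> (4 + 3 * C) * b powr ((\<gamma> - 2) / \<gamma>)"
proof -
  define T where "T = b powr (- 1 / \<gamma>)"
  have T: "T > 0" using b(2) by (simp add: T_def)
  define U' where "U' w = (if \<bar>U w\<bar> \<le> T then U w else 0)" for w
  define V' where "V' w = (if \<bar>V w\<bar> \<le> T then V w else 0)" for w
  have subA: "subalgebra M FA" and subB: "subalgebra M FB"
    using FA FB by (auto simp: subalgebra_def)
  have [measurable]: "U \<in> borel_measurable M" "V \<in> borel_measurable M"
    using measurable_from_subalg[OF subA U(1)] measurable_from_subalg[OF subB V(1)] by auto
  have mA: "U' \<in> borel_measurable FA" unfolding U'_def using U(1) by measurable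
  have mB: "V' \<in> borel_measurable FB" unfolding V'_def using V(1) by measurable
  have [measurable]: "U' \<in> borel_measurable M" "V' \<in> borel_measurable M"
    using measurable_from_subalg[OF subA mA] measurable_from_subalg[OF subB mB] by auto
  have bU: "\<bar>U' w\<bar> \<le> T" and bV: "\<bar>V' w\<bar> \<le> T" for w using T by (auto simp: U'_def V'_def)
  have iU: "integrable M U'" "integrable M V'"
    by (rule integrable_const_bound[of _ T]; use bU bV in auto)+
  have iUV': "integrable M (\<lambda>w. U' w * V' w)"
    by (rule integrable_const_bound[of _ "T * T"]) (use bU bV T in \<open>auto simp: abs_mult intro!: mult_mono\<close>)
  \<comment> \<open>Above the level \<open>T\<close> lower powers are paid for by the \<gamma>-th
    one: since x / T >= 1, x^c = T^c (x/T)^c <= T^c (x/T)^\<gamma> for c = 1, 2.\<close>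
  have sq: "x\<^sup>2 \<le> x powr \<gamma> * T powr (2 - \<gamma>)" and lin: "x \<le> x powr \<gamma> * T powr (1 - \<gamma>)"
    if "T < x" for x :: real
  proof -
    have x: "1 \<le> x / T" "x > 0" using that T by auto
    have e: "x powr \<gamma> * T powr (c - \<gamma>) = T powr c * (x / T) powr \<gamma>" for c
      using x T by (simp add: powr_divide powr_diff)
    have "x\<^sup>2 = T powr 2 * (x / T) powr 2" using x T by (simp add: power_divide)
    also have "\<dots> \<le> T powr 2 * (x / T) powr \<gamma>"
      using x \<gamma> by (intro mult_left_mono powr_mono) auto
    finally show "x\<^sup>2 \<le> x powr \<gamma> * T powr (2 - \<gamma>)" unfolding e .
    have "x = T powr 1 * (x / T) powr 1" using x T by simp
    also have "\<dots> \<le> T powr 1 * (x / T) powr \<gamma>"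
      using x \<gamma> by (intro mult_left_mono powr_mono) auto
    finally show "x \<le> x powr \<gamma> * T powr (1 - \<gamma>)" unfolding e .
  qed
  have d: "\<bar>U w * V w - U' w * V' w\<bar> \<le> (\<bar>U w\<bar> powr \<gamma> + \<bar>V w\<bar> powr \<gamma>) * T powr (2 - \<gamma>)" for w
  proof (cases "max \<bar>U w\<bar> \<bar>V w\<bar> \<le> T")
    case True
    then show ?thesis by (simp add: U'_def V'_def)
  next
    case False
    let ?m = "max \<bar>U w\<bar> \<bar>V w\<bar>"
    have "\<bar>U w * V w - U' w * V' w\<bar> \<le> \<bar>U w\<bar> * \<bar>V w\<bar>"
      using False by (auto simp: U'_def V'_def abs_mult)
    also have "\<dots> \<le> ?m\<^sup>2" unfolding power2_eq_square by (intro mult_mono) auto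
    also have "\<dots> \<le> ?m powr \<gamma> * T powr (2 - \<gamma>)" using False by (intro sq) auto
    also have "\<dots> \<le> (\<bar>U w\<bar> powr \<gamma> + \<bar>V w\<bar> powr \<gamma>) * T powr (2 - \<gamma>)"
      by (intro mult_right_mono) (auto simp: max_def)
    finally show ?thesis .
  qed
  have dU: "\<bar>U w - U' w\<bar> \<le> \<bar>U w\<bar> powr \<gamma> * T powr (1 - \<gamma>)" for w
    using lin[of "\<bar>U w\<bar>"] by (auto simp: U'_def)
  have iD: "integrable M (\<lambda>w. (\<bar>U w\<bar> powr \<gamma> + \<bar>V w\<bar> powr \<gamma>) * T powr (2 - \<gamma>))"
    using U V by simp
  have iDiff: "integrable M (\<lambda>w. U w * V w - U' w * V' w)"
    by (rule Bochner_Integration.integrable_bound[OF iD]) (use d in \<open>auto intro: order_trans\<close>)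
  have iUV: "integrable M (\<lambda>w. U w * V w)"
    using Bochner_Integration.integrable_add[OF iDiff iUV'] by simp
  have "\<bar>expectation (\<lambda>w. U w * V w) - expectation (\<lambda>w. U' w * V' w)\<bar>
      = \<bar>expectation (\<lambda>w. U w * V w - U' w * V' w)\<bar>" using iUV iUV' by simp
  also have "\<dots> \<le> expectation (\<lambda>w. \<bar>U w * V w - U' w * V' w\<bar>)" by (rule integral_abs_bound)
  also have "\<dots> \<le> expectation (\<lambda>w. (\<bar>U w\<bar> powr \<gamma> + \<bar>V w\<bar> powr \<gamma>) * T powr (2 - \<gamma>))"
    by (rule integral_mono) (use iDiff iD d in auto)
  also have "\<dots> \<le> (2 * C) * T powr (2 - \<gamma>)" using U V by (simp add: mult_right_mono)
  finally have e1: "\<bar>expectation (\<lambda>w. U w * V w) - expectation (\<lambda>w. U' w * V' w)\<bar> \<le> 2 * C * T powr (2 - \<gamma>)" .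
  have e2: "\<bar>expectation (\<lambda>w. U' w * V' w) - expectation U' * expectation V'\<bar> \<le> 4 * T\<^sup>2 * b"
    by (rule cov_bound_bounded[OF FA FB b(1) mA bU mB bV T])
  \<comment> \<open>Centering of \<open>U\<close> turns the mean of \<open>U'\<close> into a tail
    mean, of order T^(1-\<gamma>). Against the trivial bound \<open>T\<close> for the mean of
    \<open>V'\<close> the product of the means is again of order T^(2-\<gamma>).\<close>
  have "\<bar>expectation U'\<bar> = \<bar>expectation (\<lambda>w. U w - U' w)\<bar>" using U0 iU by simp
  also have "\<dots> \<le> expectation (\<lambda>w. \<bar>U w - U' w\<bar>)" by (rule integral_abs_bound)
  also have "\<dots> \<le> expectation (\<lambda>w. \<bar>U w\<bar> powr \<gamma> * T powr (1 - \<gamma>))"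
    by (rule integral_mono) (use U0 iU U dU in auto)
  also have "\<dots> \<le> C * T powr (1 - \<gamma>)" using U by (simp add: mult_right_mono)
  finally have e3: "\<bar>expectation U'\<bar> \<le> C * T powr (1 - \<gamma>)" .
  have C0: "0 \<le> C" using order_trans[OF _ U(3)] by (simp add: Bochner_Integration.integral_nonneg)
  have "\<bar>expectation V'\<bar> \<le> expectation (\<lambda>w. \<bar>V' w\<bar>)" by (rule integral_abs_bound)
  also have "\<dots> \<le> expectation (\<lambda>w. T)" by (rule integral_mono) (use iU bV in auto)
  finally have "\<bar>expectation V'\<bar> \<le> T" by (simp add: prob_space)
  then have "\<bar>expectation U' * expectation V'\<bar> \<le> (C * T powr (1 - \<gamma>)) * T"
    unfolding abs_mult using e3 C0 by (intro mult_mono) auto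
  also have "\<dots> = C * T powr (2 - \<gamma>)" using T by (simp add: powr_diff power2_eq_square)
  \<comment> \<open>\<open>3 * C\<close> is \<open>2 * C\<close> from the truncation error plus
    \<open>C\<close> from the product of the means. The choice of \<open>T\<close> makes both
    T^(2-\<gamma>) and T^2 b equal to the claimed power of \<open>b\<close>.\<close>
  finally have "\<bar>expectation (\<lambda>w. U w * V w)\<bar> \<le> 3 * C * T powr (2 - \<gamma>) + 4 * T\<^sup>2 * b"
    using e1 e2 by linarith
  also have "T powr (2 - \<gamma>) = b powr ((\<gamma> - 2) / \<gamma>)"
  proof -
    have "(- 1 / \<gamma>) * (2 - \<gamma>) = (\<gamma> - 2) / \<gamma>" using \<gamma> by (simp add: field_simps)
    then show ?thesis unfolding T_def powr_powr by simp
  qed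
  also have "4 * T\<^sup>2 * b = 4 * b powr ((\<gamma> - 2) / \<gamma>)"
  proof -
    have "T\<^sup>2 * b = b powr (- 2 / \<gamma>) * b powr 1"
      using b(2) by (simp add: T_def power2_eq_square flip: powr_add)
    also have "\<dots> = b powr ((\<gamma> - 2) / \<gamma>)"
    proof -
      have "- 2 / \<gamma> + 1 = (\<gamma> - 2) / \<gamma>" using \<gamma> by (simp add: field_simps)
      then show ?thesis unfolding powr_add[symmetric] by simp
    qed
    finally show ?thesis by simp
  qed
  finally show ?thesis by (simp add: algebra_simps)
qed

section \<open>From absolute regularity to single pairs of events\<close>

lemma (in prob_space) sum_prob_partition:
  assumes "finite P" "partition_on (space M) P" "P \<subseteq> events" "B \<in> events"
  shows "(\<Sum>A\<in>P. prob (A \<inter> B)) = prob B"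
proof -
  have "prob (\<Union>A\<in>P. A \<inter> B) = (\<Sum>A\<in>P. prob (A \<inter> B))"
    by (rule finite_measure_finite_Union)
      (use assms in \<open>auto simp: disjoint_family_on_def dest: partition_onD2[THEN disjointD]\<close>)
  moreover have "(\<Union>A\<in>P. A \<inter> B) = B"
    using assms(2) sets.sets_into_space[OF assms(4)] by (auto simp: partition_on_def)
  ultimately show ?thesis by simp
qed

text \<open>Joint and product probabilities each sum to 1 over a pair of partitions, so the sums are
  bounded by 2 and the real-valued supremum is a genuine one. The trivial partition then gives
  nonnegativity, and the partitions into an event and its complement give the event bound; the
  factor 2 undoes the 1/2 in \<open>beta_coeff\<close>.\<close>

lemma (in prob_space) beta_coeff_bounds:
  assumes A1: "sigma_algebra (space M) \<A>1" "\<A>1 \<subseteq> events"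
    and A2: "sigma_algebra (space M) \<A>2" "\<A>2 \<subseteq> events"
  shows "0 \<le> beta_coeff M \<A>1 \<A>2"
    and "A \<in> \<A>1 \<Longrightarrow> B \<in> \<A>2 \<Longrightarrow> \<bar>prob (A \<inter> B) - prob A * prob B\<bar> \<le> 2 * beta_coeff M \<A>1 \<A>2"
proof -
  define S where "S = {(P, Q). finite P \<and> partition_on (space M) P \<and> P \<subseteq> \<A>1 \<and>
                                     finite Q \<and> partition_on (space M) Q \<and> Q \<subseteq> \<A>2}"
  define F where "F = (\<lambda>(P, Q). \<Sum>(A, B) \<in> P \<times> Q. \<bar>prob (A \<inter> B) - prob A * prob B\<bar>)"
  have beta: "beta_coeff M \<A>1 \<A>2 = (1/2) * (SUP x\<in>S. F x)"
    unfolding beta_coeff_def S_def F_def by (simp add: case_prod_unfold)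
  have "F (P, Q) \<le> 2" if "(P, Q) \<in> S" for P Q
  proof -
    have P: "finite P" "partition_on (space M) P" "P \<subseteq> events"
      and Q: "finite Q" "partition_on (space M) Q" "Q \<subseteq> events" using that A1 A2 by (auto simp: S_def)
    have "F (P, Q) = (\<Sum>A\<in>P. \<Sum>B\<in>Q. \<bar>prob (A \<inter> B) - prob A * prob B\<bar>)"
      unfolding F_def prod.case by (rule sum.cartesian_product[symmetric])
    also have "\<dots> \<le> (\<Sum>A\<in>P. \<Sum>B\<in>Q. prob (A \<inter> B) + prob A * prob B)"
      by (intro sum_mono) (simp add: abs_le_iff add_increasing)
    also have "\<dots> = (\<Sum>A\<in>P. \<Sum>B\<in>Q. prob (A \<inter> B)) + (\<Sum>A\<in>P. prob A) * (\<Sum>B\<in>Q. prob B)"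
      by (simp only: sum.distrib sum_product)
    also have "(\<Sum>A\<in>P. \<Sum>B\<in>Q. prob (A \<inter> B)) = (\<Sum>B\<in>Q. \<Sum>A\<in>P. prob (A \<inter> B))"
      by (rule sum.swap)
    also have "(\<Sum>B\<in>Q. \<Sum>A\<in>P. prob (A \<inter> B)) = (\<Sum>B\<in>Q. prob B)"
      using sum_prob_partition[OF P] Q by (intro sum.cong) auto
    also have "(\<Sum>B\<in>Q. prob B) = (\<Sum>B\<in>Q. prob (B \<inter> space M))"
      using Q by (intro sum.cong) (auto simp: subset_eq)
    also have "\<dots> = 1" using sum_prob_partition[OF Q sets.top] by (simp add: prob_space)
    also have "(\<Sum>A\<in>P. prob A) = (\<Sum>A\<in>P. prob (A \<inter> space M))"
      using P by (intro sum.cong) (auto simp: subset_eq)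
    also have "\<dots> = 1" using sum_prob_partition[OF P sets.top] by (simp add: prob_space)
    finally show ?thesis by simp
  qed
  then have bdd: "bdd_above (F ` S)" by (intro bdd_aboveI[of _ 2]) auto
  interpret A1: sigma_algebra "space M" \<A>1 by fact
  interpret A2: sigma_algebra "space M" \<A>2 by fact
  have triv: "({space M}, {space M}) \<in> S"
    using not_empty by (auto simp: S_def partition_on_def disjoint_def)
  have "0 \<le> F ({space M}, {space M})" by (simp add: F_def)
  also have "\<dots> \<le> (SUP x\<in>S. F x)" by (rule cSUP_upper[OF triv bdd])
  finally show nonneg: "0 \<le> beta_coeff M \<A>1 \<A>2" by (simp add: beta)
  assume AB: "A \<in> \<A>1" "B \<in> \<A>2"
  show "\<bar>prob (A \<inter> B) - prob A * prob B\<bar> \<le> 2 * beta_coeff M \<A>1 \<A>2"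
  proof (cases "A = {} \<or> B = {}")
    case True
    then show ?thesis using nonneg by auto
  next
    case False
    \<comment> \<open>The empty set is removed because \<open>partition_on\<close> forbids empty
      blocks and the complement is empty when \<open>A\<close> is the whole space.\<close>
    define P where "P = {A, space M - A} - {{}}"
    define Q where "Q = {B, space M - B} - {{}}"
    have sub: "A \<subseteq> space M" "B \<subseteq> space M" using AB A1.sets_into_space A2.sets_into_space by auto
    have part: "partition_on (space M) ({C, space M - C} - {{}})" if "C \<subseteq> space M" for C
      using that unfolding partition_on_def disjoint_def by blast
    have "P \<subseteq> \<A>1" "Q \<subseteq> \<A>2" using AB by (auto simp: P_def Q_def)
    then have PQ: "(P, Q) \<in> S"
      using part[OF sub(1)] part[OF sub(2)] unfolding S_def P_def Q_def by simp
    have "\<bar>prob (A \<inter> B) - prob A * prob B\<bar> = (\<Sum>(A, B) \<in> {(A, B)}. \<bar>prob (A \<inter> B) - prob A * prob B\<bar>)" by simp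
    also have "\<dots> \<le> F (P, Q)"
      unfolding F_def prod.case by (rule sum_mono2) (use False in \<open>auto simp: P_def Q_def\<close>)
    also have "\<dots> \<le> (SUP x\<in>S. F x)" by (rule cSUP_upper[OF PQ bdd])
    finally show ?thesis by (simp add: beta)
  qed
qed

text \<open>\<open>sigma_rv\<close> is a bare set of events, whereas measurability with respect to
  it needs a \<open>measure\<close> object. Only the space and the sets of this object
  matter.\<close>

definition sigma_rv_gen :: "'w measure \<Rightarrow> ('i \<Rightarrow> 'w \<Rightarrow> 'a::topological_space) \<Rightarrow> 'i set \<Rightarrow> 'w measure" where
  "sigma_rv_gen M X I = sigma (space M) (\<Union>i\<in>I. {X i -` B \<inter> space M | B. B \<in> sets borel})"

lemma space_sigma_rv_gen [simp]: "space (sigma_rv_gen M X I) = space M"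
  and sets_sigma_rv_gen: "sets (sigma_rv_gen M X I) = sigma_rv M X I"
  unfolding sigma_rv_gen_def sigma_rv_def
  by (auto intro!: space_measure_of sets_measure_of)

lemma sigma_algebra_sigma_rv: "sigma_algebra (space M) (sigma_rv M X I)"
  using sets.sigma_algebra_axioms[of "sigma_rv_gen M X I"] by (simp add: sets_sigma_rv_gen)

lemma sigma_rv_subset_sets:
  assumes "\<And>i. i \<in> I \<Longrightarrow> X i \<in> borel_measurable M"
  shows "sigma_rv M X I \<subseteq> sets M"
  unfolding sigma_rv_def using assms by (intro sets.sigma_sets_subset) (auto intro: measurable_sets)

lemma sigma_rv_mono:
  assumes "I \<subseteq> J" shows "sigma_rv M X I \<subseteq> sigma_rv M X J"
  unfolding sigma_rv_def using assms by (intro sigma_sets_mono') auto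

lemma sigma_rv_empty: "sigma_rv M X {} = {{}, space M}"
  unfolding sigma_rv_def by (simp add: sigma_sets_empty_eq)

lemma measurable_sigma_rv_gen:
  fixes X :: "'i \<Rightarrow> 'w \<Rightarrow> 'a::topological_space"
  assumes "i \<in> I" shows "X i \<in> borel_measurable (sigma_rv_gen M X I)"
proof (rule measurableI)
  fix B :: "'a set" assume "B \<in> sets borel"
  then show "X i -` B \<inter> space (sigma_rv_gen M X I) \<in> sets (sigma_rv_gen M X I)"
    unfolding sets_sigma_rv_gen space_sigma_rv_gen sigma_rv_def using assms
    by (intro sigma_sets.Basic) auto
qed simp

text \<open>Lets mixing of the vectors pass to functions of them, such as centered projections. In
  the proof \<open>sigma_rv_gen M X I\<close> takes the place of \<open>M\<close>, since
  \<open>sigma_rv\<close> depends on its measure only through the space.\<close>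

lemma sigma_rv_compose_subset:
  assumes "\<And>i. i \<in> I \<Longrightarrow> h i \<in> borel_measurable borel"
  shows "sigma_rv M (\<lambda>i w. h i (X i w)) I \<subseteq> sigma_rv M X I"
proof -
  have "(\<lambda>w. h i (X i w)) \<in> borel_measurable (sigma_rv_gen M X I)" if "i \<in> I" for i
    using measurable_compose[OF measurable_sigma_rv_gen[OF that] assms[OF that]] .
  from sigma_rv_subset_sets[OF this]
  have "sigma_rv (sigma_rv_gen M X I) (\<lambda>i w. h i (X i w)) I \<subseteq> sigma_rv M X I"
    by (simp add: sets_sigma_rv_gen)
  then show ?thesis by (simp add: sigma_rv_def)
qed

lemma (in prob_space) row_beta_nonneg:
  assumes "\<And>i. i \<in> {1..m} \<Longrightarrow> X i \<in> borel_measurable M"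
  shows "0 \<le> row_beta M X m p"
proof (cases "p < m")
  case True
  let ?f = "\<lambda>j. beta_coeff M (sigma_rv M X {1..j}) (sigma_rv M X {j + p..m})"
  have "0 \<le> ?f 1"
    using True assms by (intro beta_coeff_bounds sigma_algebra_sigma_rv sigma_rv_subset_sets) auto
  also have "\<dots> \<le> (SUP j\<in>{1..m-p}. ?f j)" using True by (intro cSUP_upper) auto
  finally show ?thesis using True by (simp add: row_beta_def)
qed (simp add: row_beta_def)

text \<open>Splitting the row at the largest index \<open>a\<close> of \<open>I\<close> puts
  \<open>I\<close> into the past \<open>{1..a}\<close> and \<open>J\<close> into the future
  \<open>{a + p..m}\<close>, a pair that occurs in the supremum. If \<open>I\<close> or
  \<open>J\<close> is empty there may be no admissible split, but then one of the two sigma-algebras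
  is trivial and the difference is 0.\<close>

lemma (in prob_space) row_beta_separated:
  assumes X: "\<And>i. i \<in> {1..m} \<Longrightarrow> X i \<in> borel_measurable M"
    and IJ: "I \<subseteq> {1..m}" "J \<subseteq> {1..m}" "\<And>i j. i \<in> I \<Longrightarrow> j \<in> J \<Longrightarrow> i + p \<le> j"
    and AB: "A \<in> sigma_rv M X I" "B \<in> sigma_rv M X J"
  shows "\<bar>prob (A \<inter> B) - prob A * prob B\<bar> \<le> 2 * row_beta M X m p"
proof (cases "I = {} \<or> J = {}")
  case True
  have sub: "sigma_rv M X K \<subseteq> events" if "K \<subseteq> {1..m}" for K
    by (rule sigma_rv_subset_sets) (rule X, rule subsetD[OF that])
  have "A \<in> events" "B \<in> events"
    using subsetD[OF sub[OF IJ(1)] AB(1)] subsetD[OF sub[OF IJ(2)] AB(2)] .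
  then have "A \<subseteq> space M" "B \<subseteq> space M" by (auto dest: sets.sets_into_space)
  moreover have "A = {} \<or> A = space M \<or> B = {} \<or> B = space M"
    using True AB by (auto simp: sigma_rv_empty)
  ultimately have "prob (A \<inter> B) = prob A * prob B"
    by (auto simp: prob_space Int_absorb1 Int_absorb2)
  then show ?thesis using row_beta_nonneg[where m = m and p = p, OF X] by simp
next
  case False
  define a where "a = Max I"
  have fin: "finite I" using finite_subset[OF IJ(1)] by simp
  have aI: "a \<in> I" unfolding a_def using fin False by simp
  have I: "I \<subseteq> {1..a}" using IJ fin by (auto simp: a_def)
  have J: "J \<subseteq> {a + p..m}" using IJ aI by auto
  have a: "1 \<le> a" "a + p \<le> m" using aI IJ False J by auto
  let ?f = "\<lambda>j. beta_coeff M (sigma_rv M X {1..j}) (sigma_rv M X {j + p..m})"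
  have "\<bar>prob (A \<inter> B) - prob A * prob B\<bar> \<le> 2 * ?f a"
  proof (rule beta_coeff_bounds(2))
    show "A \<in> sigma_rv M X {1..a}" "B \<in> sigma_rv M X {a + p..m}"
      using subsetD[OF sigma_rv_mono[OF I] AB(1)] subsetD[OF sigma_rv_mono[OF J] AB(2)] .
  qed (intro sigma_algebra_sigma_rv sigma_rv_subset_sets; use a X in auto)+
  also have "?f a \<le> (SUP j\<in>{1..m-p}. ?f j)" using a by (intro cSUP_upper) auto
  also have "\<dots> = row_beta M X m p" using a by (auto simp: row_beta_def)
  finally show ?thesis by simp
qed

section \<open>A quantitative central limit theorem for one mixing row\<close>

lemma sum_swap3:
  "(\<Sum>a\<in>A. \<Sum>b\<in>B. \<Sum>c\<in>C. f a b c) = (\<Sum>b\<in>B. \<Sum>c\<in>C. \<Sum>a\<in>A. f a b c)"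
  by (subst sum.swap) (intro sum.cong refl sum.swap)

text \<open>Jensen's inequality for the power function. The convexity fact lives on the open
  half-line, so vanishing terms are first removed (\<open>B'\<close>). A bound \<open>n\<close> in
  place of the cardinality lets blocks of different sizes share one factor.\<close>

lemma powr_sum_le:
  fixes a :: "'i \<Rightarrow> real"
  assumes "finite B" "card B \<le> n" "1 \<le> \<gamma>"
  shows "\<bar>\<Sum>i\<in>B. a i\<bar> powr \<gamma> \<le> real n powr (\<gamma> - 1) * (\<Sum>i\<in>B. \<bar>a i\<bar> powr \<gamma>)"
proof -
  define B' where "B' = {i \<in> B. a i \<noteq> 0}"
  have B': "finite B'" "card B' \<le> n"
    using assms card_mono[of B B'] by (auto simp: B'_def)
  have e1: "(\<Sum>i\<in>B. a i) = (\<Sum>i\<in>B'. a i)" and e2: "(\<Sum>i\<in>B. \<bar>a i\<bar> powr \<gamma>) = (\<Sum>i\<in>B'. \<bar>a i\<bar> powr \<gamma>)"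
    unfolding B'_def using assms(1) by (auto intro: sum.mono_neutral_right)
  show ?thesis
  proof (cases "B' = {}")
    case True
    then show ?thesis unfolding e1 e2 by simp
  next
    case False
    define N where "N = real (card B')"
    have N: "N > 0" "N \<le> real n" using B' False by (auto simp: N_def card_gt_0_iff)
    have "(\<Sum>i\<in>B'. (1 / N) *\<^sub>R \<bar>a i\<bar>) powr \<gamma> \<le> (\<Sum>i\<in>B'. (1 / N) * \<bar>a i\<bar> powr \<gamma>)"
    proof (rule convex_on_sum[OF B'(1) False powr_convex[OF assms(3)]])
      show "(\<Sum>i\<in>B'. 1 / N) = 1" using N by (simp add: N_def)
      show "\<bar>a i\<bar> \<in> {0<..}" if "i \<in> B'" for i using that by (simp add: B'_def)
    qed (use N in auto)
    also have "(\<Sum>i\<in>B'. (1 / N) *\<^sub>R \<bar>a i\<bar>) = (\<Sum>i\<in>B'. \<bar>a i\<bar>) / N"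
      by (simp add: sum_divide_distrib)
    also have "(\<Sum>i\<in>B'. (1 / N) * \<bar>a i\<bar> powr \<gamma>) = (\<Sum>i\<in>B'. \<bar>a i\<bar> powr \<gamma>) / N"
      by (simp add: sum_divide_distrib)
    finally have "(\<Sum>i\<in>B'. \<bar>a i\<bar>) powr \<gamma> / N powr \<gamma> \<le> (\<Sum>i\<in>B'. \<bar>a i\<bar> powr \<gamma>) / N"
      using N by (simp add: powr_divide sum_nonneg)
    then have "(\<Sum>i\<in>B'. \<bar>a i\<bar>) powr \<gamma> \<le> N powr (\<gamma> - 1) * (\<Sum>i\<in>B'. \<bar>a i\<bar> powr \<gamma>)"
      using N by (simp add: powr_diff field_simps)
    also have "\<dots> \<le> real n powr (\<gamma> - 1) * (\<Sum>i\<in>B'. \<bar>a i\<bar> powr \<gamma>)"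
      using N assms(3) by (intro mult_right_mono powr_mono2 sum_nonneg) auto
    finally have "(\<Sum>i\<in>B'. \<bar>a i\<bar>) powr \<gamma> \<le> real n powr (\<gamma> - 1) * (\<Sum>i\<in>B'. \<bar>a i\<bar> powr \<gamma>)" .
    moreover have "\<bar>\<Sum>i\<in>B'. a i\<bar> powr \<gamma> \<le> (\<Sum>i\<in>B'. \<bar>a i\<bar>) powr \<gamma>"
      using assms(3) by (intro powr_mono2 sum_abs) auto
    ultimately show ?thesis unfolding e1 e2 by linarith
  qed
qed

lemma abs_power_le_one_plus_powr:
  fixes x \<gamma> :: real assumes "real n \<le> \<gamma>"
  shows "\<bar>x\<bar> ^ n \<le> 1 + \<bar>x\<bar> powr \<gamma>"
proof (cases "\<bar>x\<bar> \<le> 1")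
  case True
  then have "\<bar>x\<bar> ^ n \<le> 1" by (simp add: power_le_one)
  then show ?thesis by (simp add: add_increasing2)
next
  case False
  then have "\<bar>x\<bar> powr real n \<le> \<bar>x\<bar> powr \<gamma>" using assms by (intro powr_mono) auto
  then show ?thesis using False by (simp add: powr_realpow)
qed

lemma abs_mult_le_sum_squares: "\<bar>x * y\<bar> \<le> x\<^sup>2 + y\<^sup>2" for x y :: real
  using sum_squares_bound[of "\<bar>x\<bar>" "\<bar>y\<bar>"] mult_nonneg_nonneg[OF abs_ge_zero abs_ge_zero, of x y]
  unfolding abs_mult mult.assoc power2_abs by linarith

lemma integrable_mult_square_integrable:
  fixes f g :: "'a \<Rightarrow> real"
  assumes "f \<in> borel_measurable M" "g \<in> borel_measurable M"
    and "integrable M (\<lambda>w. (f w)\<^sup>2)" "integrable M (\<lambda>w. (g w)\<^sup>2)"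
  shows "integrable M (\<lambda>w. f w * g w)"
proof (rule Bochner_Integration.integrable_bound)
  show "integrable M (\<lambda>w. (f w)\<^sup>2 + (g w)\<^sup>2)" using assms by simp
  show "AE w in M. norm (f w * g w) \<le> norm ((f w)\<^sup>2 + (g w)\<^sup>2)"
    using abs_mult_le_sum_squares by simp
qed (use assms in simp)

lemma (in finite_measure) integrable_square_of_powr:
  fixes f :: "'a \<Rightarrow> real"
  assumes "f \<in> borel_measurable M" "integrable M (\<lambda>w. \<bar>f w\<bar> powr \<gamma>)" "2 \<le> \<gamma>"
  shows "integrable M (\<lambda>w. (f w)\<^sup>2)"
proof (rule Bochner_Integration.integrable_bound)
  show "integrable M (\<lambda>w. 1 + \<bar>f w\<bar> powr \<gamma>)" using assms by simp
  show "AE w in M. norm ((f w)\<^sup>2) \<le> norm (1 + \<bar>f w\<bar> powr \<gamma>)"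
    using abs_power_le_one_plus_powr[of 2 \<gamma>] assms(3) by (simp add: add_increasing)
qed (use assms in simp)

text \<open>Distinct shifts below \<open>L\<close> give distinct residues, so a fixed index falls
  into the gaps for few shifts only; this is the count behind the averaging argument.\<close>

lemma card_residue_shift_le: "card {s. s < L \<and> (i + s) mod L < p} \<le> p" for L p i :: nat
proof -
  have inj: "inj_on (\<lambda>s. (i + s) mod L) {s. s < L \<and> (i + s) mod L < p}"
  proof (rule inj_onI)
    have wlog: "s = s'" if "s \<le> s'" "s' < L" "(i + s) mod L = (i + s') mod L" for s s'
    proof -
      have "L dvd (i + s') - (i + s)" using that by (metis mod_eq_dvd_iff_nat add_le_cancel_left)
      then have "L dvd s' - s" by simp
      then show ?thesis using that by (metis diff_is_0_eq dvd_imp_le le_antisym less_imp_diff_less not_le neq0_conv)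
    qed
    fix s s' assume "s \<in> {s. s < L \<and> (i + s) mod L < p}" "s' \<in> {s. s < L \<and> (i + s) mod L < p}"
      "(i + s) mod L = (i + s') mod L"
    then show "s = s'" using wlog[of s s'] wlog[of s' s] by (cases "s \<le> s'") auto
  qed
  have "card {s. s < L \<and> (i + s) mod L < p} \<le> card {..<p}"
    by (rule card_inj_on_le[OF inj]) auto
  then show ?thesis by simp
qed

text \<open>By averaging over the shifts. This is how the summability of the covariances lets the gaps between
  blocks be negligible although they are only short relative to the blocks, wherever the covariances concentrate.\<close>

lemma exists_light_shift:
  fixes f :: "nat \<Rightarrow> real" and L p :: nat
  assumes A: "finite A" and f: "\<And>i. i \<in> A \<Longrightarrow> 0 \<le> f i" and L: "0 < L"
  obtains s where "s < L" "(\<Sum>i\<in>{i \<in> A. (i + s) mod L < p}. f i) \<le> real p / real L * (\<Sum>i\<in>A. f i)"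
proof (rule ccontr)
  note witness = that
  assume "\<not> thesis"
  then have *: "real p / real L * (\<Sum>i\<in>A. f i) < (\<Sum>i\<in>{i \<in> A. (i + s) mod L < p}. f i)" if "s < L" for s
    using witness[OF that] by (meson not_le)
  have "real p * (\<Sum>i\<in>A. f i) = (\<Sum>s<L. real p / real L * (\<Sum>i\<in>A. f i))" using L by simp
  also have "\<dots> < (\<Sum>s<L. \<Sum>i\<in>{i \<in> A. (i + s) mod L < p}. f i)"
    using * L by (intro sum_strict_mono) auto
  also have "\<dots> = (\<Sum>s<L. \<Sum>i\<in>A. if (i + s) mod L < p then f i else 0)"
    using A by (simp add: sum.inter_filter)
  also have "\<dots> = (\<Sum>i\<in>A. \<Sum>s<L. if (i + s) mod L < p then f i else 0)" by (rule sum.swap)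
  also have "\<dots> = (\<Sum>i\<in>A. real (card {s. s < L \<and> (i + s) mod L < p}) * f i)"
    by (intro sum.cong) (auto simp: sum.If_cases Int_def)
  also have "\<dots> \<le> (\<Sum>i\<in>A. real p * f i)"
    using f card_residue_shift_le by (intro sum_mono mult_right_mono) auto
  finally show False by (simp add: sum_distrib_left)
qed

text \<open>As \<gamma> may be below 3, the cubic remainder serves only for |x| <= \<epsilon>. For
  larger |x| the quadratic remainder becomes a \<gamma>-th power through x^2 = |x|^\<gamma>
  |x|^(2-\<gamma>), whose last factor is decreasing in |x|.\<close>

lemma iexp_lindeberg_bound:
  assumes "\<epsilon> > 0" "\<gamma> > 2"
  shows "cmod (iexp x - (1 + \<i> * x - x\<^sup>2 / 2)) \<le> \<epsilon> * x\<^sup>2 + \<epsilon> powr (2 - \<gamma>) * \<bar>x\<bar> powr \<gamma>"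
proof -
  have e: "(\<Sum>k \<le> (2::nat). (\<i> * complex_of_real x)^k / fact k) = 1 + \<i> * x - x\<^sup>2 / 2"
    by (simp add: numeral_2_eq_2 power_mult_distrib)
  show ?thesis
  proof (cases "\<bar>x\<bar> \<le> \<epsilon>")
    case True
    have "cmod (iexp x - (1 + \<i> * x - x\<^sup>2 / 2)) \<le> \<bar>x\<bar> ^ 3 / 6"
      using iexp_approx1[of x 2] unfolding e by (simp add: eval_nat_numeral)
    also have "\<dots> \<le> \<bar>x\<bar> ^ 3" by simp
    also have "\<dots> = \<bar>x\<bar> * x\<^sup>2" by (simp add: power3_eq_cube power2_eq_square)
    also have "\<dots> \<le> \<epsilon> * x\<^sup>2" using True by (intro mult_right_mono) auto
    finally show ?thesis by (simp add: add_increasing2)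
  next
    case False
    have "cmod (iexp x - (1 + \<i> * x - x\<^sup>2 / 2)) \<le> \<bar>x\<bar>\<^sup>2"
      using iexp_approx2[of x 2] unfolding e by (simp add: eval_nat_numeral)
    also have "\<dots> = \<bar>x\<bar> powr \<gamma> * \<bar>x\<bar> powr (2 - \<gamma>)"
      using False assms by (simp flip: powr_add)
    also have "\<dots> \<le> \<bar>x\<bar> powr \<gamma> * \<epsilon> powr (2 - \<gamma>)"
      using False assms by (intro mult_left_mono powr_mono2') auto
    also have "\<dots> \<le> \<epsilon> * x\<^sup>2 + \<epsilon> powr (2 - \<gamma>) * \<bar>x\<bar> powr \<gamma>" using assms by (simp add: mult.commute)
    finally show ?thesis .
  qed
qed

lemma exp_minus_taylor_bound:
  fixes x :: real assumes "0 \<le> x"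
  shows "\<bar>exp (- x) - (1 - x)\<bar> \<le> x\<^sup>2"
proof -
  \<comment> \<open>The right-hand side equals 1 + x^3.\<close>
  have "1 \<le> (1 + x) * (1 - x + x\<^sup>2)"
    using assms by (simp add: algebra_simps power2_eq_square)
  then have "1 / (1 + x) \<le> 1 - x + x\<^sup>2" using assms by (simp add: field_simps)
  moreover have "exp (- x) \<le> 1 / (1 + x)"
    using exp_ge_add_one_self[of x] assms by (simp add: exp_minus field_simps)
  ultimately show ?thesis using exp_ge_add_one_self[of "- x"] by linarith
qed

lemma exp_minus_diff_le:
  fixes x y :: real assumes "0 \<le> x" "0 \<le> y"
  shows "\<bar>exp (- x) - exp (- y)\<bar> \<le> \<bar>x - y\<bar>"
proof -
  have *: "exp (- x) - exp (- y) \<le> y - x" if "0 \<le> x" "x \<le> y" for x y :: real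
  proof -
    have "exp (- x) * (1 - exp (x - y)) \<le> 1 * (y - x)"
    proof (rule mult_mono)
      show "1 - exp (x - y) \<le> y - x" using exp_ge_add_one_self[of "x - y"] by linarith
    qed (use that in auto)
    moreover have "exp (- x) * exp (x - y) = exp (- y)" by (simp flip: exp_add)
    ultimately show ?thesis by (simp add: algebra_simps)
  qed
  show ?thesis using *[of x y] *[of y x] assms by (cases "x \<le> y") auto
qed

lemma iexp_diff_le: "cmod (iexp x - iexp y) \<le> \<bar>x - y\<bar>" for x y :: real
proof -
  have "iexp x - iexp y = iexp y * (iexp (x - y) - 1)"
    by (simp add: algebra_simps flip: exp_add)
  moreover have "cmod (iexp (x - y) - 1) \<le> \<bar>x - y\<bar>" using iexp_approx1[of "x - y" 0] by simp
  ultimately show ?thesis by (simp add: norm_mult)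
qed

lemma (in prob_space) integrable_iexp_random_variable:
  assumes "f \<in> borel_measurable M" shows "integrable M (\<lambda>w. iexp (f w))"
  using assms by (intro integrable_const_bound[of _ 1]) auto

lemma (in prob_space) cmod_expectation_iexp_le:
  "cmod (expectation (\<lambda>w. iexp (f w))) \<le> 1"
proof -
  have "cmod (expectation (\<lambda>w. iexp (f w))) \<le> expectation (\<lambda>w. cmod (iexp (f w)))"
    by (rule integral_norm_bound)
  then show ?thesis by (simp add: prob_space)
qed

text \<open>A row after projection to the real line, with everything asymptotic replaced by
  constants. \<open>mixing\<close> covers arbitrary separated index sets because it is applied both
  to single indices (covariances) and to a block against the union of its predecessors
  (characteristic functions). The absolute values in \<open>cov_sum\<close> let it pass to partial
  sums over pairs, and \<open>b_pos\<close> permits truncation at a negative power of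
  \<open>b\<close>.\<close>

locale mixing_row = prob_space M for M :: "'w measure" +
  fixes \<xi> :: "nat \<Rightarrow> 'w \<Rightarrow> real" and m p :: nat and b \<gamma> C K :: real
  assumes m_pos: "1 \<le> m"
    and measurable_\<xi> [measurable]: "\<And>i. i \<in> {1..m} \<Longrightarrow> \<xi> i \<in> borel_measurable M"
    and \<gamma>: "2 < \<gamma>" and b_pos: "0 < b"
    and mixing: "\<And>I J A B. I \<subseteq> {1..m} \<Longrightarrow> J \<subseteq> {1..m} \<Longrightarrow> (\<And>i j. i \<in> I \<Longrightarrow> j \<in> J \<Longrightarrow> i + p \<le> j) \<Longrightarrow>
        A \<in> sigma_rv M \<xi> I \<Longrightarrow> B \<in> sigma_rv M \<xi> J \<Longrightarrow> \<bar>prob (A \<inter> B) - prob A * prob B\<bar> \<le> b"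
    and moment_integrable: "\<And>i. i \<in> {1..m} \<Longrightarrow> integrable M (\<lambda>w. \<bar>\<xi> i w\<bar> powr \<gamma>)"
    and moment_le: "\<And>i. i \<in> {1..m} \<Longrightarrow> expectation (\<lambda>w. \<bar>\<xi> i w\<bar> powr \<gamma>) \<le> C"
    and centered: "\<And>i. i \<in> {1..m} \<Longrightarrow> expectation (\<xi> i) = 0"
    and cov_sum: "(\<Sum>i\<in>{1..m}. \<Sum>j\<in>{1..m}. \<bar>expectation (\<lambda>w. \<xi> i w * \<xi> j w)\<bar>) \<le> K * real m"
begin

definition cv :: "nat \<Rightarrow> nat \<Rightarrow> real" where
  "cv i j = expectation (\<lambda>w. \<xi> i w * \<xi> j w)"

lemma cv_commute: "cv i j = cv j i"
  unfolding cv_def by (simp add: mult.commute)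

lemma C_nonneg: "0 \<le> C"
proof -
  have "0 \<le> expectation (\<lambda>w. \<bar>\<xi> 1 w\<bar> powr \<gamma>)" by (rule Bochner_Integration.integral_nonneg) simp
  also have "\<dots> \<le> C" using m_pos by (intro moment_le) simp
  finally show ?thesis .
qed

lemma square_le_powr: "x\<^sup>2 \<le> 1 + \<bar>x\<bar> powr \<gamma>" for x :: real
  using abs_power_le_one_plus_powr[of 2 \<gamma> x] \<gamma> by simp

lemma integrable_square:
  assumes "i \<in> {1..m}" shows "integrable M (\<lambda>w. (\<xi> i w)\<^sup>2)"
  using integrable_square_of_powr[OF measurable_\<xi>[OF assms] moment_integrable[OF assms]] \<gamma> by simp

lemma integrable_\<xi>:
  assumes "i \<in> {1..m}" shows "integrable M (\<xi> i)"
  using square_integrable_imp_integrable[OF measurable_\<xi>[OF assms] integrable_square[OF assms]] .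

lemma integrable_product:
  assumes "i \<in> {1..m}" "j \<in> {1..m}" shows "integrable M (\<lambda>w. \<xi> i w * \<xi> j w)"
  using assms by (intro integrable_mult_square_integrable measurable_\<xi> integrable_square)

lemma cv_bound:
  assumes "i \<in> {1..m}" "j \<in> {1..m}" shows "\<bar>cv i j\<bar> \<le> 1 + C"
proof -
  have "\<bar>cv i j\<bar> \<le> expectation (\<lambda>w. \<bar>\<xi> i w * \<xi> j w\<bar>)" unfolding cv_def by (rule integral_abs_bound)
  also have "\<dots> \<le> expectation (\<lambda>w. 1 + \<bar>\<xi> i w\<bar> powr \<gamma> / 2 + \<bar>\<xi> j w\<bar> powr \<gamma> / 2)"
  proof (rule integral_mono)
    show "\<bar>\<xi> i w * \<xi> j w\<bar> \<le> 1 + \<bar>\<xi> i w\<bar> powr \<gamma> / 2 + \<bar>\<xi> j w\<bar> powr \<gamma> / 2" for w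
      using sum_squares_bound[of "\<bar>\<xi> i w\<bar>" "\<bar>\<xi> j w\<bar>"] square_le_powr[of "\<xi> i w"] square_le_powr[of "\<xi> j w"]
      by (simp add: abs_mult)
  qed (use assms integrable_product moment_integrable in auto)
  also have "\<dots> \<le> 1 + C"
    using moment_le[OF assms(1)] moment_le[OF assms(2)] moment_integrable assms by (simp add: prob_space)
  finally show ?thesis .
qed

lemma sets_gen_subset:
  assumes "I \<subseteq> {1..m}" shows "sets (sigma_rv_gen M \<xi> I) \<subseteq> events"
  unfolding sets_sigma_rv_gen using assms by (intro sigma_rv_subset_sets measurable_\<xi>) auto

lemma cv_separated:
  assumes "i \<in> {1..m}" "j \<in> {1..m}" "i + p \<le> j \<or> j + p \<le> i"
  shows "\<bar>cv i j\<bar> \<le> (4 + 3 * C) * b powr ((\<gamma> - 2) / \<gamma>)"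
proof -
  have *: "\<bar>cv i j\<bar> \<le> (4 + 3 * C) * b powr ((\<gamma> - 2) / \<gamma>)"
    if ij: "i \<in> {1..m}" "j \<in> {1..m}" "i + p \<le> j" for i j
    unfolding cv_def
  proof (rule covariance_bound_truncation[where FA = "sigma_rv_gen M \<xi> {i}" and FB = "sigma_rv_gen M \<xi> {j}"])
    show "\<bar>prob (A \<inter> B) - prob A * prob B\<bar> \<le> b"
      if "A \<in> sets (sigma_rv_gen M \<xi> {i})" "B \<in> sets (sigma_rv_gen M \<xi> {j})" for A B
      using that ij unfolding sets_sigma_rv_gen by (intro mixing[of "{i}" "{j}"]) auto
  qed (use ij sets_gen_subset \<gamma> b_pos measurable_sigma_rv_gen[of i "{i}" \<xi> M] measurable_sigma_rv_gen[of j "{j}" \<xi> M] in \<open>auto intro!: moment_integrable moment_le integrable_\<xi> centered\<close>)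
  show ?thesis using *[of i j] *[of j i] assms by (auto simp: cv_commute)
qed

lemma measurable_sum_gen:
  assumes "finite I" shows "(\<lambda>w. r * (\<Sum>i\<in>I. \<xi> i w)) \<in> borel_measurable (sigma_rv_gen M \<xi> I)"
  by (intro borel_measurable_times borel_measurable_const borel_measurable_sum measurable_sigma_rv_gen)

lemma measurable_sum:
  assumes "I \<subseteq> {1..m}" shows "(\<lambda>w. r * (\<Sum>i\<in>I. \<xi> i w)) \<in> borel_measurable M"
  using assms by (intro borel_measurable_times borel_measurable_const borel_measurable_sum measurable_\<xi>) auto

lemma iexp_separated:
  assumes "I \<subseteq> {1..m}" "J \<subseteq> {1..m}" "\<And>i j. i \<in> I \<Longrightarrow> j \<in> J \<Longrightarrow> i + p \<le> j"
  shows "cmod (expectation (\<lambda>w. iexp (r * (\<Sum>i\<in>I. \<xi> i w) + r * (\<Sum>i\<in>J. \<xi> i w)))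
     - expectation (\<lambda>w. iexp (r * (\<Sum>i\<in>I. \<xi> i w))) * expectation (\<lambda>w. iexp (r * (\<Sum>i\<in>J. \<xi> i w)))) \<le> 16 * b"
proof (rule iexp_product_bound[where FA = "sigma_rv_gen M \<xi> I" and FB = "sigma_rv_gen M \<xi> J"])
  show "\<bar>prob (A \<inter> B) - prob A * prob B\<bar> \<le> b"
    if "A \<in> sets (sigma_rv_gen M \<xi> I)" "B \<in> sets (sigma_rv_gen M \<xi> J)" for A B
    using that assms(3) unfolding sets_sigma_rv_gen by (rule mixing[OF assms(1,2), rotated])
qed (use assms finite_subset[OF assms(1)] finite_subset[OF assms(2)] in
    \<open>simp_all add: sets_gen_subset measurable_sum_gen\<close>)

lemma second_moment_sum:
  assumes "I \<subseteq> {1..m}"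
  shows "integrable M (\<lambda>w. (r * (\<Sum>i\<in>I. \<xi> i w))\<^sup>2)"
    and "expectation (\<lambda>w. (r * (\<Sum>i\<in>I. \<xi> i w))\<^sup>2) = r\<^sup>2 * (\<Sum>i\<in>I. \<Sum>j\<in>I. cv i j)"
proof -
  have e: "(\<lambda>w. (r * (\<Sum>i\<in>I. \<xi> i w))\<^sup>2) = (\<lambda>w. r\<^sup>2 * (\<Sum>i\<in>I. \<Sum>j\<in>I. \<xi> i w * \<xi> j w))"
    by (simp add: power2_eq_square sum_product mult_ac)
  have i: "integrable M (\<lambda>w. \<xi> i w * \<xi> j w)" if "i \<in> I" "j \<in> I" for i j
    using integrable_product that assms by blast
  show "integrable M (\<lambda>w. (r * (\<Sum>i\<in>I. \<xi> i w))\<^sup>2)"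
    unfolding e by (intro integrable_mult_right Bochner_Integration.integrable_sum i)
  show "expectation (\<lambda>w. (r * (\<Sum>i\<in>I. \<xi> i w))\<^sup>2) = r\<^sup>2 * (\<Sum>i\<in>I. \<Sum>j\<in>I. cv i j)"
    unfolding e cv_def by (simp add: Bochner_Integration.integral_sum Bochner_Integration.integrable_sum i)
qed

lemma first_moment_sum:
  assumes "I \<subseteq> {1..m}"
  shows "integrable M (\<lambda>w. r * (\<Sum>i\<in>I. \<xi> i w))" "expectation (\<lambda>w. r * (\<Sum>i\<in>I. \<xi> i w)) = 0"
proof -
  have i: "integrable M (\<xi> i)" "expectation (\<xi> i) = 0" if "i \<in> I" for i
    using integrable_\<xi> centered that assms by blast+
  show "integrable M (\<lambda>w. r * (\<Sum>i\<in>I. \<xi> i w))"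
    by (intro integrable_mult_right Bochner_Integration.integrable_sum i)
  show "expectation (\<lambda>w. r * (\<Sum>i\<in>I. \<xi> i w)) = 0"
    by (simp add: Bochner_Integration.integral_sum i)
qed

text \<open>Centering removes the linear term of the expansion. The moment bound keeps
  \<open>card I\<close> as a linear factor and puts the common bound \<open>n\<close> into the
  power, so that summation over disjoint blocks yields the row length.\<close>

lemma char_sum_taylor:
  assumes I: "I \<subseteq> {1..m}" "card I \<le> n" and \<epsilon>: "0 < \<epsilon>" and r: "0 \<le> r"
  defines "v \<equiv> expectation (\<lambda>w. (r * (\<Sum>i\<in>I. \<xi> i w))\<^sup>2)"
  shows "cmod (expectation (\<lambda>w. iexp (r * (\<Sum>i\<in>I. \<xi> i w))) - complex_of_real (1 - v / 2))
    \<le> \<epsilon> * v + \<epsilon> powr (2 - \<gamma>) * (r powr \<gamma> * (real n powr (\<gamma> - 1) * (real (card I) * C)))"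
proof -
  let ?Z = "\<lambda>w. r * (\<Sum>i\<in>I. \<xi> i w)"
  have fin: "finite I" using finite_subset[OF I(1)] by simp
  note [measurable] = measurable_sum[OF I(1), of r]
  note i1 = first_moment_sum[OF I(1), of r] and i2 = second_moment_sum(1)[OF I(1), of r]
  have pw: "\<bar>?Z w\<bar> powr \<gamma> \<le> r powr \<gamma> * (real n powr (\<gamma> - 1) * (\<Sum>i\<in>I. \<bar>\<xi> i w\<bar> powr \<gamma>))" for w
  proof -
    have "\<bar>?Z w\<bar> powr \<gamma> = r powr \<gamma> * \<bar>\<Sum>i\<in>I. \<xi> i w\<bar> powr \<gamma>"
      using r by (simp add: abs_mult powr_mult)
    also have "\<dots> \<le> r powr \<gamma> * (real n powr (\<gamma> - 1) * (\<Sum>i\<in>I. \<bar>\<xi> i w\<bar> powr \<gamma>))"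
      using \<gamma> fin I(2) by (intro mult_left_mono powr_sum_le) auto
    finally show ?thesis .
  qed
  have imom: "integrable M (\<lambda>w. \<bar>\<xi> i w\<bar> powr \<gamma>)" if "i \<in> I" for i using moment_integrable that I by blast
  have ipw: "integrable M (\<lambda>w. r powr \<gamma> * (real n powr (\<gamma> - 1) * (\<Sum>i\<in>I. \<bar>\<xi> i w\<bar> powr \<gamma>)))"
    by (intro integrable_mult_right Bochner_Integration.integrable_sum imom)
  have iZ: "integrable M (\<lambda>w. \<bar>?Z w\<bar> powr \<gamma>)"
    by (rule Bochner_Integration.integrable_bound[OF ipw])
      (use pw in \<open>auto intro!: AE_I2 order_trans[OF pw abs_ge_self]\<close>)
  have "expectation (\<lambda>w. \<bar>?Z w\<bar> powr \<gamma>) \<le> expectation (\<lambda>w. r powr \<gamma> * (real n powr (\<gamma> - 1) * (\<Sum>i\<in>I. \<bar>\<xi> i w\<bar> powr \<gamma>)))"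
    by (rule integral_mono[OF iZ ipw pw])
  also have "\<dots> = r powr \<gamma> * (real n powr (\<gamma> - 1) * (\<Sum>i\<in>I. expectation (\<lambda>w. \<bar>\<xi> i w\<bar> powr \<gamma>)))"
    by (simp add: Bochner_Integration.integral_sum imom)
  also have "\<dots> \<le> r powr \<gamma> * (real n powr (\<gamma> - 1) * (\<Sum>i\<in>I. C))"
    using I(1) by (intro mult_left_mono sum_mono moment_le) auto
  finally have EZ: "expectation (\<lambda>w. \<bar>?Z w\<bar> powr \<gamma>) \<le> r powr \<gamma> * (real n powr (\<gamma> - 1) * (real (card I) * C))" by simp
  have ie: "integrable M (\<lambda>w. iexp (?Z w))"
    by (rule integrable_iexp_random_variable) (rule measurable_sum[OF I(1)])
  have ic: "integrable M (\<lambda>w. 1 + \<i> * complex_of_real (?Z w) - complex_of_real ((?Z w)\<^sup>2) / 2)"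
    using i1(1) i2 by (intro Bochner_Integration.integrable_add Bochner_Integration.integrable_diff
        integrable_mult_right integrable_divide integrable_of_real) auto
  have "expectation (\<lambda>w. 1 + \<i> * complex_of_real (?Z w) - complex_of_real ((?Z w)\<^sup>2) / 2)
      = complex_of_real (1 - v / 2)"
  proof -
    have "expectation (\<lambda>w. 1 + \<i> * complex_of_real (?Z w) - complex_of_real ((?Z w)\<^sup>2) / 2)
        = expectation (\<lambda>w. 1 + \<i> * complex_of_real (?Z w)) - expectation (\<lambda>w. complex_of_real ((?Z w)\<^sup>2) / 2)"
      using i1(1) i2 by (intro Bochner_Integration.integral_diff Bochner_Integration.integrable_add
        integrable_mult_right integrable_divide integrable_of_real) auto
    also have "expectation (\<lambda>w. complex_of_real ((?Z w)\<^sup>2) / 2) = complex_of_real v / 2"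
      unfolding v_def integral_complex_of_real[symmetric] by (rule integral_divide_zero)
    also have "expectation (\<lambda>w. 1 + \<i> * complex_of_real (?Z w))
        = expectation (\<lambda>w. 1) + expectation (\<lambda>w. \<i> * complex_of_real (?Z w))"
      using i1(1) by (intro Bochner_Integration.integral_add integrable_mult_right integrable_of_real) auto
    also have "expectation (\<lambda>w. \<i> * complex_of_real (?Z w)) = \<i> * expectation (\<lambda>w. complex_of_real (?Z w))"
      by (rule integral_mult_right_zero)
    also have "expectation (\<lambda>w. complex_of_real (?Z w)) = 0"
      unfolding integral_complex_of_real i1(2) by simp
    finally show ?thesis by (simp add: prob_space)
  qed
  then have "cmod (expectation (\<lambda>w. iexp (?Z w)) - complex_of_real (1 - v / 2)) =
     cmod (expectation (\<lambda>w. iexp (?Z w) - (1 + \<i> * complex_of_real (?Z w) - complex_of_real ((?Z w)\<^sup>2) / 2)))"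
    using Bochner_Integration.integral_diff[OF ie ic] by simp
  also have "\<dots> \<le> expectation (\<lambda>w. cmod (iexp (?Z w) - (1 + \<i> * complex_of_real (?Z w) - complex_of_real ((?Z w)\<^sup>2) / 2)))"
    by (rule integral_norm_bound)
  also have "\<dots> \<le> expectation (\<lambda>w. \<epsilon> * (?Z w)\<^sup>2 + \<epsilon> powr (2 - \<gamma>) * \<bar>?Z w\<bar> powr \<gamma>)"
  proof (rule integral_mono)
    show "integrable M (\<lambda>w. cmod (iexp (?Z w) - (1 + \<i> * complex_of_real (?Z w) - complex_of_real ((?Z w)\<^sup>2) / 2)))"
      by (rule integrable_norm[OF Bochner_Integration.integrable_diff[OF ie ic]])
    show "integrable M (\<lambda>w. \<epsilon> * (?Z w)\<^sup>2 + \<epsilon> powr (2 - \<gamma>) * \<bar>?Z w\<bar> powr \<gamma>)"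
      by (intro Bochner_Integration.integrable_add integrable_mult_right i2 iZ)
    show "cmod (iexp (?Z w) - (1 + \<i> * complex_of_real (?Z w) - complex_of_real ((?Z w)\<^sup>2) / 2))
        \<le> \<epsilon> * (?Z w)\<^sup>2 + \<epsilon> powr (2 - \<gamma>) * \<bar>?Z w\<bar> powr \<gamma>" for w
      using iexp_lindeberg_bound[OF \<epsilon> \<gamma>, of "?Z w"] by simp
  qed
  also have "\<dots> = \<epsilon> * v + \<epsilon> powr (2 - \<gamma>) * expectation (\<lambda>w. \<bar>?Z w\<bar> powr \<gamma>)"
    unfolding v_def
    by (subst Bochner_Integration.integral_add)
      (intro integrable_mult_right i2 iZ integral_mult_right_zero arg_cong2[where f = "(+)"])+
  also have "\<dots> \<le> \<epsilon> * v + \<epsilon> powr (2 - \<gamma>) * (r powr \<gamma> * (real n powr (\<gamma> - 1) * (real (card I) * C)))"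
    using EZ by (intro add_left_mono mult_left_mono) auto
  finally show ?thesis .
qed

end

text \<open>Each period of length \<open>L\<close> begins with its gap. The index \<open>j\<close>
  lies past the whole gap of its own period, while \<open>i\<close> lies before that period.\<close>

lemma div_less_imp_add_le:
  fixes i j p L s :: nat
  assumes "(i + s) div L < (j + s) div L" "p \<le> (j + s) mod L" "0 < L"
  shows "i + p \<le> j"
proof -
  have "i + s < ((i + s) div L + 1) * L"
    using assms(3) by (metis Suc_eq_plus1 dividend_less_div_times mult.commute mult_Suc_right add.commute)
  also have "\<dots> \<le> (j + s) div L * L" using assms(1) by (intro mult_right_mono) auto
  finally have "i + s + p \<le> (j + s) div L * L + (j + s) mod L" using assms(2) by linarith
  then show ?thesis by simp
qed

context mixing_row begin

text \<open>The summands record successive replacements: deleting the gap indices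
  (\<open>\<epsilon> + \<rho> / \<epsilon>\<close>), factorizing over the blocks
  (\<open>16 * real (m + 1) * b\<close>), passing to Gaussian factors block by block (the next two),
  and replacing the sum of the block variances by \<open>v\<close> (the last bracket). The shift is
  chosen inside the proof, so the position of the covariances does not enter.\<close>

lemma char_sum_gaussian_bound:
  fixes q :: nat and \<epsilon> :: real
  assumes q: "1 \<le> q" and \<epsilon>: "0 < \<epsilon>"
  defines "r \<equiv> 1 / sqrt (real m)"
  defines "v \<equiv> expectation (\<lambda>w. (r * (\<Sum>i\<in>{1..m}. \<xi> i w))\<^sup>2)"
    and "\<rho> \<equiv> real p / real (p + q) * K"
    and "D \<equiv> (4 + 3 * C) * b powr ((\<gamma> - 2) / \<gamma>)"
  shows "cmod (expectation (\<lambda>w. iexp (r * (\<Sum>i\<in>{1..m}. \<xi> i w))) - complex_of_real (exp (- (v / 2))))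
    \<le> \<epsilon> + \<rho> / \<epsilon> + 16 * real (m + 1) * b
      + (\<epsilon> * K + \<epsilon> powr (2 - \<gamma>) * (C * (real q powr (\<gamma> - 1) * real m powr (1 - \<gamma> / 2))))
      + K * ((real q)\<^sup>2 * (1 + C) / real m) + (\<rho> + real m * D / 2)"
proof -
  define L where "L = p + q"
  have L: "0 < L" "p < L" using q by (auto simp: L_def)
  have r: "0 < r" "r\<^sup>2 = 1 / real m" using m_pos by (auto simp: r_def power_divide)
  have D0: "0 \<le> D" using C_nonneg by (simp add: D_def)
  \<comment> \<open>The weight of an index is its whole row of absolute covariances. A light set of
    gaps then controls at once the variance of the gap sum and all covariances with an index in a
    gap.\<close>
  define f where "f i = (\<Sum>j\<in>{1..m}. \<bar>cv i j\<bar>)" for i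
  have f0: "0 \<le> f i" for i by (simp add: f_def sum_nonneg)
  have sumf: "(\<Sum>i\<in>{1..m}. f i) \<le> K * real m" using cov_sum by (simp add: f_def cv_def)
  obtain s where s: "s < L" "(\<Sum>i\<in>{i \<in> {1..m}. (i + s) mod L < p}. f i) \<le> real p / real L * (\<Sum>i\<in>{1..m}. f i)"
    using exists_light_shift[of "{1..m}" f L p] f0 L by auto
  define G where "G = {i \<in> {1..m}. (i + s) mod L < p}"
  define H where "H j = {i \<in> {1..m}. (i + s) div L < j \<and> p \<le> (i + s) mod L}" for j
  define B where "B j = {i \<in> {1..m}. (i + s) div L = j \<and> p \<le> (i + s) mod L}" for j
  \<comment> \<open>\<open>G\<close> are the indices in the gaps, \<open>B j\<close> is the \<open>j\<close>-th block, \<open>H j\<close> the union of the blocks before it.\<close>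
  define S where "S I w = r * (\<Sum>i\<in>I. \<xi> i w)" for I w
  define V where "V j = expectation (\<lambda>w. (S (B j) w)\<^sup>2)" for j
  have sub: "G \<subseteq> {1..m}" "H j \<subseteq> {1..m}" "B j \<subseteq> {1..m}" for j by (auto simp: G_def H_def B_def)
  have fin: "finite G" "finite (H j)" "finite (B j)" for j by (auto simp: G_def H_def B_def)
  have Gf: "(\<Sum>i\<in>G. f i) \<le> \<rho> * real m"
  proof -
    have "(\<Sum>i\<in>G. f i) \<le> real p / real L * (K * real m)"
      unfolding G_def by (rule order_trans[OF s(2)]) (intro mult_left_mono sumf, simp)
    then show ?thesis by (simp add: \<rho>_def L_def)
  qed
  have H0: "H 0 = {}" by (simp add: H_def)
  have HS: "H (Suc j) = H j \<union> B j" "H j \<inter> B j = {}" for j by (auto simp: H_def B_def)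
  \<comment> \<open>Since i + s < m + L <= (m + 1) L, the block numbers stay below
    \<open>m + 1\<close>. Blocks in this crude count may be empty; these contribute the factor 1 and
    the variance 0.\<close>
  have HN: "{1..m} = H (m + 1) \<union> G" "H (m + 1) \<inter> G = {}"
  proof -
    have "(i + s) div L < m + 1" if "i \<in> {1..m}" for i
    proof (rule less_mult_imp_div_less)
      have "m \<le> m * L" using L by simp
      moreover have "i + s < m + L" using that s by auto
      ultimately show "i + s < (m + 1) * L" unfolding add_mult_distrib mult_1 by linarith
    qed
    then show "{1..m} = H (m + 1) \<union> G" "H (m + 1) \<inter> G = {}" by (force simp: H_def G_def)+
  qed
  have sumH: "(\<Sum>i\<in>H (Suc j). g i) = (\<Sum>i\<in>H j. g i) + (\<Sum>i\<in>B j. g i)" for g :: "nat \<Rightarrow> real" and j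
    unfolding HS(1) by (rule sum.union_disjoint) (use fin HS in auto)
  have mS[measurable]: "S I \<in> borel_measurable M" if "I \<subseteq> {1..m}" for I
    using measurable_sum[OF that] by (simp add: S_def[abs_def])
  have total: "S {1..m} w = S (H (m + 1)) w + S G w" for w
    unfolding S_def HN(1) by (subst sum.union_disjoint) (use fin HN in \<open>auto simp: algebra_simps\<close>)

  \<comment> \<open>Dropping the gap sum y changes \<open>iexp\<close> by at most |y| <= \<epsilon>
    + y^2 / \<epsilon>, and the light shift bounds the second moment of y by
    \<open>\<rho>\<close>.\<close>
  have E1: "cmod (expectation (\<lambda>w. iexp (S {1..m} w)) - expectation (\<lambda>w. iexp (S (H (m + 1)) w))) \<le> \<epsilon> + \<rho> / \<epsilon>"
  proof -
    have iG: "integrable M (\<lambda>w. (S G w)\<^sup>2)" and eG: "expectation (\<lambda>w. (S G w)\<^sup>2) = r\<^sup>2 * (\<Sum>i\<in>G. \<Sum>j\<in>G. cv i j)"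
      using second_moment_sum[OF sub(1), of r] by (auto simp: S_def)
    have ie: "integrable M (\<lambda>w. iexp (S {1..m} w))" "integrable M (\<lambda>w. iexp (S (H (m + 1)) w))"
      by (rule integrable_iexp_random_variable mS sub order_refl)+
    have "cmod (expectation (\<lambda>w. iexp (S {1..m} w)) - expectation (\<lambda>w. iexp (S (H (m + 1)) w)))
       = cmod (expectation (\<lambda>w. iexp (S {1..m} w) - iexp (S (H (m + 1)) w)))"
      by (simp only: Bochner_Integration.integral_diff[OF ie])
    also have "\<dots> \<le> expectation (\<lambda>w. cmod (iexp (S {1..m} w) - iexp (S (H (m + 1)) w)))"
      by (rule integral_norm_bound)
    also have "\<dots> \<le> expectation (\<lambda>w. \<epsilon> + (S G w)\<^sup>2 / \<epsilon>)"
    proof (rule integral_mono)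
      show "integrable M (\<lambda>w. cmod (iexp (S {1..m} w) - iexp (S (H (m + 1)) w)))"
        by (rule integrable_norm[OF Bochner_Integration.integrable_diff[OF ie]])
      show "integrable M (\<lambda>w. \<epsilon> + (S G w)\<^sup>2 / \<epsilon>)" using iG by simp
      fix w
      have "\<bar>y\<bar> \<le> \<epsilon> + y\<^sup>2 / \<epsilon>" for y :: real
      proof (cases "\<bar>y\<bar> \<le> \<epsilon>")
        case True
        then show ?thesis using \<epsilon> by (simp add: add_increasing2)
      next
        case False
        then have "\<epsilon> * \<bar>y\<bar> \<le> \<bar>y\<bar> * \<bar>y\<bar>" by (intro mult_right_mono) auto
        then have "\<bar>y\<bar> \<le> y\<^sup>2 / \<epsilon>" using \<epsilon> by (simp add: field_simps power2_eq_square)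
        then show ?thesis using \<epsilon> by linarith
      qed
      from this[of "S G w"] show "cmod (iexp (S {1..m} w) - iexp (S (H (m + 1)) w)) \<le> \<epsilon> + (S G w)\<^sup>2 / \<epsilon>"
        using iexp_diff_le[of "S {1..m} w" "S (H (m + 1)) w"] total[of w] by linarith
    qed
    also have "\<dots> = \<epsilon> + expectation (\<lambda>w. (S G w)\<^sup>2) / \<epsilon>" using iG by (simp add: prob_space)
    also have "expectation (\<lambda>w. (S G w)\<^sup>2) \<le> \<rho>"
    proof -
      have "(\<Sum>i\<in>G. \<Sum>j\<in>G. cv i j) \<le> (\<Sum>i\<in>G. f i)"
        unfolding f_def
        by (intro sum_mono order_trans[OF sum_mono[OF abs_ge_self] sum_mono2]) (use sub in auto)
      then have "(\<Sum>i\<in>G. \<Sum>j\<in>G. cv i j) \<le> \<rho> * real m" using Gf by linarith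
      then show ?thesis unfolding eG r(2) using m_pos by (simp add: field_simps)
    qed
    finally show ?thesis using \<epsilon> by (simp add: divide_right_mono)
  qed

  \<comment> \<open>The gap before \<open>B n\<close> separates it from all of \<open>H n\<close>,
    so each induction step costs \<open>16 * b\<close>. Earlier errors are multiplied by a factor of
    modulus at most 1 and do not grow.\<close>
  have E2: "cmod (expectation (\<lambda>w. iexp (S (H n) w)) - (\<Prod>j<n. expectation (\<lambda>w. iexp (S (B j) w)))) \<le> 16 * real n * b" for n
  proof (induction n)
    case 0
    then show ?case by (simp add: H0 S_def prob_space)
  next
    case (Suc n)
    let ?P = "\<Prod>j<n. expectation (\<lambda>w. iexp (S (B j) w))"
    let ?E = "\<lambda>I. expectation (\<lambda>w. iexp (S I w))"
    have "?E (H (Suc n)) = expectation (\<lambda>w. iexp (S (H n) w + S (B n) w))"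
      by (intro Bochner_Integration.integral_cong refl) (simp add: S_def sumH algebra_simps)
    then have "cmod (?E (H (Suc n)) - ?E (H n) * ?E (B n)) \<le> 16 * b"
      using iexp_separated[OF sub(2) sub(3), of n n r] L
      by (simp add: S_def) (force simp: H_def B_def intro!: div_less_imp_add_le)
    moreover have "cmod (?E (H n) * ?E (B n) - ?P * ?E (B n)) \<le> 16 * real n * b"
    proof -
      have "cmod (?E (H n) * ?E (B n) - ?P * ?E (B n)) = cmod (?E (H n) - ?P) * cmod (?E (B n))"
        by (simp only: left_diff_distrib[symmetric] norm_mult)
      also have "\<dots> \<le> cmod (?E (H n) - ?P) * 1"
        by (intro mult_left_mono cmod_expectation_iexp_le) auto
      finally show ?thesis using Suc.IH by simp
    qed
    ultimately have "cmod (?E (H (Suc n)) - ?P * ?E (B n)) \<le> 16 * b + 16 * real n * b"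
      by (rule norm_diff_triangle_le)
    then show ?case by (simp add: algebra_simps)
  qed

  have V: "V j = r\<^sup>2 * (\<Sum>i\<in>B j. \<Sum>i'\<in>B j. cv i i')" for j
    unfolding V_def S_def by (rule second_moment_sum(2)[OF sub(3)])
  have V0: "0 \<le> V j" for j unfolding V_def by (rule Bochner_Integration.integral_nonneg) simp
  define same where "same i i' \<longleftrightarrow> p \<le> (i + s) mod L \<and> p \<le> (i' + s) mod L \<and> (i + s) div L = (i' + s) div L" for i i'
  have sumV: "(\<Sum>j<m+1. V j) = r\<^sup>2 * (\<Sum>i\<in>{1..m}. \<Sum>i'\<in>{1..m}. if same i i' then cv i i' else 0)"
  proof -
    have bj: "(\<Sum>i\<in>B j. g i) = (\<Sum>i\<in>{1..m}. if i \<in> B j then g i else 0)" for g :: "nat \<Rightarrow> real" and j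
      by (rule sum.mono_neutral_cong_left) (use sub in auto)
    have "(\<Sum>j<m+1. \<Sum>i\<in>B j. \<Sum>i'\<in>B j. cv i i') =
        (\<Sum>j<m+1. \<Sum>i\<in>{1..m}. \<Sum>i'\<in>{1..m}. if i \<in> B j \<and> i' \<in> B j then cv i i' else 0)"
      unfolding bj by (intro sum.cong refl) auto
    also have "\<dots> = (\<Sum>i\<in>{1..m}. \<Sum>i'\<in>{1..m}. \<Sum>j<m+1. if i \<in> B j \<and> i' \<in> B j then cv i i' else 0)"
      by (rule sum_swap3)
    also have "\<dots> = (\<Sum>i\<in>{1..m}. \<Sum>i'\<in>{1..m}. if same i i' then cv i i' else 0)"
    proof (intro sum.cong refl)
      fix i i' assume i: "i \<in> {1..m}" "i' \<in> {1..m}"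
      show "(\<Sum>j<m+1. if i \<in> B j \<and> i' \<in> B j then cv i i' else 0) = (if same i i' then cv i i' else 0)"
      proof (cases "same i i'")
        case True
        then have iH: "i \<in> H (m + 1)" using i HN by (auto simp: G_def same_def)
        then have j: "(i + s) div L < m + 1" by (simp add: H_def)
        have "(\<Sum>j<m+1. if i \<in> B j \<and> i' \<in> B j then cv i i' else 0) = (\<Sum>j<m+1. if j = (i + s) div L then cv i i' else 0)"
          using True i by (intro sum.cong refl) (auto simp: B_def same_def)
        then show ?thesis using j True by simp
      next
        case False
        then show ?thesis by (auto simp: B_def same_def intro!: sum.neutral)
      qed
    qed
    finally show ?thesis unfolding V by (simp only: sum_distrib_left[symmetric])
  qed
  have Ve: "v = r\<^sup>2 * (\<Sum>i\<in>{1..m}. \<Sum>i'\<in>{1..m}. cv i i')"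
    unfolding v_def by (rule second_moment_sum(2)) simp
  have v0: "0 \<le> v" unfolding v_def by (rule Bochner_Integration.integral_nonneg) simp
  have sumVK: "(\<Sum>j<m+1. V j) \<le> K"
  proof -
    have "(\<Sum>i\<in>{1..m}. \<Sum>i'\<in>{1..m}. if same i i' then cv i i' else 0) \<le> (\<Sum>i\<in>{1..m}. f i)"
      unfolding f_def by (intro sum_mono) auto
    then have "(\<Sum>i\<in>{1..m}. \<Sum>i'\<in>{1..m}. if same i i' then cv i i' else 0) \<le> K * real m" using sumf by linarith
    then show ?thesis unfolding sumV r(2) using m_pos by (simp add: field_simps)
  qed
  \<comment> \<open>A pair is missed by the block variances only if it meets \<open>G\<close>, with
    total weight at most \<open>2 * \<rho> * m\<close>, or if it joins different blocks, where
    separation gives \<open>D\<close>. At most m^2 such pairs, divided by m, produce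
    \<open>m * D\<close>.\<close>
  have E5: "\<bar>(\<Sum>j<m+1. V j) - v\<bar> \<le> 2 * \<rho> + real m * D"
  proof -
    have "\<bar>(\<Sum>j<m+1. V j) - v\<bar> = r\<^sup>2 * \<bar>\<Sum>i\<in>{1..m}. \<Sum>i'\<in>{1..m}. (if same i i' then cv i i' else 0) - cv i i'\<bar>"
      unfolding sumV Ve by (simp add: sum_subtractf abs_mult flip: right_diff_distrib)
    also have "\<dots> \<le> r\<^sup>2 * (\<Sum>i\<in>{1..m}. \<Sum>i'\<in>{1..m}.
        (if i \<in> G then \<bar>cv i i'\<bar> else 0) + (if i' \<in> G then \<bar>cv i' i\<bar> else 0) + D)"
    proof (intro mult_left_mono order_trans[OF sum_abs] sum_mono)
      fix i i' assume i: "i \<in> {1..m}" "i' \<in> {1..m}"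
      show "\<bar>(if same i i' then cv i i' else 0) - cv i i'\<bar>
         \<le> (if i \<in> G then \<bar>cv i i'\<bar> else 0) + (if i' \<in> G then \<bar>cv i' i\<bar> else 0) + D"
      proof (cases "same i i' \<or> i \<in> G \<or> i' \<in> G")
        case True
        then show ?thesis using D0 by (auto simp: cv_commute[of i' i])
      next
        case False
        then have "(i + s) div L < (i' + s) div L \<or> (i' + s) div L < (i + s) div L"
          and "p \<le> (i + s) mod L" "p \<le> (i' + s) mod L" using i by (auto simp: same_def G_def)
        then have "i + p \<le> i' \<or> i' + p \<le> i" using L div_less_imp_add_le by blast
        from cv_separated[OF i this] show ?thesis using False D0 by (simp add: D_def)
      qed
    qed simp
    also have "(\<Sum>i\<in>{1..m}. \<Sum>i'\<in>{1..m}.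
        (if i \<in> G then \<bar>cv i i'\<bar> else 0) + (if i' \<in> G then \<bar>cv i' i\<bar> else 0) + D)
        = 2 * (\<Sum>i\<in>G. f i) + (real m)\<^sup>2 * D"
    proof -
      have g: "(\<Sum>i\<in>{1..m}. \<Sum>i'\<in>{1..m}. if i \<in> G then \<bar>cv i i'\<bar> else 0) = (\<Sum>i\<in>G. f i)"
      proof -
        have "(\<Sum>i\<in>{1..m}. \<Sum>i'\<in>{1..m}. if i \<in> G then \<bar>cv i i'\<bar> else 0) = (\<Sum>i\<in>{1..m}. if i \<in> G then f i else 0)"
          unfolding f_def by (intro sum.cong refl) auto
        also have "\<dots> = (\<Sum>i\<in>G. f i)" by (rule sum.mono_neutral_cong_right) (use sub in auto)
        finally show ?thesis .
      qed
      have g': "(\<Sum>i\<in>{1..m}. \<Sum>i'\<in>{1..m}. if i' \<in> G then \<bar>cv i' i\<bar> else 0) = (\<Sum>i\<in>G. f i)"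
        by (subst sum.swap) (rule g)
      show ?thesis unfolding sum.distrib g g' by (simp add: power2_eq_square)
    qed
    also have "r\<^sup>2 * (2 * (\<Sum>i\<in>G. f i) + (real m)\<^sup>2 * D) \<le> r\<^sup>2 * (2 * (\<rho> * real m) + (real m)\<^sup>2 * D)"
      using Gf by (intro mult_left_mono) auto
    also have "\<dots> = 2 * \<rho> + real m * D" unfolding r(2) using m_pos by (simp add: field_simps power2_eq_square)
    finally show ?thesis .
  qed

  have cardB: "card (B j) \<le> q" for j
  proof -
    have "card (B j) \<le> card {j * L + p..<j * L + L}"
    proof (rule card_inj_on_le)
      show "inj_on (\<lambda>i. i + s) (B j)" by (simp add: inj_on_def)
      show "(\<lambda>i. i + s) ` B j \<subseteq> {j * L + p..<j * L + L}"
      proof (intro image_subsetI)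
        fix i assume "i \<in> B j"
        then have "j * L + (i + s) mod L = i + s" "p \<le> (i + s) mod L" by (auto simp: B_def)
        moreover have "(i + s) mod L < L" using L by simp
        ultimately show "i + s \<in> {j * L + p..<j * L + L}" unfolding atLeastLessThan_iff by linarith
      qed
    qed simp
    then show ?thesis by (simp add: L_def)
  qed
  have sumcard: "(\<Sum>j<m+1. real (card (B j))) \<le> real m"
  proof -
    have "real (card (H n)) = (\<Sum>j<n. real (card (B j)))" for n
      by (induction n) (use sumH[of "\<lambda>_. 1"] H0 in simp_all)
    moreover have "card (H (m + 1)) \<le> card {1..m}" by (rule card_mono) (use sub in auto)
    ultimately show ?thesis by (metis card_atLeastAtMost diff_Suc_1 of_nat_mono One_nat_def)
  qed
  have Vmax: "V j \<le> (real q)\<^sup>2 * (1 + C) / real m" for j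
  proof -
    have "(\<Sum>i\<in>B j. \<Sum>i'\<in>B j. cv i i') \<le> (\<Sum>i\<in>B j. \<Sum>i'\<in>B j. 1 + C)"
      using cv_bound sub(3)[of j] by (intro sum_mono) (meson abs_le_D1 subsetD)
    also have "\<dots> = (real (card (B j)))\<^sup>2 * (1 + C)" by (simp add: power2_eq_square)
    also have "\<dots> \<le> (real q)\<^sup>2 * (1 + C)"
      using cardB[of j] C_nonneg by (intro mult_right_mono power_mono) auto
    finally show ?thesis unfolding V r(2) using m_pos by (simp add: divide_right_mono)
  qed

  \<comment> \<open>All factors have modulus at most 1, so the difference of products is at most the
    sum of the single differences. \<open>?c\<close> is the error of the second order expansion,
    \<open>?d\<close> the distance of 1 - V/2 from exp(-V/2); there V^2 <= V * max V, and the block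
    variances sum to at most \<open>K\<close>.\<close>
  have E3: "cmod ((\<Prod>j<m+1. expectation (\<lambda>w. iexp (S (B j) w))) - (\<Prod>j<m+1. complex_of_real (exp (- (V j / 2)))))
     \<le> (\<epsilon> * K + \<epsilon> powr (2 - \<gamma>) * (C * (real q powr (\<gamma> - 1) * real m powr (1 - \<gamma> / 2))))
      + K * ((real q)\<^sup>2 * (1 + C) / real m)"
  proof -
    let ?c = "\<lambda>j. \<epsilon> * V j + \<epsilon> powr (2 - \<gamma>) * (r powr \<gamma> * (real q powr (\<gamma> - 1) * (real (card (B j)) * C)))"
    let ?d = "\<lambda>j. V j * ((real q)\<^sup>2 * (1 + C) / real m)"
    have "cmod ((\<Prod>j<m+1. expectation (\<lambda>w. iexp (S (B j) w))) - (\<Prod>j<m+1. complex_of_real (exp (- (V j / 2)))))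
      \<le> (\<Sum>j<m+1. cmod (expectation (\<lambda>w. iexp (S (B j) w)) - complex_of_real (exp (- (V j / 2)))))"
    proof (rule norm_prod_diff)
      show "cmod (complex_of_real (exp (- (V j / 2)))) \<le> 1" for j using V0[of j] unfolding norm_of_real by simp
    qed (rule cmod_expectation_iexp_le)
    also have "\<dots> \<le> (\<Sum>j<m+1. ?c j + ?d j)"
    proof (rule sum_mono)
      fix j
      have "cmod (expectation (\<lambda>w. iexp (S (B j) w)) - complex_of_real (1 - V j / 2)) \<le> ?c j"
        using char_sum_taylor[OF sub(3) cardB \<epsilon>, of r j] r by (simp add: S_def V_def)
      moreover have "cmod (complex_of_real (1 - V j / 2) - complex_of_real (exp (- (V j / 2)))) \<le> ?d j"
      proof -
        have "cmod (complex_of_real (1 - V j / 2) - complex_of_real (exp (- (V j / 2)))) = \<bar>exp (- (V j / 2)) - (1 - V j / 2)\<bar>"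
          unfolding of_real_diff[symmetric] norm_of_real by simp
        also have "\<dots> \<le> (V j / 2)\<^sup>2" using V0[of j] by (intro exp_minus_taylor_bound) simp
        also have "\<dots> \<le> V j * V j" by (simp add: power2_eq_square)
        also have "\<dots> \<le> ?d j" using V0[of j] Vmax[of j] by (intro mult_left_mono)
        finally show ?thesis .
      qed
      ultimately show "cmod (expectation (\<lambda>w. iexp (S (B j) w)) - complex_of_real (exp (- (V j / 2)))) \<le> ?c j + ?d j"
        by (meson add_mono norm_triangle_sub norm_diff_triangle_le)
    qed
    also have "\<dots> = \<epsilon> * (\<Sum>j<m+1. V j) + \<epsilon> powr (2 - \<gamma>) * (r powr \<gamma> * (real q powr (\<gamma> - 1) * ((\<Sum>j<m+1. real (card (B j))) * C)))
       + (\<Sum>j<m+1. V j) * ((real q)\<^sup>2 * (1 + C) / real m)"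
      unfolding sum.distrib sum_distrib_left sum_distrib_right ..
    also have "\<dots> \<le> \<epsilon> * K + \<epsilon> powr (2 - \<gamma>) * (r powr \<gamma> * (real q powr (\<gamma> - 1) * (real m * C)))
       + K * ((real q)\<^sup>2 * (1 + C) / real m)"
      using sumVK sumcard \<epsilon> C_nonneg by (intro add_mono mult_left_mono mult_right_mono) auto
    also have "r powr \<gamma> * (real q powr (\<gamma> - 1) * (real m * C)) = C * (real q powr (\<gamma> - 1) * real m powr (1 - \<gamma> / 2))"
    proof -
      have "r = real m powr (- 1 / 2)"
        using m_pos by (simp add: r_def powr_minus_divide powr_half_sqrt)
      then have "r powr \<gamma> * real m = real m powr (- (\<gamma> / 2)) * real m powr 1"
        using m_pos by (simp add: powr_powr)
      also have "\<dots> = real m powr (1 - \<gamma> / 2)" unfolding powr_add[symmetric] by simp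
      finally show ?thesis by (simp add: algebra_simps)
    qed
    finally show ?thesis .
  qed
  have E4: "cmod ((\<Prod>j<m+1. complex_of_real (exp (- (V j / 2)))) - complex_of_real (exp (- (v / 2)))) \<le> \<rho> + real m * D / 2"
  proof -
    have "(\<Prod>j<m+1. complex_of_real (exp (- (V j / 2)))) = complex_of_real (exp (- ((\<Sum>j<m+1. V j) / 2)))"
      unfolding of_real_prod[symmetric] exp_sum[OF finite_lessThan, symmetric]
      unfolding sum_negf sum_divide_distrib ..
    then have "cmod ((\<Prod>j<m+1. complex_of_real (exp (- (V j / 2)))) - complex_of_real (exp (- (v / 2))))
       = \<bar>exp (- ((\<Sum>j<m+1. V j) / 2)) - exp (- (v / 2))\<bar>"
      by (simp only: of_real_diff[symmetric] norm_of_real)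
    also have "\<dots> \<le> \<bar>(\<Sum>j<m+1. V j) / 2 - v / 2\<bar>"
      using sum_nonneg[of "{..<m + 1}" V, OF V0] v0
      by (intro exp_minus_diff_le) (simp_all only: divide_nonneg_pos zero_less_numeral)
    also have "\<dots> = \<bar>(\<Sum>j<m+1. V j) - v\<bar> / 2" by (simp add: diff_divide_distrib[symmetric])
    also have "\<dots> \<le> (2 * \<rho> + real m * D) / 2" using E5 by simp
    finally show ?thesis by simp
  qed
  note T = norm_diff_triangle_le
  have "cmod (expectation (\<lambda>w. iexp (S {1..m} w)) - complex_of_real (exp (- (v / 2))))
    \<le> \<epsilon> + \<rho> / \<epsilon> + 16 * real (m + 1) * b
      + ((\<epsilon> * K + \<epsilon> powr (2 - \<gamma>) * (C * (real q powr (\<gamma> - 1) * real m powr (1 - \<gamma> / 2))))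
      + K * ((real q)\<^sup>2 * (1 + C) / real m)) + (\<rho> + real m * D / 2)"
    by (rule T[OF T[OF T[OF E1 E2[of "m + 1"]] E3] E4])
  then show ?thesis by (simp add: S_def add.assoc)
qed

end

section \<open>Characteristic functions and relative weak convergence\<close>

text \<open>The phase \<open>s\<close> makes sines and, through the product-to-sum formula, products
  expressible with real coefficients. Each wave is the real part of a constant multiple of
  \<open>iexp (t \<bullet> x)\<close>, so its integral is determined by the characteristic function
  at \<open>t\<close>.\<close>

inductive trig_poly :: "('a::euclidean_space \<Rightarrow> real) \<Rightarrow> bool" where
  wave: "trig_poly (\<lambda>x. c * cos (t \<bullet> x + s))"
| add: "trig_poly f \<Longrightarrow> trig_poly g \<Longrightarrow> trig_poly (\<lambda>x. f x + g x)"

lemma trig_poly_const: "trig_poly (\<lambda>x. c)"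
  using trig_poly.wave[of c 0 0] by simp

lemma trig_poly_sin: "trig_poly (\<lambda>x. c * sin (t \<bullet> x))"
  using trig_poly.wave[of c t "- (pi / 2)"] by (simp add: cos_diff)

lemma trig_poly_sum:
  "finite I \<Longrightarrow> (\<And>i. i \<in> I \<Longrightarrow> trig_poly (f i)) \<Longrightarrow> trig_poly (\<lambda>x. \<Sum>i\<in>I. f i x)"
  by (induction I rule: finite_induct) (auto intro: trig_poly_const trig_poly.add)

lemma trig_poly_mult:
  assumes "trig_poly f" "trig_poly g"
  shows "trig_poly (\<lambda>x. f x * g x)"
  using assms(1)
proof induction
  case (wave c t s)
  show ?case using assms(2)
  proof induction
    case (wave c' t' s')
    have "(\<lambda>x. c * cos (t \<bullet> x + s) * (c' * cos (t' \<bullet> x + s'))) =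
      (\<lambda>x. (c * c' / 2) * cos ((t - t') \<bullet> x + (s - s')) + (c * c' / 2) * cos ((t + t') \<bullet> x + (s + s')))"
    proof
      fix x
      have "cos (t \<bullet> x + s) * cos (t' \<bullet> x + s') =
          (cos ((t - t') \<bullet> x + (s - s')) + cos ((t + t') \<bullet> x + (s + s'))) / 2"
        unfolding cos_times_cos by (simp add: inner_diff_left inner_add_left algebra_simps)
      then show "c * cos (t \<bullet> x + s) * (c' * cos (t' \<bullet> x + s')) =
        (c * c' / 2) * cos ((t - t') \<bullet> x + (s - s')) + (c * c' / 2) * cos ((t + t') \<bullet> x + (s + s'))"
        by (simp add: mult_ac add_divide_distrib distrib_left)
    qed
    then show ?case by (simp only: trig_poly.wave trig_poly.add)
  qed (simp add: distrib_left trig_poly.add)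
qed (simp add: distrib_right trig_poly.add)

lemma trig_poly_continuous: "trig_poly f \<Longrightarrow> continuous_on UNIV f"
  by (induction rule: trig_poly.induct) (auto intro!: continuous_intros)

lemma trig_poly_measurable: "trig_poly f \<Longrightarrow> f \<in> borel_measurable borel"
  by (intro borel_measurable_continuous_onI trig_poly_continuous)

lemma trig_poly_bounded: "trig_poly f \<Longrightarrow> \<exists>B. \<forall>x. \<bar>f x\<bar> \<le> B"
proof (induction rule: trig_poly.induct)
  case (wave c t s)
  have "\<bar>c * cos (t \<bullet> x + s)\<bar> \<le> \<bar>c\<bar>" for x
    unfolding abs_mult by (rule mult_right_le_one_le) auto
  then show ?case by blast
next
  case (add f g)
  then obtain B B' where "\<bar>f x\<bar> \<le> B" "\<bar>g x\<bar> \<le> B'" for x by blast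
  then have "\<bar>f x + g x\<bar> \<le> B + B'" for x by (meson abs_triangle_ineq add_mono order_trans)
  then show ?case by blast
qed

text \<open>A linear functional of the sine vector is a sum of sine waves; closure under sums and
  products handles the remaining constructors of polynomials.\<close>

lemma trig_poly_sine_embedding:
  assumes "real_polynomial_function P"
  shows "trig_poly (\<lambda>x::'a::euclidean_space. P (\<Sum>b\<in>Basis. sin ((x \<bullet> b) / L) *\<^sub>R b :: 'a))"
  using assms
proof induction
  case (linear f)
  interpret bounded_linear f by fact
  have "(\<lambda>x::'a. f (\<Sum>b\<in>Basis. sin ((x \<bullet> b) / L) *\<^sub>R b)) = (\<lambda>x. \<Sum>b\<in>Basis. f b * sin ((b /\<^sub>R L) \<bullet> x))"
    by (simp add: sum scaleR inner_commute divide_inverse mult_ac)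
  then show ?case by (simp only: trig_poly_sum trig_poly_sin finite_Basis)
qed (auto intro: trig_poly_const trig_poly.add trig_poly_mult)

lemma integrable_bounded_borel:
  fixes f :: "'a::topological_space \<Rightarrow> real"
  assumes "prob_space M" "sets M = sets borel" "f \<in> borel_measurable borel" "\<And>x. \<bar>f x\<bar> \<le> B"
  shows "integrable M f"
proof -
  interpret prob_space M by fact
  show ?thesis
    using assms by (intro integrable_const_bound[of _ B]) (auto simp: measurable_cong_sets[OF assms(2) refl])
qed

lemma trig_poly_integral_diff_tendsto:
  fixes \<mu> \<nu> :: "nat \<Rightarrow> 'a::euclidean_space measure"
  assumes \<mu>: "\<And>n. prob_space (\<mu> n)" "\<And>n. sets (\<mu> n) = sets borel"
    and \<nu>: "\<And>n. prob_space (\<nu> n)" "\<And>n. sets (\<nu> n) = sets borel"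
    and char: "\<And>t. (\<lambda>n. (\<integral>x. iexp (t \<bullet> x) \<partial>\<mu> n) - (\<integral>x. iexp (t \<bullet> x) \<partial>\<nu> n)) \<longlonglongrightarrow> 0"
    and f: "trig_poly f"
  shows "(\<lambda>n. integral\<^sup>L (\<mu> n) f - integral\<^sup>L (\<nu> n) f) \<longlonglongrightarrow> 0"
  using f
proof induction
  case (wave c t s)
  have e: "(\<integral>x. c * cos (t \<bullet> x + s) \<partial>N) = c * Re (iexp s * (\<integral>x. iexp (t \<bullet> x) \<partial>N))"
    if "prob_space N" "sets N = sets borel" for N :: "'a measure"
  proof -
    interpret prob_space N by fact
    note [measurable_cong] = that(2)
    have i: "integrable N (\<lambda>x. iexp s * iexp (t \<bullet> x))"
      by (intro integrable_mult_right integrable_const_bound[of _ 1]) auto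
    have "(\<integral>x. c * cos (t \<bullet> x + s) \<partial>N) = c * (\<integral>x. Re (iexp s * iexp (t \<bullet> x)) \<partial>N)"
      by (simp add: cos_add Re_exp Im_exp mult_ac)
    also have "(\<integral>x. Re (iexp s * iexp (t \<bullet> x)) \<partial>N) = Re (\<integral>x. iexp s * iexp (t \<bullet> x) \<partial>N)"
      by (rule integral_Re[OF i])
    also have "(\<integral>x. iexp s * iexp (t \<bullet> x) \<partial>N) = iexp s * (\<integral>x. iexp (t \<bullet> x) \<partial>N)"
      by (rule integral_mult_right_zero)
    finally show ?thesis .
  qed
  have "(\<lambda>n. c * Re (iexp s * ((\<integral>x. iexp (t \<bullet> x) \<partial>\<mu> n) - (\<integral>x. iexp (t \<bullet> x) \<partial>\<nu> n)))) \<longlonglongrightarrow> c * Re (iexp s * 0)"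
    by (intro tendsto_intros char)
  then show ?case
    unfolding e[OF \<mu>] e[OF \<nu>] right_diff_distrib[of "iexp s"] minus_complex.sel right_diff_distrib[of c] by simp
next
  case (add f g)
  have i: "integrable N h" if N: "prob_space N" "sets N = sets borel" and h: "trig_poly h" for N h
  proof -
    obtain B where "\<bar>h x\<bar> \<le> B" for x using trig_poly_bounded[OF h] by blast
    then show ?thesis by (rule integrable_bounded_borel[OF N trig_poly_measurable[OF h]])
  qed
  have "(\<integral>x. f x + g x \<partial>\<mu> n) - (\<integral>x. f x + g x \<partial>\<nu> n) =
     (integral\<^sup>L (\<mu> n) f - integral\<^sup>L (\<nu> n) f) + (integral\<^sup>L (\<mu> n) g - integral\<^sup>L (\<nu> n) g)" for n
    using i[OF \<mu> add.hyps(1)] i[OF \<mu> add.hyps(2)] i[OF \<nu> add.hyps(1)] i[OF \<nu> add.hyps(2)] by simp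
  then show ?case using tendsto_add[OF add.IH] by simp
qed

text \<open>Rescaled and composed with the componentwise sine, a continuous function becomes a
  continuous function on a cube; a polynomial approximation on the cube is then a bounded
  trigonometric polynomial that is globally controlled and close to the given function on a large ball.\<close>

lemma trig_poly_approximation:
  fixes f :: "'a::euclidean_space \<Rightarrow> real"
  assumes f: "continuous_on UNIV f" and B: "\<And>x. \<bar>f x\<bar> \<le> B" and L: "0 < L" and e: "0 < e"
  obtains g where "trig_poly g" "\<And>x. \<bar>f x - g x\<bar> \<le> e + 2 * B * ((norm x)\<^sup>2 / L\<^sup>2)"
proof -
  define sn :: "'a \<Rightarrow> 'a" where "sn x = (\<Sum>b\<in>Basis. sin ((x \<bullet> b) / L) *\<^sub>R b)" for x
  define unsn :: "'a \<Rightarrow> 'a" where "unsn y = (\<Sum>b\<in>Basis. (L * arcsin (y \<bullet> b)) *\<^sub>R b)" for y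
  have snb: "sn x \<bullet> b = sin ((x \<bullet> b) / L)" if "b \<in> Basis" for x b
    using that by (simp add: sn_def inner_sum_left inner_Basis if_distrib cong: if_cong)
  have cube: "sn x \<in> cbox (- One) One" for x by (simp add: mem_box snb)
  have "continuous_on (cbox (- One) One) unsn"
    unfolding unsn_def
    by (intro continuous_intros) (auto simp: mem_box)
  then have "continuous_on (cbox (- One) One) (\<lambda>y. f (unsn y))"
    by (rule continuous_on_compose2[OF f]) auto
  from Stone_Weierstrass_real_polynomial_function[OF compact_cbox this e]
  obtain P where P: "real_polynomial_function P" "\<And>y. y \<in> cbox (- One) One \<Longrightarrow> \<bar>f (unsn y) - P y\<bar> < e"
    by blast
  have B0: "0 \<le> B" using B[of 0] by linarith
  \<comment> \<open>On the ball of radius \<open>L\<close> all arguments of the sine lie in [-1, 1],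
    well inside [-pi/2, pi/2], where \<open>arcsin\<close> inverts it.\<close>
  have inv: "unsn (sn x) = x" if "norm x \<le> L" for x
  proof -
    have "L * arcsin (sin ((x \<bullet> b) / L)) = x \<bullet> b" if "b \<in> Basis" for b
    proof -
      have "\<bar>x \<bullet> b\<bar> \<le> L" using Basis_le_norm[OF that, of x] \<open>norm x \<le> L\<close> by linarith
      then have "\<bar>(x \<bullet> b) / L\<bar> \<le> 1" using L by simp
      then have "- (pi / 2) \<le> (x \<bullet> b) / L" "(x \<bullet> b) / L \<le> pi / 2"
        using pi_gt3 unfolding abs_le_iff by linarith+
      then show ?thesis using L by (simp add: arcsin_sin)
    qed
    then show ?thesis unfolding unsn_def by (simp add: snb euclidean_representation cong: sum.cong)
  qed
  show thesis
  proof (rule that)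
    show "trig_poly (\<lambda>x. P (sn x))" unfolding sn_def by (rule trig_poly_sine_embedding[OF P(1)])
    fix x
    have 1: "\<bar>f (unsn (sn x)) - P (sn x)\<bar> \<le> e" using P(2)[OF cube] by (rule less_imp_le)
    show "\<bar>f x - P (sn x)\<bar> \<le> e + 2 * B * ((norm x)\<^sup>2 / L\<^sup>2)"
    proof (cases "norm x \<le> L")
      case True
      then show ?thesis using 1 B0 inv by (simp add: add_increasing2)
    next
      \<comment> \<open>\<open>sn x\<close> never leaves the cube, so \<open>P (sn x)\<close> is
        still close to some value of \<open>f\<close>, which differs from \<open>f x\<close> by at
        most \<open>2 * B\<close>. Outside the ball the quadratic factor is at least 1 and pays for
        this, as in Chebyshev's inequality.\<close>
      case False
      then have "L\<^sup>2 \<le> (norm x)\<^sup>2" using L by (intro power_mono) auto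
      then have "1 \<le> (norm x)\<^sup>2 / L\<^sup>2" using L by simp
      then have "2 * B * 1 \<le> 2 * B * ((norm x)\<^sup>2 / L\<^sup>2)" using B0 by (intro mult_left_mono) auto
      moreover have "\<bar>f x - f (unsn (sn x))\<bar> \<le> 2 * B" using B[of x] B[of "unsn (sn x)"] by linarith
      ultimately show ?thesis using 1 by linarith
    qed
  qed
qed

text \<open>One trigonometric polynomial serves all \<open>n\<close>: the common second moment bound
  makes the quadratic error of the approximation uniformly small under both sequences. No limit law
  appears.\<close>

lemma relatively_weakly_convergent_char:
  fixes \<mu> \<nu> :: "nat \<Rightarrow> 'a::euclidean_space measure"
  assumes \<mu>: "\<And>n. prob_space (\<mu> n)" "\<And>n. sets (\<mu> n) = sets borel"
      "\<And>n. integrable (\<mu> n) (\<lambda>x. (norm x)\<^sup>2)" "\<And>n. (\<integral>x. (norm x)\<^sup>2 \<partial>\<mu> n) \<le> C"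
    and \<nu>: "\<And>n. prob_space (\<nu> n)" "\<And>n. sets (\<nu> n) = sets borel"
      "\<And>n. integrable (\<nu> n) (\<lambda>x. (norm x)\<^sup>2)" "\<And>n. (\<integral>x. (norm x)\<^sup>2 \<partial>\<nu> n) \<le> C"
    and char: "\<And>t. (\<lambda>n. (\<integral>x. iexp (t \<bullet> x) \<partial>\<mu> n) - (\<integral>x. iexp (t \<bullet> x) \<partial>\<nu> n)) \<longlonglongrightarrow> 0"
  shows "relatively_weakly_convergent \<mu> \<nu>"
  unfolding relatively_weakly_convergent_def
proof (intro allI impI)
  fix f :: "'a \<Rightarrow> real"
  assume "continuous_on UNIV f \<and> bounded (range f)"
  then have f: "continuous_on UNIV f" and "bounded (range f)" by auto
  then obtain B where B: "\<bar>f x\<bar> \<le> B" for x by (auto simp: bounded_iff)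
  have B0: "0 \<le> B" using B[of 0] by linarith
  have fm: "f \<in> borel_measurable borel" by (rule borel_measurable_continuous_onI[OF f])
  show "(\<lambda>n. \<bar>integral\<^sup>L (\<mu> n) f - integral\<^sup>L (\<nu> n) f\<bar>) \<longlonglongrightarrow> 0"
  proof (rule tendsto_rabs_zero, rule LIMSEQ_I)
    fix r :: real assume r: "0 < r"
    define e where "e = r / 8"
    define C' where "C' = max C 0"
    \<comment> \<open>Chosen so that the quadratic error \<open>2 * B * C' / L^2\<close> is at most
      \<open>e\<close>; the added 1 keeps \<open>L\<close> positive when \<open>B\<close> or
      \<open>C'\<close> is 0. The total error is then below \<open>2 * e + 2 * e + e\<close>, which
      is less than \<open>r\<close>.\<close>
    define L where "L = sqrt (2 * B * C' / e) + 1"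
    have e: "0 < e" using r by (simp add: e_def)
    have L: "0 < L" unfolding L_def using B0 e by (simp add: C'_def add_nonneg_pos)
    have "2 * B * C' / e \<le> L\<^sup>2"
    proof -
      have "sqrt (2 * B * C' / e) \<le> L" by (simp add: L_def)
      then show ?thesis using sqrt_le_D by blast
    qed
    then have LC: "2 * B * (C' / L\<^sup>2) \<le> e" using L e by (simp add: field_simps)
    obtain g where g: "trig_poly g" "\<And>x. \<bar>f x - g x\<bar> \<le> e + 2 * B * ((norm x)\<^sup>2 / L\<^sup>2)"
      using trig_poly_approximation[OF f B L e] by blast
    have approx: "\<bar>integral\<^sup>L N f - integral\<^sup>L N g\<bar> \<le> 2 * e"
      if N: "prob_space N" "sets N = sets borel" "integrable N (\<lambda>x. (norm x)\<^sup>2)" "(\<integral>x. (norm x)\<^sup>2 \<partial>N) \<le> C" for N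
    proof -
      interpret prob_space N by fact
      obtain B' where B': "\<bar>g x\<bar> \<le> B'" for x using trig_poly_bounded[OF g(1)] by blast
      have i: "integrable N f" "integrable N g"
        using integrable_bounded_borel[OF N(1,2) fm B] integrable_bounded_borel[OF N(1,2) trig_poly_measurable[OF g(1)] B'] .
      have "\<bar>integral\<^sup>L N f - integral\<^sup>L N g\<bar> = \<bar>\<integral>x. f x - g x \<partial>N\<bar>" using i by simp
      also have "\<dots> \<le> (\<integral>x. \<bar>f x - g x\<bar> \<partial>N)" by (rule integral_abs_bound)
      also have "\<dots> \<le> (\<integral>x. e + 2 * B * ((norm x)\<^sup>2 / L\<^sup>2) \<partial>N)"
        by (rule integral_mono) (use i N(3) g(2) in auto)
      also have "\<dots> = e + 2 * B * ((\<integral>x. (norm x)\<^sup>2 \<partial>N) / L\<^sup>2)" using N(3) by (simp add: prob_space)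
      also have "\<dots> \<le> e + 2 * B * (C' / L\<^sup>2)"
        using N(4) B0 by (intro add_left_mono mult_left_mono divide_right_mono) (auto simp: C'_def)
      finally show ?thesis using LC by linarith
    qed
    obtain n0 where n0: "\<And>n. n \<ge> n0 \<Longrightarrow> norm (integral\<^sup>L (\<mu> n) g - integral\<^sup>L (\<nu> n) g - 0) < e"
      using LIMSEQ_D[OF trig_poly_integral_diff_tendsto[OF \<mu>(1,2) \<nu>(1,2) char g(1)] e] by blast
    have "norm (integral\<^sup>L (\<mu> n) f - integral\<^sup>L (\<nu> n) f - 0) < r" if "n \<ge> n0" for n
      using n0[OF that] approx[OF \<mu>, of n] approx[OF \<nu>, of n] r unfolding e_def real_norm_def by linarith
    then show "\<exists>n0. \<forall>n\<ge>n0. norm (integral\<^sup>L (\<mu> n) f - integral\<^sup>L (\<nu> n) f - 0) < r" by blast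
  qed
qed

section \<open>Gaussian vectors\<close>

definition quad_form :: "('d::finite \<Rightarrow> 'd \<Rightarrow> real) \<Rightarrow> ('d \<Rightarrow> real) \<Rightarrow> real" where
  "quad_form A x = (\<Sum>i\<in>UNIV. \<Sum>j\<in>UNIV. x i * A i j * x j)"

text \<open>\<open>of_bool (i = l)\<close> is the unit vector in direction \<open>l\<close>. The
  elimination below evaluates forms only at points moved along coordinates in this way, either
  starting from 0 or to complete a square.\<close>

lemma quad_form_add_unit:
  assumes sym: "\<And>i j. A i j = A j i"
  shows "quad_form A (\<lambda>i. x i + c * of_bool (i = l)) =
    quad_form A x + 2 * c * (\<Sum>i\<in>UNIV. x i * A i l) + c\<^sup>2 * A l l"
proof -
  have d: "(\<Sum>j\<in>UNIV. g j * of_bool (j = l)) = g l" for g :: "'a \<Rightarrow> real"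
    by (simp add: of_bool_def if_distrib cong: if_cong)
  have "quad_form A (\<lambda>i. x i + c * of_bool (i = l)) =
    (\<Sum>i\<in>UNIV. \<Sum>j\<in>UNIV. x i * A i j * x j + (c * x i * A i j) * of_bool (j = l)
      + ((c * A i j * x j) * of_bool (i = l) + (c * c * A i j * of_bool (i = l)) * of_bool (j = l)))"
    unfolding quad_form_def by (intro sum.cong refl) (simp add: algebra_simps)
  also have "\<dots> = quad_form A x + (\<Sum>i\<in>UNIV. c * x i * A i l)
      + ((\<Sum>j\<in>UNIV. c * A l j * x j) + c * c * A l l)"
    unfolding sum.distrib d quad_form_def
    by (simp only: sum_distrib_right[symmetric] d)
  also have "(\<Sum>j\<in>UNIV. c * A l j * x j) = (\<Sum>i\<in>UNIV. c * x i * A i l)"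
    using sym by (intro sum.cong refl) simp
  finally show ?thesis
    by (simp add: sum_distrib_left[symmetric] mult.assoc power2_eq_square)
qed

text \<open>Symmetric elimination: subtracting the rank-one form of a column with nonzero diagonal entry
  keeps the form nonnegative and clears one more diagonal entry.\<close>

lemma nonneg_quad_form_gram:
  fixes A :: "'d::finite \<Rightarrow> 'd \<Rightarrow> real"
  assumes "\<And>i j. A i j = A j i" "\<And>x. 0 \<le> quad_form A x"
  shows "\<exists>V. (\<forall>l. A l l = 0 \<longrightarrow> (\<forall>i. V l i = 0)) \<and> (\<forall>i j. A i j = (\<Sum>l\<in>UNIV. V l i * V l j))"
  using assms
proof (induction "card {l. A l l \<noteq> 0}" arbitrary: A rule: less_induct)
  case less
  note sym = less.prems(1) and psd = less.prems(2)
  note unit = quad_form_add_unit[where A = A, OF sym]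
  show ?case
  proof (cases "\<exists>l. A l l \<noteq> 0")
    case False
    have "A i j = 0" for i j
    proof -
      have 0: "quad_form A (\<lambda>k. 0 + 1 * of_bool (k = i)) = 0"
        unfolding unit using False by (simp add: quad_form_def)
      have "(\<Sum>k\<in>UNIV. (0 + 1 * of_bool (k = i)) * A k j) = (\<Sum>k\<in>UNIV. if k = i then A k j else 0)"
        by (intro sum.cong) auto
      then have s: "(\<Sum>k\<in>UNIV. (0 + 1 * of_bool (k = i)) * A k j) = A i j" by simp
      \<comment> \<open>With zero diagonal the form is linear in \<open>c\<close> along this line,
        so nonnegativity at \<open>c = 1\<close> and \<open>c = -1\<close> forces the entry to
        vanish.\<close>
      have "quad_form A (\<lambda>k. (0 + 1 * of_bool (k = i)) + c * of_bool (k = j)) = 2 * c * A i j" for c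
        unfolding unit[of "\<lambda>k. 0 + 1 * of_bool (k = i)" c j] 0 s using False by simp
      then have "0 \<le> 2 * c * A i j" for c using psd by metis
      from this[of 1] this[of "-1"] show ?thesis by simp
    qed
    then show ?thesis by (intro exI[of _ "\<lambda>_ _. 0"]) simp
  next
    case True
    then obtain l where l: "A l l \<noteq> 0" by blast
    have diag: "0 \<le> A i i" for i
      using psd[of "\<lambda>k. 0 + 1 * of_bool (k = i)"] unfolding unit by (simp add: quad_form_def)
    have lpos: "0 < A l l" using diag[of l] l by simp
    define v where "v i = A i l / sqrt (A l l)" for i
    define A' where "A' i j = A i j - v i * v j" for i j
    have vv: "v i * v j = A i l * A j l / A l l" for i j using lpos by (simp add: v_def)
    have sym': "A' i j = A' j i" for i j using sym by (simp add: A'_def)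
    \<comment> \<open>Completing the square: \<open>A'\<close> at \<open>x\<close> is the minimum of
      the form of \<open>A\<close> along the line through \<open>x\<close> in direction
      \<open>l\<close>, attained at the move \<open>- s / A l l\<close>.\<close>
    have psd': "0 \<le> quad_form A' x" for x
    proof -
      define s where "s = (\<Sum>i\<in>UNIV. x i * A i l)"
      have "quad_form A' x = quad_form A x - (\<Sum>i\<in>UNIV. \<Sum>j\<in>UNIV. (x i * A i l) * (x j * A j l)) / A l l"
        unfolding quad_form_def A'_def vv
        by (simp add: algebra_simps sum_subtractf sum_divide_distrib)
      also have "(\<Sum>i\<in>UNIV. \<Sum>j\<in>UNIV. (x i * A i l) * (x j * A j l)) = s * s"
        unfolding s_def sum_product ..
      also have "quad_form A x - s * s / A l l = quad_form A (\<lambda>i. x i + (- s / A l l) * of_bool (i = l))"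
        unfolding unit s_def[symmetric] using lpos by (simp add: field_simps power2_eq_square)
      finally show ?thesis using psd by simp
    qed
    have diag': "0 \<le> A' i i" for i
      using psd'[of "\<lambda>k. 0 + 1 * of_bool (k = i)"] unfolding quad_form_add_unit[where A = A', OF sym'] by (simp add: quad_form_def)
    have A'l: "A' l l = 0" using lpos by (simp add: A'_def vv)
    \<comment> \<open>A vanishing diagonal entry stays zero, since \<open>A' i i\<close> would be
      minus the square of \<open>v i\<close> and must be nonnegative. Together with
      \<open>A' l l = 0\<close> this makes the induction measure drop strictly.\<close>
    have zero: "v i = 0 \<and> A' i i = 0" if "A i i = 0" for i
    proof -
      have "(v i)\<^sup>2 \<le> 0" using diag'[of i] that by (simp add: A'_def power2_eq_square)
      then have "v i = 0" by simp
      then show ?thesis using that by (simp add: A'_def)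
    qed
    have "{i. A' i i \<noteq> 0} \<subset> {i. A i i \<noteq> 0}" using zero A'l l by auto
    then have "card {i. A' i i \<noteq> 0} < card {i. A i i \<noteq> 0}" by (intro psubset_card_mono) auto
    from less.hyps[OF this sym' psd'] obtain V where
      V: "\<And>k i. A' k k = 0 \<Longrightarrow> V k i = 0" "\<And>i j. A' i j = (\<Sum>k\<in>UNIV. V k i * V k j)" by blast
    \<comment> \<open>Slot \<open>l\<close> is free: \<open>A' l l = 0\<close> and the first
      conjunct of the induction claim make \<open>V l\<close> vanish, so the new vector is stored
      there and \<open>'d\<close> slots suffice.\<close>
    define W where "W = V(l := v)"
    have "A i j = (\<Sum>k\<in>UNIV. W k i * W k j)" for i j
    proof -
      have "(\<Sum>k\<in>UNIV. W k i * W k j) = W l i * W l j + (\<Sum>k\<in>UNIV - {l}. W k i * W k j)"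
        by (subst sum.remove[of _ l]) auto
      also have "(\<Sum>k\<in>UNIV - {l}. W k i * W k j) = (\<Sum>k\<in>UNIV - {l}. V k i * V k j)"
        by (intro sum.cong) (auto simp: W_def)
      also have "\<dots> = (\<Sum>k\<in>UNIV. V k i * V k j)"
        by (subst sum.remove[of UNIV l]) (auto simp: V(1)[OF A'l])
      finally show ?thesis using V(2)[of i j] by (simp add: W_def A'_def)
    qed
    moreover have "W k i = 0" if "A k k = 0" for k i
      using that l zero V(1) by (auto simp: W_def)
    ultimately show ?thesis by blast
  qed
qed

text \<open>One source space for all coefficient families reduces weak limits to dominated
  convergence. Zero or linearly dependent \<open>V l\<close> cover singular covariance
  matrices.\<close>

definition gaussian_vector_law :: "('k::finite \<Rightarrow> 'a::euclidean_space) \<Rightarrow> 'a measure" where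
  "gaussian_vector_law V =
     distr (PiM UNIV (\<lambda>_::'k. std_normal_distribution)) borel (\<lambda>x. \<Sum>l\<in>UNIV. x l *\<^sub>R V l)"

interpretation std_normal: real_distribution std_normal_distribution
  by (rule real_dist_normal_dist)

abbreviation std_normal_product :: "('k::finite \<Rightarrow> real) measure" where
  "std_normal_product \<equiv> PiM UNIV (\<lambda>_. std_normal_distribution)"

interpretation std_normal_product: product_prob_space "\<lambda>_. std_normal_distribution" "UNIV :: 'k::finite set"
  by unfold_locales

lemma measurable_gaussian_combination [measurable]:
  fixes V :: "'k::finite \<Rightarrow> 'a::euclidean_space"
  shows "(\<lambda>x. \<Sum>l\<in>UNIV. x l *\<^sub>R V l) \<in> borel_measurable std_normal_product"
proof (intro borel_measurable_sum borel_measurable_scaleR borel_measurable_const)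
  fix l :: 'k
  show "(\<lambda>x. x l) \<in> borel_measurable std_normal_product"
    using measurable_component_singleton[of l UNIV "\<lambda>_. std_normal_distribution"] by simp
qed

lemma sets_gaussian_vector_law [simp, measurable_cong]: "sets (gaussian_vector_law V) = sets borel"
  by (simp add: gaussian_vector_law_def)

lemma prob_space_gaussian_vector_law: "prob_space (gaussian_vector_law V)"
  unfolding gaussian_vector_law_def by (rule std_normal_product.prob_space_distr) measurable

lemma char_gaussian_vector_law:
  fixes V :: "'k::finite \<Rightarrow> 'a::euclidean_space"
  shows "(\<integral>y. iexp (t \<bullet> y) \<partial>gaussian_vector_law V) = complex_of_real (exp (- ((\<Sum>l\<in>UNIV. (t \<bullet> V l)\<^sup>2) / 2)))"
proof -
  have i: "integrable std_normal_distribution (\<lambda>x. iexp ((t \<bullet> V l) * x))" for l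
    by (intro std_normal.integrable_const_bound[of _ 1]) auto
  have "(\<integral>y. iexp (t \<bullet> y) \<partial>gaussian_vector_law V)
      = (\<integral>x. iexp (t \<bullet> (\<Sum>l\<in>UNIV. x l *\<^sub>R V l)) \<partial>std_normal_product)"
    unfolding gaussian_vector_law_def by (rule integral_distr) measurable
  also have "\<dots> = (\<integral>x. (\<Prod>l\<in>UNIV. iexp ((t \<bullet> V l) * x l)) \<partial>std_normal_product)"
    by (intro Bochner_Integration.integral_cong refl)
      (simp add: inner_sum_right exp_sum[symmetric] sum_distrib_left mult_ac)
  also have "\<dots> = (\<Prod>l\<in>UNIV. (\<integral>x. iexp ((t \<bullet> V l) * x) \<partial>std_normal_distribution))"
    by (rule std_normal_product.product_integral_prod) (use i in auto)
  also have "\<dots> = (\<Prod>l\<in>UNIV. complex_of_real (exp (- ((t \<bullet> V l)\<^sup>2) / 2)))"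
    using fun_cong[OF char_std_normal_distribution] by (simp add: char_def)
  also have "\<dots> = complex_of_real (exp (\<Sum>l\<in>UNIV. - ((t \<bullet> V l)\<^sup>2) / 2))"
    unfolding exp_sum[OF finite] of_real_prod ..
  finally show ?thesis by (simp add: sum_negf sum_divide_distrib)
qed

lemma normal_law_distr_std_normal:
  "0 < \<sigma> \<Longrightarrow> normal_law 0 \<sigma> = distr std_normal_distribution borel (\<lambda>x. \<sigma> * x)"
proof -
  assume \<sigma>: "0 < \<sigma>"
  have "distributed std_normal_distribution lborel (\<lambda>x. x) std_normal_density"
    by (auto simp: distributed_def distr_id2)
  from std_normal.normal_density_affine[OF this, of \<sigma> 0] \<sigma>
  have "distr std_normal_distribution lborel (\<lambda>x. \<sigma> * x) = density lborel (normal_density 0 \<sigma>)"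
    by (simp add: distributed_def)
  moreover have "distr std_normal_distribution lborel (\<lambda>x. \<sigma> * x) = distr std_normal_distribution borel (\<lambda>x. \<sigma> * x)"
    by (rule distr_cong) auto
  ultimately show ?thesis using \<sigma> by (simp add: normal_law_def)
qed

lemma real_distribution_normal_law:
  assumes "0 \<le> \<sigma>" shows "real_distribution (normal_law 0 \<sigma>)"
proof (cases "\<sigma> = 0")
  case True
  then show ?thesis
    by (auto simp: normal_law_def real_distribution_def real_distribution_axioms_def intro!: prob_space_return)
next
  case False
  then have "0 < \<sigma>" using assms by simp
  then show ?thesis
    unfolding normal_law_distr_std_normal[OF \<open>0 < \<sigma>\<close>] by (intro std_normal.real_distribution_distr) measurable
qed

lemma char_normal_law:
  assumes "0 \<le> \<sigma>" shows "char (normal_law 0 \<sigma>) t = complex_of_real (exp (- ((\<sigma> * t)\<^sup>2 / 2)))"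
proof (cases "\<sigma> = 0")
  case True
  then show ?thesis by (simp add: normal_law_def char_def integral_return)
next
  case False
  then have "0 < \<sigma>" using assms by simp
  then show ?thesis
    using fun_cong[OF char_std_normal_distribution, of "\<sigma> * t"]
    by (simp add: normal_law_distr_std_normal char_def integral_distr mult_ac)
qed

text \<open>The one-dimensional characteristic functions agree, and Levy's uniqueness theorem
  concludes; this includes directions of zero variance.\<close>

lemma gaussian_vector_law_projection:
  fixes V :: "'k::finite \<Rightarrow> 'a::euclidean_space"
  shows "distr (gaussian_vector_law V) borel (\<lambda>x. a \<bullet> x) = normal_law 0 (sqrt (\<Sum>l\<in>UNIV. (a \<bullet> V l)\<^sup>2))"
proof (rule Levy_uniqueness)
  interpret G: prob_space "gaussian_vector_law V" by (rule prob_space_gaussian_vector_law)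
  show "real_distribution (distr (gaussian_vector_law V) borel (\<lambda>x. a \<bullet> x))"
    by (rule G.real_distribution_distr) measurable
  show "real_distribution (normal_law 0 (sqrt (\<Sum>l\<in>UNIV. (a \<bullet> V l)\<^sup>2)))"
    by (rule real_distribution_normal_law) (simp add: sum_nonneg)
  show "char (distr (gaussian_vector_law V) borel (\<lambda>x. a \<bullet> x)) = char (normal_law 0 (sqrt (\<Sum>l\<in>UNIV. (a \<bullet> V l)\<^sup>2)))"
  proof
    fix t
    have "char (distr (gaussian_vector_law V) borel (\<lambda>x. a \<bullet> x)) t = (\<integral>y. iexp ((t *\<^sub>R a) \<bullet> y) \<partial>gaussian_vector_law V)"
      unfolding char_def by (subst integral_distr) (simp_all add: mult_ac)
    also have "\<dots> = complex_of_real (exp (- ((sqrt (\<Sum>l\<in>UNIV. (a \<bullet> V l)\<^sup>2) * t)\<^sup>2 / 2)))"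
      unfolding char_gaussian_vector_law
      by (simp add: power_mult_distrib sum_nonneg sum_distrib_left mult_ac)
    finally show "char (distr (gaussian_vector_law V) borel (\<lambda>x. a \<bullet> x)) t
        = char (normal_law 0 (sqrt (\<Sum>l\<in>UNIV. (a \<bullet> V l)\<^sup>2))) t"
      by (simp add: char_normal_law sum_nonneg)
  qed
qed

lemma centered_gaussian_gaussian_vector_law: "centered_gaussian_law (gaussian_vector_law V)"
  unfolding centered_gaussian_law_def
proof (intro conjI allI prob_space_gaussian_vector_law sets_gaussian_vector_law)
  show "\<exists>\<sigma>\<ge>0. distr (gaussian_vector_law V) borel (\<lambda>x. a \<bullet> x) = normal_law 0 \<sigma>" for a
    using gaussian_vector_law_projection[of V a]
    by (intro exI[of _ "sqrt (\<Sum>l\<in>UNIV. (a \<bullet> V l)\<^sup>2)"]) (simp add: sum_nonneg)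
qed

section \<open>Moments and weak limits of the Gaussian vector laws\<close>

lemma std_normal_product_moments:
  fixes a b :: "'k::finite"
  shows "integrable std_normal_product (\<lambda>x. x a)" "(\<integral>x. x a \<partial>std_normal_product) = 0"
    "integrable std_normal_product (\<lambda>x. x a * x b)"
    "(\<integral>x. x a * x b \<partial>std_normal_product) = of_bool (a = b)"
proof -
  have m: "integrable std_normal_distribution (\<lambda>x. x ^ n)" for n
    by (rule integrable_std_normal_distribution_moment)
  have m1: "integral\<^sup>L std_normal_distribution (\<lambda>x. x ^ 1) = 0"
    by (rule integral_std_normal_distribution_moment_odd) simp
  have m2: "integral\<^sup>L std_normal_distribution (\<lambda>x. x ^ 2) = 1"
    using std_normal_distribution_even_moments(1)[of 1] by simp
  have m0: "integral\<^sup>L std_normal_distribution (\<lambda>x. x ^ 0) = 1"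
    by (simp add: std_normal.prob_space[simplified])
  \<comment> \<open>Monomials with exponents built from \<open>of_bool\<close> let one product
    formula treat \<open>x a\<close> as well as \<open>x a * x b\<close>, for equal and for distinct
    indices.\<close>
  have I: "integrable std_normal_product (\<lambda>x. \<Prod>l\<in>UNIV. x l ^ n l)"
    "(\<integral>x. (\<Prod>l\<in>UNIV. x l ^ n l) \<partial>std_normal_product) = (\<Prod>l\<in>UNIV. integral\<^sup>L std_normal_distribution (\<lambda>x. x ^ n l))"
    for n :: "'k \<Rightarrow> nat"
    by (rule std_normal_product.product_integrable_prod std_normal_product.product_integral_prod finite m)+
  have p1: "(\<Prod>l\<in>UNIV. g l ^ of_bool (l = c)) = g c" for g :: "'k \<Rightarrow> real" and c
    by (simp add: of_bool_def if_distrib prod.delta cong: if_cong)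
  have p2: "(\<Prod>l\<in>UNIV. x l ^ (of_bool (l = a) + of_bool (l = b))) = x a * x b" for x :: "'k \<Rightarrow> real"
    by (simp add: power_add prod.distrib p1)
  show "integrable std_normal_product (\<lambda>x. x a)"
    using I(1)[of "\<lambda>l. of_bool (l = a)"] by (simp add: p1)
  show "integrable std_normal_product (\<lambda>x. x a * x b)"
    using I(1)[of "\<lambda>l. of_bool (l = a) + of_bool (l = b)"] by (simp add: p2)
  show "(\<integral>x. x a \<partial>std_normal_product) = 0"
  proof -
    have "(\<Prod>l\<in>UNIV. integral\<^sup>L std_normal_distribution (\<lambda>x. x ^ of_bool (l = a))) = 0"
      using m1 by (intro prod_zero) (auto intro!: bexI[of _ a])
    then show ?thesis using I(2)[of "\<lambda>l. of_bool (l = a)"] by (simp add: p1)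
  qed
  show "(\<integral>x. x a * x b \<partial>std_normal_product) = of_bool (a = b)"
  proof -
    have "(\<Prod>l\<in>UNIV. integral\<^sup>L std_normal_distribution (\<lambda>x. x ^ (of_bool (l = a) + of_bool (l = b)))) = of_bool (a = b)"
    proof (cases "a = b")
      case True
      have "integral\<^sup>L std_normal_distribution (\<lambda>x. x ^ (of_bool (l = a) + of_bool (l = b))) = 1" for l
        using m0 m2 True by (cases "l = a") (simp_all add: numeral_2_eq_2)
      then show ?thesis using True by simp
    next
      case False
      then have "integral\<^sup>L std_normal_distribution (\<lambda>x. x ^ (of_bool (a = a) + of_bool (a = b))) = 0" using m1 by simp
      then show ?thesis using False by (subst prod_zero[OF finite]) auto
    qed
    then show ?thesis using I(2)[of "\<lambda>l. of_bool (l = a) + of_bool (l = b)"] by (simp add: p2)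
  qed
qed

lemma gaussian_vector_law_moments:
  fixes V :: "'k::finite \<Rightarrow> real ^ 'd"
  shows "integrable (gaussian_vector_law V) (\<lambda>y. y $ i)" "(\<integral>y. y $ i \<partial>gaussian_vector_law V) = 0"
    "integrable (gaussian_vector_law V) (\<lambda>y. y $ i * y $ j)"
    "(\<integral>y. y $ i * y $ j \<partial>gaussian_vector_law V) = (\<Sum>l\<in>UNIV. V l $ i * V l $ j)"
proof -
  note M = std_normal_product_moments
  have meas: "(\<lambda>y::real ^ 'd. y $ i) \<in> borel_measurable borel"
    "(\<lambda>y::real ^ 'd. y $ i * y $ j) \<in> borel_measurable borel" for i j
    by (intro borel_measurable_continuous_onI continuous_intros)+
  have c: "(\<Sum>l\<in>UNIV. x l *\<^sub>R V l) $ i = (\<Sum>l\<in>UNIV. V l $ i * x l)" for x i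
    by (simp add: mult.commute)
  have cc: "(\<Sum>l\<in>UNIV. x l *\<^sub>R V l) $ i * (\<Sum>l\<in>UNIV. x l *\<^sub>R V l) $ j =
      (\<Sum>l\<in>UNIV. \<Sum>k\<in>UNIV. (V l $ i * V k $ j) * (x l * x k))" for x i j
    unfolding c sum_product by (simp add: mult_ac)
  show "integrable (gaussian_vector_law V) (\<lambda>y. y $ i)"
    unfolding gaussian_vector_law_def integrable_distr_eq[OF measurable_gaussian_combination meas(1)] c
    by (intro Bochner_Integration.integrable_sum integrable_mult_right M)
  show "(\<integral>y. y $ i \<partial>gaussian_vector_law V) = 0"
    unfolding gaussian_vector_law_def integral_distr[OF measurable_gaussian_combination meas(1)] c
    by (simp add: Bochner_Integration.integral_sum M)
  show "integrable (gaussian_vector_law V) (\<lambda>y. y $ i * y $ j)"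
    unfolding gaussian_vector_law_def integrable_distr_eq[OF measurable_gaussian_combination meas(2)] cc
    by (intro Bochner_Integration.integrable_sum integrable_mult_right M)
  have "(\<integral>y. y $ i * y $ j \<partial>gaussian_vector_law V) = (\<Sum>l\<in>UNIV. \<Sum>k\<in>UNIV. (V l $ i * V k $ j) * of_bool (l = k))"
    unfolding gaussian_vector_law_def integral_distr[OF measurable_gaussian_combination meas(2)] cc
    by (simp add: Bochner_Integration.integral_sum M Bochner_Integration.integrable_sum del: of_bool_eq)
  also have "\<dots> = (\<Sum>l\<in>UNIV. V l $ i * V l $ j)"
    by (simp add: of_bool_def if_distrib cong: if_cong)
  finally show "(\<integral>y. y $ i * y $ j \<partial>gaussian_vector_law V) = (\<Sum>l\<in>UNIV. V l $ i * V l $ j)" .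
qed

lemma converges_weakly_gaussian_vector_law:
  fixes V :: "nat \<Rightarrow> 'k::finite \<Rightarrow> 'a::euclidean_space"
  assumes "\<And>l. (\<lambda>n. V n l) \<longlonglongrightarrow> W l"
  shows "converges_weakly (\<lambda>n. gaussian_vector_law (V n)) (gaussian_vector_law W)"
  unfolding converges_weakly_def
proof (intro allI impI)
  fix f :: "'a \<Rightarrow> real" assume "continuous_on UNIV f \<and> bounded (range f)"
  then have f: "continuous_on UNIV f" and "bounded (range f)" by auto
  then obtain B where B: "\<bar>f x\<bar> \<le> B" for x by (auto simp: bounded_iff)
  have fm[measurable]: "f \<in> borel_measurable borel" by (rule borel_measurable_continuous_onI[OF f])
  have "(\<lambda>n. \<integral>x. f (\<Sum>l\<in>UNIV. x l *\<^sub>R V n l) \<partial>std_normal_product)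
      \<longlonglongrightarrow> (\<integral>x. f (\<Sum>l\<in>UNIV. x l *\<^sub>R W l) \<partial>std_normal_product)"
  proof (rule integral_dominated_convergence[where w = "\<lambda>_. B"])
    show "AE x in std_normal_product. (\<lambda>n. f (\<Sum>l\<in>UNIV. x l *\<^sub>R V n l)) \<longlonglongrightarrow> f (\<Sum>l\<in>UNIV. x l *\<^sub>R W l)"
      by (intro AE_I2 isCont_tendsto_compose[where g = f] tendsto_sum tendsto_scaleR tendsto_const assms)
        (use f in \<open>simp add: continuous_on_eq_continuous_at\<close>)
  qed (use B in auto)
  then show "(\<lambda>n. integral\<^sup>L (gaussian_vector_law (V n)) f) \<longlonglongrightarrow> integral\<^sup>L (gaussian_vector_law W) f"
    unfolding gaussian_vector_law_def integral_distr[OF measurable_gaussian_combination fm] .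
qed

lemma tight_borel_law_euclidean:
  fixes \<nu> :: "'a::euclidean_space measure"
  assumes "prob_space \<nu>" "sets \<nu> = sets borel"
  shows "tight_borel_law \<nu>"
  unfolding tight_borel_law_def
proof (intro conjI allI impI assms)
  interpret prob_space \<nu> by fact
  have sp: "space \<nu> = UNIV" using sets_eq_imp_space_eq[OF assms(2)] by simp
  fix e :: real assume e: "0 < e"
  have "(\<lambda>n. prob (cball 0 (real n))) \<longlonglongrightarrow> prob (\<Union>n. cball 0 (real n))"
    by (rule finite_Lim_measure_incseq) (auto simp: assms(2) incseq_def)
  also have "(\<Union>n. cball 0 (real n)) = (UNIV :: 'a set)"
    using real_arch_simple by auto
  finally have "(\<lambda>n. prob (cball 0 (real n))) \<longlonglongrightarrow> 1" using prob_space sp by simp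
  from LIMSEQ_D[OF this e] obtain n where "\<bar>prob (cball 0 (real n)) - 1\<bar> < e" by auto
  moreover have "prob (UNIV - cball 0 (real n)) = 1 - prob (cball 0 (real n))"
    using prob_compl[of "cball 0 (real n)"] assms(2) sp by simp
  ultimately have "measure \<nu> (UNIV - cball 0 (real n)) < e" by linarith
  then show "\<exists>C\<in>sets borel. compact C \<and> measure \<nu> (UNIV - C) < e"
    by (intro bexI[of _ "cball 0 (real n)"]) auto
qed

lemma relatively_compact_gaussian_vector_laws:
  fixes V :: "nat \<Rightarrow> real ^ 'd ^ 'k"
  assumes "bounded (range V)"
  shows "relatively_compact_laws (\<lambda>n. gaussian_vector_law (\<lambda>l. V n $ l))"
  unfolding relatively_compact_laws_def
proof (intro allI impI)
  fix r :: "nat \<Rightarrow> nat" assume "strict_mono r"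
  have "bounded (range (V \<circ> r))" by (rule bounded_subset[OF assms]) auto
  from bounded_imp_convergent_subsequence[OF this] obtain W s where
    s: "strict_mono s" "((V \<circ> r) \<circ> s) \<longlonglongrightarrow> W" by auto
  have "(\<lambda>n. V (r (s n)) $ l) \<longlonglongrightarrow> W $ l" for l
    using tendsto_vec_nth[OF s(2), of l] by (simp add: o_def)
  then have "converges_weakly (\<lambda>n. gaussian_vector_law (\<lambda>l. V (r (s n)) $ l)) (gaussian_vector_law (\<lambda>l. W $ l))"
    by (rule converges_weakly_gaussian_vector_law)
  then show "\<exists>s \<nu>. strict_mono s \<and> tight_borel_law \<nu> \<and> converges_weakly (\<lambda>n. gaussian_vector_law (\<lambda>l. V (r (s n)) $ l)) \<nu>"
    using s(1) tight_borel_law_euclidean[OF prob_space_gaussian_vector_law sets_gaussian_vector_law] by blast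
qed

section \<open>Rows of random vectors\<close>

lemma abs_diff_powr_le:
  fixes x y \<gamma> :: real assumes "0 \<le> \<gamma>"
  shows "\<bar>x - y\<bar> powr \<gamma> \<le> 2 powr \<gamma> * (\<bar>x\<bar> powr \<gamma> + \<bar>y\<bar> powr \<gamma>)"
proof -
  have "\<bar>x - y\<bar> powr \<gamma> \<le> (2 * max \<bar>x\<bar> \<bar>y\<bar>) powr \<gamma>"
    using assms by (intro powr_mono2) auto
  also have "\<dots> = 2 powr \<gamma> * max \<bar>x\<bar> \<bar>y\<bar> powr \<gamma>" by (simp add: powr_mult)
  also have "\<dots> \<le> 2 powr \<gamma> * (\<bar>x\<bar> powr \<gamma> + \<bar>y\<bar> powr \<gamma>)"
    by (intro mult_left_mono) (auto simp: max_def)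
  finally show ?thesis .
qed

lemma integrable_vecI:
  fixes f :: "'w \<Rightarrow> real ^ 'd"
  assumes "f \<in> borel_measurable M" "\<And>l. integrable M (\<lambda>w. f w $ l)"
  shows "integrable M f"
proof (rule Bochner_Integration.integrable_bound)
  show "integrable M (\<lambda>w. \<Sum>l\<in>UNIV. \<bar>f w $ l\<bar>)"
    by (intro Bochner_Integration.integrable_sum integrable_abs assms)
  show "AE w in M. norm (f w) \<le> norm (\<Sum>l\<in>UNIV. \<bar>f w $ l\<bar>)"
    using norm_le_l1_cart by (intro AE_I2) (simp add: sum_nonneg)
qed fact

lemma borel_measurable_vec_nth:
  fixes f :: "'w \<Rightarrow> real ^ 'd"
  assumes "f \<in> borel_measurable M" shows "(\<lambda>w. f w $ l) \<in> borel_measurable M"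
  by (rule measurable_compose[OF assms])
    (intro borel_measurable_continuous_onI continuous_intros)

text \<open>\<open>m = 0\<close> is allowed because \<open>relative_CLT\<close> constrains every
  \<open>n\<close>, including rows that are still empty. The moment bounds say nothing there, hence
  the separate assumption \<open>C_nonneg\<close>. The constant \<open>C\<close> is common to all
  components.\<close>

locale moment_row = prob_space M for M :: "'w measure" +
  fixes X :: "nat \<Rightarrow> 'w \<Rightarrow> real ^ 'd" and m :: nat and \<gamma> C :: real
  assumes measurable_X: "\<And>i. i \<in> {1..m} \<Longrightarrow> X i \<in> borel_measurable M"
    and \<gamma>: "2 < \<gamma>"
    and moment_integrable: "\<And>i l. i \<in> {1..m} \<Longrightarrow> integrable M (\<lambda>w. \<bar>X i w $ l\<bar> powr \<gamma>)"
    and moment_le: "\<And>i l. i \<in> {1..m} \<Longrightarrow> expectation (\<lambda>w. \<bar>X i w $ l\<bar> powr \<gamma>) \<le> C"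
    and C_nonneg: "0 \<le> C"
begin

definition Xc :: "nat \<Rightarrow> 'w \<Rightarrow> real ^ 'd" where
  "Xc i w = X i w - expectation (X i)"

definition scaled_sum :: "'w \<Rightarrow> real ^ 'd" where
  "scaled_sum w = (1 / sqrt (real m)) *\<^sub>R (\<Sum>i\<in>{1..m}. Xc i w)"

definition row_cov :: "'d \<Rightarrow> 'd \<Rightarrow> real" where
  "row_cov l1 l2 = (1 / real m) * (\<Sum>i\<in>{1..m}. \<Sum>j\<in>{1..m}. covar M (\<lambda>w. X i w $ l1) (\<lambda>w. X j w $ l2))"

lemma integrable_component:
  assumes "i \<in> {1..m}" shows "integrable M (\<lambda>w. X i w $ l)"
proof -
  have m: "(\<lambda>w. X i w $ l) \<in> borel_measurable M" by (rule borel_measurable_vec_nth[OF measurable_X[OF assms]])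
  show ?thesis
    using integrable_square_of_powr[OF m moment_integrable[OF assms]] \<gamma> by (intro square_integrable_imp_integrable[OF m]) simp
qed

lemma integrable_X: "i \<in> {1..m} \<Longrightarrow> integrable M (X i)"
  by (intro integrable_vecI measurable_X integrable_component)

lemma measurable_Xc: "i \<in> {1..m} \<Longrightarrow> Xc i \<in> borel_measurable M"
  unfolding Xc_def[abs_def] by (intro borel_measurable_diff borel_measurable_const measurable_X)

lemma Xc_component:
  assumes "i \<in> {1..m}" shows "Xc i w $ l = X i w $ l - expectation (\<lambda>w. X i w $ l)"
  using integral_bounded_linear[OF bounded_linear_vec_nth integrable_X[OF assms], of l] by (simp add: Xc_def)

lemma integrable_Xc_component:
  assumes "i \<in> {1..m}" shows "integrable M (\<lambda>w. Xc i w $ l)" "expectation (\<lambda>w. Xc i w $ l) = 0"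
  using integrable_component[OF assms] unfolding Xc_component[OF assms] by (simp_all add: prob_space)

lemma Xc_powr_le:
  assumes "i \<in> {1..m}"
  shows "\<bar>Xc i w $ l\<bar> powr \<gamma> \<le> 2 powr \<gamma> * (\<bar>X i w $ l\<bar> powr \<gamma> + (1 + C) powr \<gamma>)"
proof -
  have "\<bar>expectation (\<lambda>w. X i w $ l)\<bar> \<le> expectation (\<lambda>w. \<bar>X i w $ l\<bar>)" by (rule integral_abs_bound)
  also have "\<dots> \<le> expectation (\<lambda>w. 1 + \<bar>X i w $ l\<bar> powr \<gamma>)"
    using integrable_component[OF assms] moment_integrable[OF assms] abs_power_le_one_plus_powr[of 1 \<gamma>] \<gamma>
    by (intro integral_mono) auto
  also have "\<dots> \<le> 1 + C"
    using moment_integrable[OF assms] moment_le[OF assms, of l] by (simp add: prob_space)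
  finally have "\<bar>expectation (\<lambda>w. X i w $ l)\<bar> powr \<gamma> \<le> (1 + C) powr \<gamma>"
    using \<gamma> by (intro powr_mono2) auto
  moreover have "\<bar>Xc i w $ l\<bar> powr \<gamma> \<le> 2 powr \<gamma> * (\<bar>X i w $ l\<bar> powr \<gamma> + \<bar>expectation (\<lambda>w. X i w $ l)\<bar> powr \<gamma>)"
    unfolding Xc_component[OF assms] using \<gamma> by (intro abs_diff_powr_le) simp
  ultimately show ?thesis by (smt (verit) mult_left_mono powr_ge_zero)
qed

lemma integrable_Xc_product:
  assumes "i \<in> {1..m}" "j \<in> {1..m}"
  shows "integrable M (\<lambda>w. Xc i w $ l1 * Xc j w $ l2)"
proof -
  have *: "integrable M (\<lambda>w. (Xc i w $ l)\<^sup>2)" if i: "i \<in> {1..m}" for i l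
  proof (rule integrable_square_of_powr)
    show m: "(\<lambda>w. Xc i w $ l) \<in> borel_measurable M" by (intro borel_measurable_vec_nth measurable_Xc i)
    show "integrable M (\<lambda>w. \<bar>Xc i w $ l\<bar> powr \<gamma>)"
    proof (rule Bochner_Integration.integrable_bound)
      show "integrable M (\<lambda>w. 2 powr \<gamma> * (\<bar>X i w $ l\<bar> powr \<gamma> + (1 + C) powr \<gamma>))"
        using moment_integrable[OF i] by simp
      show "AE w in M. norm (\<bar>Xc i w $ l\<bar> powr \<gamma>) \<le> norm (2 powr \<gamma> * (\<bar>X i w $ l\<bar> powr \<gamma> + (1 + C) powr \<gamma>))"
        using Xc_powr_le[OF i] by (intro AE_I2) simp
    qed (use m in simp)
  qed (use \<gamma> in simp)
  show ?thesis
    using assms by (intro integrable_mult_square_integrable * borel_measurable_vec_nth measurable_Xc)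
qed

lemma expectation_Xc_product:
  assumes "i \<in> {1..m}" "j \<in> {1..m}"
  shows "expectation (\<lambda>w. Xc i w $ l1 * Xc j w $ l2) = covar M (\<lambda>w. X i w $ l1) (\<lambda>w. X j w $ l2)"
  unfolding covar_def Xc_component[OF assms(1)] Xc_component[OF assms(2)] ..

lemma scaled_sum_component: "scaled_sum w $ l = (1 / sqrt (real m)) * (\<Sum>i\<in>{1..m}. Xc i w $ l)"
  by (simp add: scaled_sum_def)

lemma measurable_scaled_sum: "scaled_sum \<in> borel_measurable M"
  unfolding scaled_sum_def[abs_def]
  by (intro borel_measurable_scaleR borel_measurable_const borel_measurable_sum measurable_Xc)

lemma scaled_sum_moments:
  "expectation (\<lambda>w. scaled_sum w $ l1) = 0"
  "integrable M (\<lambda>w. scaled_sum w $ l1 * scaled_sum w $ l2)"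
  "expectation (\<lambda>w. scaled_sum w $ l1 * scaled_sum w $ l2) = row_cov l1 l2"
proof -
  show "expectation (\<lambda>w. scaled_sum w $ l1) = 0"
    unfolding scaled_sum_component by (simp add: Bochner_Integration.integral_sum integrable_Xc_component)
  have e: "(\<lambda>w. scaled_sum w $ l1 * scaled_sum w $ l2) =
     (\<lambda>w. (1 / real m) * (\<Sum>i\<in>{1..m}. \<Sum>j\<in>{1..m}. Xc i w $ l1 * Xc j w $ l2))"
    unfolding scaled_sum_component by (simp add: sum_product sum_divide_distrib flip: real_sqrt_mult)
  show "integrable M (\<lambda>w. scaled_sum w $ l1 * scaled_sum w $ l2)"
    unfolding e by (intro integrable_mult_right Bochner_Integration.integrable_sum integrable_Xc_product)
  have "expectation (\<lambda>w. \<Sum>i\<in>{1..m}. \<Sum>j\<in>{1..m}. Xc i w $ l1 * Xc j w $ l2) =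
      (\<Sum>i\<in>{1..m}. expectation (\<lambda>w. \<Sum>j\<in>{1..m}. Xc i w $ l1 * Xc j w $ l2))"
    by (intro Bochner_Integration.integral_sum Bochner_Integration.integrable_sum integrable_Xc_product)
  also have "\<dots> = (\<Sum>i\<in>{1..m}. \<Sum>j\<in>{1..m}. expectation (\<lambda>w. Xc i w $ l1 * Xc j w $ l2))"
    by (intro sum.cong refl Bochner_Integration.integral_sum integrable_Xc_product)
  also have "\<dots> = (\<Sum>i\<in>{1..m}. \<Sum>j\<in>{1..m}. covar M (\<lambda>w. X i w $ l1) (\<lambda>w. X j w $ l2))"
    by (intro sum.cong refl expectation_Xc_product)
  finally show "expectation (\<lambda>w. scaled_sum w $ l1 * scaled_sum w $ l2) = row_cov l1 l2"
    unfolding e row_cov_def by simp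
qed

lemma cov_matrix_scaled_sum: "cov_matrix M scaled_sum $ l1 $ l2 = row_cov l1 l2"
  by (simp add: cov_matrix_def covar_def scaled_sum_moments)

lemma integral_quad_scaled_sum:
  "integrable M (\<lambda>w. (t \<bullet> scaled_sum w)\<^sup>2)"
  "expectation (\<lambda>w. (t \<bullet> scaled_sum w)\<^sup>2) = quad_form row_cov (\<lambda>l. t $ l)"
proof -
  have e: "(\<lambda>w. (t \<bullet> scaled_sum w)\<^sup>2) = (\<lambda>w. \<Sum>l1\<in>UNIV. \<Sum>l2\<in>UNIV. (t $ l1 * t $ l2) * (scaled_sum w $ l1 * scaled_sum w $ l2))"
    by (simp add: inner_vec_def power2_eq_square sum_product mult_ac)
  show "integrable M (\<lambda>w. (t \<bullet> scaled_sum w)\<^sup>2)"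
    unfolding e by (intro Bochner_Integration.integrable_sum integrable_mult_right scaled_sum_moments)
  show "expectation (\<lambda>w. (t \<bullet> scaled_sum w)\<^sup>2) = quad_form row_cov (\<lambda>l. t $ l)"
    unfolding e quad_form_def
    by (simp add: Bochner_Integration.integral_sum Bochner_Integration.integrable_sum scaled_sum_moments mult_ac)
qed

lemma integral_norm_scaled_sum:
  "integrable M (\<lambda>w. (norm (scaled_sum w))\<^sup>2)"
  "expectation (\<lambda>w. (norm (scaled_sum w))\<^sup>2) = (\<Sum>l\<in>UNIV. row_cov l l)"
  unfolding power2_norm_eq_inner inner_vec_def inner_real_def
  by (simp_all add: scaled_sum_moments Bochner_Integration.integral_sum)

text \<open>The form of \<open>row_cov\<close> at \<open>t\<close> is the second moment of
  \<open>t \<bullet> scaled_sum w\<close>, hence nonnegative, so symmetric elimination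
  applies.\<close>

lemma row_cov_gram: "\<exists>V. \<forall>l1 l2. row_cov l1 l2 = (\<Sum>l\<in>(UNIV :: 'd set). V l l1 * V l l2)"
proof -
  have sym: "row_cov l1 l2 = row_cov l2 l1" for l1 l2
    unfolding scaled_sum_moments(3)[symmetric] by (simp add: mult.commute)
  have psd: "0 \<le> quad_form row_cov x" for x
    using integral_quad_scaled_sum(2)[of "\<chi> l. x l"]
      Bochner_Integration.integral_nonneg[of M "\<lambda>w. ((\<chi> l. x l) \<bullet> scaled_sum w)\<^sup>2"] by simp
  from nonneg_quad_form_gram[of row_cov, OF sym psd] show ?thesis by blast
qed

text \<open>Convexity over the coordinates combined with \<open>Xc_powr_le\<close>, where
  \<open>1 + C\<close> bounds the absolute mean. Only \<open>t\<close>, \<gamma> and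
  \<open>C\<close> occur, so the value is the same for all rows.\<close>

definition projected_moment_bound :: "real ^ 'd \<Rightarrow> real" where
  "projected_moment_bound t =
     real CARD('d) powr (\<gamma> - 1) * (\<Sum>l\<in>UNIV. \<bar>t $ l\<bar> powr \<gamma> * (2 powr \<gamma> * (C + (1 + C) powr \<gamma>)))"

text \<open>The passage to real rows: functions of the single \<open>X i\<close> inherit the event
  bound, which is twice \<open>row_beta\<close>, and bilinearity of the covariance yields the new
  covariance constant.\<close>

lemma mixing_row_projection:
  assumes m: "1 \<le> m" and b: "0 < b" "2 * row_beta M X m p \<le> b"
    and K: "\<And>l1 l2. (1 / real m) * (\<Sum>i\<in>{1..m}. \<Sum>j\<in>{1..m}. \<bar>covar M (\<lambda>w. X i w $ l1) (\<lambda>w. X j w $ l2)\<bar>) \<le> K"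
  shows "mixing_row M (\<lambda>i w. t \<bullet> Xc i w) m p b \<gamma> (projected_moment_bound t)
    ((\<Sum>l1\<in>UNIV. \<Sum>l2\<in>UNIV. \<bar>t $ l1\<bar> * \<bar>t $ l2\<bar>) * K)"
proof
  show "1 \<le> m" "2 < \<gamma>" "0 < b" using m \<gamma> b by auto
  have mt[measurable]: "(\<lambda>x. t \<bullet> x) \<in> borel_measurable borel" by measurable
  show meas: "(\<lambda>w. t \<bullet> Xc i w) \<in> borel_measurable M" if "i \<in> {1..m}" for i
    by (rule measurable_compose[OF measurable_Xc[OF that] mt])
  show "expectation (\<lambda>w. t \<bullet> Xc i w) = 0" if "i \<in> {1..m}" for i
    unfolding inner_vec_def inner_real_def using integrable_Xc_component[OF that]
    by (simp add: Bochner_Integration.integral_sum)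
  show "\<bar>prob (A \<inter> B) - prob A * prob B\<bar> \<le> b"
    if "I \<subseteq> {1..m}" "J \<subseteq> {1..m}" "\<And>i j. i \<in> I \<Longrightarrow> j \<in> J \<Longrightarrow> i + p \<le> j"
      "A \<in> sigma_rv M (\<lambda>i w. t \<bullet> Xc i w) I" "B \<in> sigma_rv M (\<lambda>i w. t \<bullet> Xc i w) J" for I J A B
  proof -
    have "sigma_rv M (\<lambda>i w. t \<bullet> Xc i w) I \<subseteq> sigma_rv M X I" for I
      unfolding Xc_def by (rule sigma_rv_compose_subset) measurable
    then have "A \<in> sigma_rv M X I" "B \<in> sigma_rv M X J" using that by auto
    from row_beta_separated[OF measurable_X that(1-3) this] show ?thesis using b(2) by linarith
  qed
  have pw: "\<bar>t \<bullet> Xc i w\<bar> powr \<gamma> \<le> real CARD('d) powr (\<gamma> - 1) *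
      (\<Sum>l\<in>UNIV. \<bar>t $ l\<bar> powr \<gamma> * (2 powr \<gamma> * (\<bar>X i w $ l\<bar> powr \<gamma> + (1 + C) powr \<gamma>)))" if i: "i \<in> {1..m}" for i w
  proof -
    have "\<bar>t \<bullet> Xc i w\<bar> powr \<gamma> \<le> real CARD('d) powr (\<gamma> - 1) * (\<Sum>l\<in>UNIV. \<bar>t $ l * Xc i w $ l\<bar> powr \<gamma>)"
      unfolding inner_vec_def inner_real_def using \<gamma> by (intro powr_sum_le) auto
    also have "\<dots> \<le> real CARD('d) powr (\<gamma> - 1) *
      (\<Sum>l\<in>UNIV. \<bar>t $ l\<bar> powr \<gamma> * (2 powr \<gamma> * (\<bar>X i w $ l\<bar> powr \<gamma> + (1 + C) powr \<gamma>)))"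
      unfolding abs_mult powr_mult by (intro mult_left_mono sum_mono Xc_powr_le i) auto
    finally show ?thesis .
  qed
  have ib: "integrable M (\<lambda>w. real CARD('d) powr (\<gamma> - 1) *
      (\<Sum>l\<in>UNIV. \<bar>t $ l\<bar> powr \<gamma> * (2 powr \<gamma> * (\<bar>X i w $ l\<bar> powr \<gamma> + (1 + C) powr \<gamma>))))" if "i \<in> {1..m}" for i
    by (intro integrable_mult_right Bochner_Integration.integrable_sum Bochner_Integration.integrable_add
        moment_integrable that integrable_const)
  show ip: "integrable M (\<lambda>w. \<bar>t \<bullet> Xc i w\<bar> powr \<gamma>)" if i: "i \<in> {1..m}" for i
    by (rule Bochner_Integration.integrable_bound[OF ib[OF i]])
      (use meas[OF i] in \<open>auto intro!: AE_I2 order_trans[OF pw[OF i] abs_ge_self]\<close>)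
  show "expectation (\<lambda>w. \<bar>t \<bullet> Xc i w\<bar> powr \<gamma>) \<le> projected_moment_bound t" if i: "i \<in> {1..m}" for i
  proof -
    have "expectation (\<lambda>w. \<bar>t \<bullet> Xc i w\<bar> powr \<gamma>) \<le> expectation (\<lambda>w. real CARD('d) powr (\<gamma> - 1) *
      (\<Sum>l\<in>UNIV. \<bar>t $ l\<bar> powr \<gamma> * (2 powr \<gamma> * (\<bar>X i w $ l\<bar> powr \<gamma> + (1 + C) powr \<gamma>))))"
      by (rule integral_mono[OF ip[OF i] ib[OF i] pw[OF i]])
    also have "\<dots> = real CARD('d) powr (\<gamma> - 1) *
      (\<Sum>l\<in>UNIV. \<bar>t $ l\<bar> powr \<gamma> * (2 powr \<gamma> * (expectation (\<lambda>w. \<bar>X i w $ l\<bar> powr \<gamma>) + (1 + C) powr \<gamma>)))"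
      using moment_integrable[OF i] by (simp add: Bochner_Integration.integral_sum prob_space)
    also have "\<dots> \<le> projected_moment_bound t"
      unfolding projected_moment_bound_def
      by (intro mult_left_mono sum_mono add_right_mono moment_le[OF i]) auto
    finally show ?thesis .
  qed
  show "(\<Sum>i\<in>{1..m}. \<Sum>j\<in>{1..m}. \<bar>expectation (\<lambda>w. (t \<bullet> Xc i w) * (t \<bullet> Xc j w))\<bar>)
      \<le> ((\<Sum>l1\<in>UNIV. \<Sum>l2\<in>UNIV. \<bar>t $ l1\<bar> * \<bar>t $ l2\<bar>) * K) * real m"
  proof -
    let ?c = "\<lambda>i j l1 l2. covar M (\<lambda>w. X i w $ l1) (\<lambda>w. X j w $ l2)"
    have "\<bar>expectation (\<lambda>w. (t \<bullet> Xc i w) * (t \<bullet> Xc j w))\<bar> \<le> (\<Sum>l1\<in>UNIV. \<Sum>l2\<in>UNIV. (\<bar>t $ l1\<bar> * \<bar>t $ l2\<bar>) * \<bar>?c i j l1 l2\<bar>)"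
      if i: "i \<in> {1..m}" and j: "j \<in> {1..m}" for i j
    proof -
      have "(\<lambda>w. (t \<bullet> Xc i w) * (t \<bullet> Xc j w)) =
          (\<lambda>w. \<Sum>l1\<in>UNIV. \<Sum>l2\<in>UNIV. (t $ l1 * t $ l2) * (Xc i w $ l1 * Xc j w $ l2))"
        by (simp add: inner_vec_def sum_product mult_ac)
      then have "expectation (\<lambda>w. (t \<bullet> Xc i w) * (t \<bullet> Xc j w)) = (\<Sum>l1\<in>UNIV. \<Sum>l2\<in>UNIV. (t $ l1 * t $ l2) * ?c i j l1 l2)"
        using integrable_Xc_product[OF i j] expectation_Xc_product[OF i j]
        by (simp add: Bochner_Integration.integral_sum Bochner_Integration.integrable_sum)
      also have "\<bar>\<dots>\<bar> \<le> (\<Sum>l1\<in>UNIV. \<Sum>l2\<in>UNIV. \<bar>(t $ l1 * t $ l2) * ?c i j l1 l2\<bar>)"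
        by (intro order_trans[OF sum_abs] sum_mono sum_abs)
      finally show ?thesis by (simp add: abs_mult)
    qed
    then have "(\<Sum>i\<in>{1..m}. \<Sum>j\<in>{1..m}. \<bar>expectation (\<lambda>w. (t \<bullet> Xc i w) * (t \<bullet> Xc j w))\<bar>)
      \<le> (\<Sum>i\<in>{1..m}. \<Sum>j\<in>{1..m}. \<Sum>l1\<in>UNIV. \<Sum>l2\<in>UNIV. (\<bar>t $ l1\<bar> * \<bar>t $ l2\<bar>) * \<bar>?c i j l1 l2\<bar>)"
      by (intro sum_mono)
    also have "\<dots> = (\<Sum>l1\<in>UNIV. \<Sum>l2\<in>UNIV. (\<bar>t $ l1\<bar> * \<bar>t $ l2\<bar>) * (\<Sum>i\<in>{1..m}. \<Sum>j\<in>{1..m}. \<bar>?c i j l1 l2\<bar>))"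
      unfolding sum_distrib_left sum_swap3[where A = "{1..m}"] ..
    also have "\<dots> \<le> (\<Sum>l1\<in>UNIV. \<Sum>l2\<in>UNIV. (\<bar>t $ l1\<bar> * \<bar>t $ l2\<bar>) * (K * real m))"
    proof (intro sum_mono mult_left_mono)
      show "(\<Sum>i\<in>{1..m}. \<Sum>j\<in>{1..m}. \<bar>?c i j l1 l2\<bar>) \<le> K * real m" for l1 l2
        using K[of l1 l2] m by (simp add: field_simps)
    qed simp
    finally show ?thesis by (simp add: sum_distrib_right mult.assoc)
  qed
qed

lemma char_scaled_sum_bound:
  fixes q :: nat and \<epsilon> :: real and t :: "real ^ 'd"
  assumes m: "1 \<le> m" and b: "0 < b" "2 * row_beta M X m p \<le> b"
    and K: "\<And>l1 l2. (1 / real m) * (\<Sum>i\<in>{1..m}. \<Sum>j\<in>{1..m}. \<bar>covar M (\<lambda>w. X i w $ l1) (\<lambda>w. X j w $ l2)\<bar>) \<le> K"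
    and q: "1 \<le> q" and \<epsilon>: "0 < \<epsilon>"
  defines "K' \<equiv> (\<Sum>l1\<in>UNIV. \<Sum>l2\<in>UNIV. \<bar>t $ l1\<bar> * \<bar>t $ l2\<bar>) * K"
    and "C' \<equiv> projected_moment_bound t"
  shows "cmod (expectation (\<lambda>w. iexp (t \<bullet> scaled_sum w)) - complex_of_real (exp (- (quad_form row_cov (\<lambda>l. t $ l) / 2))))
    \<le> \<epsilon> + real p / real (p + q) * K' / \<epsilon> + 16 * real (m + 1) * b
      + (\<epsilon> * K' + \<epsilon> powr (2 - \<gamma>) * (C' * (real q powr (\<gamma> - 1) * real m powr (1 - \<gamma> / 2))))
      + K' * ((real q)\<^sup>2 * (1 + C') / real m)
      + (real p / real (p + q) * K' + real m * ((4 + 3 * C') * b powr ((\<gamma> - 2) / \<gamma>)) / 2)"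
proof -
  interpret row: mixing_row M "\<lambda>i w. t \<bullet> Xc i w" m p b \<gamma> C' K'
    unfolding K'_def C'_def by (rule mixing_row_projection[OF m b K])
  have "(1 / sqrt (real m)) * (\<Sum>i\<in>{1..m}. t \<bullet> Xc i w) = t \<bullet> scaled_sum w" for w
    by (simp add: scaled_sum_def inner_sum_right)
  then show ?thesis
    using row.char_sum_gaussian_bound[OF q \<epsilon>] by (simp only: integral_quad_scaled_sum(2))
qed

end

section \<open>Rates and the passage to the limit\<close>

lemma block_length_sequence:
  fixes k :: "nat \<Rightarrow> nat" and \<gamma> \<alpha> :: real
  assumes k: "filterlim k at_top sequentially" and \<gamma>: "\<gamma> > 2"
    and \<alpha>: "\<alpha> < (\<gamma> - 2) / (2 * (\<gamma> - 1))"
  defines "p \<equiv> \<lambda>n. nat \<lfloor>real (k n) powr \<alpha>\<rfloor>"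
  obtains q :: "nat \<Rightarrow> nat" where "\<And>n. 1 \<le> q n"
    "(\<lambda>n. real (p n) / real (p n + q n)) \<longlonglongrightarrow> 0"
    "(\<lambda>n. real (q n) powr (\<gamma> - 1) * real (k n) powr (1 - \<gamma> / 2)) \<longlonglongrightarrow> 0"
    "(\<lambda>n. (real (q n))\<^sup>2 / real (k n)) \<longlonglongrightarrow> 0"
proof -
  define a where "a = (\<gamma> - 2) / (2 * (\<gamma> - 1))"
  have a: "0 < a" "a < 1 / 2" "a * (\<gamma> - 1) = (\<gamma> - 2) / 2" using \<gamma> by (auto simp: a_def field_simps)
  \<comment> \<open>Above \<alpha>, \<open>d\<close> makes the gaps short relative to the blocks;
    below \<open>a\<close>, which is less than 1/2, it gives the other two limits. The
    \<open>max\<close> keeps \<open>d\<close> positive for nonpositive \<alpha>, and the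
    \<open>+ 1\<close> in \<open>q\<close> gives \<open>1 \<le> q n\<close> for every
    \<open>n\<close>.\<close>
  define d where "d = (max \<alpha> 0 + a) / 2"
  have d: "\<alpha> < d" "0 < d" "d < a" using \<alpha> a unfolding d_def a_def[symmetric] by auto
  define q where "q n = nat \<lfloor>real (k n) powr d\<rfloor> + 1" for n
  have x: "filterlim (\<lambda>n. real (k n)) at_top sequentially"
    by (rule filterlim_compose[OF filterlim_real_sequentially k])
  have ev: "eventually (\<lambda>n. 1 \<le> real (k n)) sequentially"
    using x unfolding filterlim_at_top by blast
  have qb: "real (k n) powr d \<le> real (q n)" for n unfolding q_def by linarith
  have qu: "real (q n) \<le> 2 * real (k n) powr d" if "1 \<le> real (k n)" for n
  proof -
    have "1 \<le> real (k n) powr d" using that d by (simp add: ge_one_powr_ge_zero)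
    then show ?thesis unfolding q_def by linarith
  qed
  show thesis
  proof (rule that)
    show "1 \<le> q n" for n by (simp add: q_def)
    have "(\<lambda>n. real (k n) powr (\<alpha> - d)) \<longlonglongrightarrow> 0" using d by (intro tendsto_neg_powr x) simp
    then show "(\<lambda>n. real (p n) / real (p n + q n)) \<longlonglongrightarrow> 0"
    proof (rule tendsto_sandwich[OF _ _ tendsto_const, rotated 2])
      show "eventually (\<lambda>n. real (p n) / real (p n + q n) \<le> real (k n) powr (\<alpha> - d)) sequentially"
        using ev
      proof eventually_elim
        case (elim n)
        have "real (p n) \<le> real (k n) powr \<alpha>" unfolding p_def by simp
        moreover have "real (k n) powr d \<le> real (p n + q n)" using qb[of n] by simp
        moreover have "0 < real (k n) powr d" using elim by simp
        ultimately have "real (p n) / real (p n + q n) \<le> real (k n) powr \<alpha> / real (k n) powr d"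
          by (intro frac_le) auto
        then show ?case by (simp add: powr_diff)
      qed
    qed simp
    have "(\<lambda>n. 2 powr (\<gamma> - 1) * real (k n) powr (d * (\<gamma> - 1) + (1 - \<gamma> / 2))) \<longlonglongrightarrow> 2 powr (\<gamma> - 1) * 0"
    proof (intro tendsto_mult tendsto_const tendsto_neg_powr x)
      have "d * (\<gamma> - 1) < a * (\<gamma> - 1)" using d \<gamma> by (intro mult_strict_right_mono) auto
      then show "d * (\<gamma> - 1) + (1 - \<gamma> / 2) < 0" using a(3) by (simp add: field_simps)
    qed
    then have "(\<lambda>n. 2 powr (\<gamma> - 1) * real (k n) powr (d * (\<gamma> - 1) + (1 - \<gamma> / 2))) \<longlonglongrightarrow> 0" by simp
    then show "(\<lambda>n. real (q n) powr (\<gamma> - 1) * real (k n) powr (1 - \<gamma> / 2)) \<longlonglongrightarrow> 0"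
    proof (rule tendsto_sandwich[OF _ _ tendsto_const, rotated 2])
      show "eventually (\<lambda>n. real (q n) powr (\<gamma> - 1) * real (k n) powr (1 - \<gamma> / 2)
          \<le> 2 powr (\<gamma> - 1) * real (k n) powr (d * (\<gamma> - 1) + (1 - \<gamma> / 2))) sequentially"
        using ev
      proof eventually_elim
        case (elim n)
        have "real (q n) powr (\<gamma> - 1) \<le> (2 * real (k n) powr d) powr (\<gamma> - 1)"
          using \<gamma> qu[OF elim] by (intro powr_mono2) auto
        also have "\<dots> = 2 powr (\<gamma> - 1) * real (k n) powr (d * (\<gamma> - 1))"
          by (simp add: powr_mult powr_powr)
        finally have "real (q n) powr (\<gamma> - 1) * real (k n) powr (1 - \<gamma> / 2)
            \<le> 2 powr (\<gamma> - 1) * real (k n) powr (d * (\<gamma> - 1)) * real (k n) powr (1 - \<gamma> / 2)"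
          by (intro mult_right_mono) auto
        then show ?case by (simp only: powr_add mult.assoc)
      qed
    qed simp
    have "(\<lambda>n. 4 * real (k n) powr (2 * d - 1)) \<longlonglongrightarrow> 4 * 0"
      using d a by (intro tendsto_mult tendsto_const tendsto_neg_powr x) simp
    then have "(\<lambda>n. 4 * real (k n) powr (2 * d - 1)) \<longlonglongrightarrow> 0" by simp
    then show "(\<lambda>n. (real (q n))\<^sup>2 / real (k n)) \<longlonglongrightarrow> 0"
    proof (rule tendsto_sandwich[OF _ _ tendsto_const, rotated 2])
      show "eventually (\<lambda>n. (real (q n))\<^sup>2 / real (k n) \<le> 4 * real (k n) powr (2 * d - 1)) sequentially"
        using ev
      proof eventually_elim
        case (elim n)
        have "(real (q n))\<^sup>2 \<le> (2 * real (k n) powr d)\<^sup>2" using qu[OF elim] by (intro power_mono) auto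
        also have "\<dots> = 4 * real (k n) powr (2 * d)"
          by (simp add: power_mult_distrib power2_eq_square flip: powr_add)
        finally have "(real (q n))\<^sup>2 / real (k n) \<le> 4 * real (k n) powr (2 * d) / real (k n)"
          by (intro divide_right_mono) auto
        then show ?case using elim by (simp add: powr_diff)
      qed
    qed simp
  qed
qed

text \<open>The mixing bound is made strictly positive by a negligible summand, so that it can be used as
  a truncation parameter even when the coefficients vanish.\<close>

lemma positive_mixing_rate:
  fixes k :: "nat \<Rightarrow> nat" and \<beta> :: "nat \<Rightarrow> real"
  assumes k: "filterlim k at_top sequentially" and \<delta>: "0 < \<delta>" "\<delta> \<le> 1" and \<beta>0: "\<And>n. 0 \<le> \<beta> n"
    and \<beta>: "(\<lambda>n. real (k n) * \<beta> n powr \<delta>) \<longlonglongrightarrow> 0"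
  obtains b where "\<And>n. 1 \<le> k n \<Longrightarrow> 0 < b n" "\<And>n. 2 * \<beta> n \<le> b n"
    "(\<lambda>n. real (k n) * b n powr \<delta>) \<longlonglongrightarrow> 0" "(\<lambda>n. real (k n + 1) * b n) \<longlonglongrightarrow> 0"
proof -
  \<comment> \<open>The \<delta>-th power of the added summand is k^(-2), which leaves 1/k after
    multiplication by k.\<close>
  define b where "b n = 2 * \<beta> n + real (k n) powr (- (2 / \<delta>))" for n
  have x: "filterlim (\<lambda>n. real (k n)) at_top sequentially"
    by (rule filterlim_compose[OF filterlim_real_sequentially k])
  have ev: "eventually (\<lambda>n. 1 \<le> real (k n)) sequentially"
    using x unfolding filterlim_at_top by blast
  have b0: "0 \<le> b n" for n using \<beta>0 by (simp add: b_def)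
  have "(\<lambda>n. 4 powr \<delta> * (real (k n) * \<beta> n powr \<delta>) + 2 powr \<delta> * real (k n) powr (- 1)) \<longlonglongrightarrow> 4 powr \<delta> * 0 + 2 powr \<delta> * 0"
    by (intro tendsto_intros \<beta> tendsto_neg_powr x) simp
  then have lim: "(\<lambda>n. 4 powr \<delta> * (real (k n) * \<beta> n powr \<delta>) + 2 powr \<delta> * real (k n) powr (- 1)) \<longlonglongrightarrow> 0" by simp
  have B: "(\<lambda>n. real (k n) * b n powr \<delta>) \<longlonglongrightarrow> 0"
  proof (rule tendsto_sandwich[OF _ _ tendsto_const lim])
    show "eventually (\<lambda>n. real (k n) * b n powr \<delta> \<le>
        4 powr \<delta> * (real (k n) * \<beta> n powr \<delta>) + 2 powr \<delta> * real (k n) powr (- 1)) sequentially"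
      using ev
    proof eventually_elim
      case (elim n)
      have "b n \<le> max (4 * \<beta> n) (2 * real (k n) powr (- (2 / \<delta>)))" unfolding b_def by linarith
      then have "b n powr \<delta> \<le> (max (4 * \<beta> n) (2 * real (k n) powr (- (2 / \<delta>)))) powr \<delta>"
        using \<delta> b0 by (intro powr_mono2) auto
      also have "\<dots> \<le> (4 * \<beta> n) powr \<delta> + (2 * real (k n) powr (- (2 / \<delta>))) powr \<delta>"
        by (simp add: max_def)
      also have "\<dots> = 4 powr \<delta> * \<beta> n powr \<delta> + 2 powr \<delta> * real (k n) powr (- 2)"
        using \<delta> \<beta>0 by (simp add: powr_mult powr_powr)
      finally have "real (k n) * b n powr \<delta> \<le> real (k n) * (4 powr \<delta> * \<beta> n powr \<delta> + 2 powr \<delta> * real (k n) powr (- 2))"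
        by (intro mult_left_mono) auto
      also have "\<dots> = 4 powr \<delta> * (real (k n) * \<beta> n powr \<delta>) + 2 powr \<delta> * (real (k n) powr 1 * real (k n) powr (- 2))"
        using elim by (simp add: algebra_simps)
      also have "real (k n) powr 1 * real (k n) powr (- 2) = real (k n) powr (- 1)"
        unfolding powr_add[symmetric] by simp
      finally show ?case .
    qed
  qed simp
  show thesis
  proof (rule that[of b])
    show "0 < b n" if "1 \<le> k n" for n using that \<beta>0[of n] by (simp add: b_def add_nonneg_pos)
    show "2 * \<beta> n \<le> b n" for n by (simp add: b_def)
    \<comment> \<open>Eventually \<open>b n powr \<delta> < 1\<close>, so
      \<open>b n \<le> 1\<close>, and then \<open>b n \<le> b n powr \<delta>\<close> as \<delta> is
      at most 1. Thus the rate needed for factorization follows from that for covariances; the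
      factor 2 absorbs k + 1 <= 2k.\<close>
    have "(\<lambda>n. 2 * (real (k n) * b n powr \<delta>)) \<longlonglongrightarrow> 2 * 0" by (intro tendsto_intros B)
    then have "(\<lambda>n. 2 * (real (k n) * b n powr \<delta>)) \<longlonglongrightarrow> 0" by simp
    then show "(\<lambda>n. real (k n + 1) * b n) \<longlonglongrightarrow> 0"
    proof (rule tendsto_sandwich[OF _ _ tendsto_const, rotated 2])
      have "eventually (\<lambda>n. real (k n) * b n powr \<delta> < 1) sequentially"
        using order_tendstoD(2)[OF B] by simp
      then show "eventually (\<lambda>n. real (k n + 1) * b n \<le> 2 * (real (k n) * b n powr \<delta>)) sequentially"
        using ev
      proof eventually_elim
        case (elim n)
        have "1 * b n powr \<delta> \<le> real (k n) * b n powr \<delta>" using elim by (intro mult_right_mono) auto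
        then have small: "b n powr \<delta> < 1" using elim by linarith
        have "b n \<le> 1"
        proof (rule ccontr)
          assume "\<not> b n \<le> 1"
          then have "1 \<le> b n powr \<delta>" using \<delta> by (intro ge_one_powr_ge_zero) auto
          then show False using small by simp
        qed
        then have "b n powr 1 \<le> b n powr \<delta>" using b0[of n] \<delta> by (intro powr_mono') auto
        then have "b n \<le> b n powr \<delta>" using b0[of n] by simp
        then have "real (k n + 1) * b n \<le> (2 * real (k n)) * b n powr \<delta>"
          using elim b0[of n] by (intro mult_mono) auto
        then show ?case by simp
      qed
    qed (use b0 in simp)
  qed (rule B)
qed

text \<open>Encodes the order of the limits: first \<open>n\<close> grows for fixed
  \<open>\<epsilon>\<close>, with a majorant that may depend on \<open>\<epsilon>\<close>, and only
  then \<open>\<epsilon>\<close> tends to 0.\<close>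

lemma tendsto_zero_if_eventually_le_linear:
  fixes f :: "nat \<Rightarrow> real" and c :: real
  assumes "\<And>n. 0 \<le> f n" "0 \<le> c"
    and "\<And>\<epsilon>. 0 < \<epsilon> \<Longrightarrow> \<exists>g. g \<longlonglongrightarrow> \<epsilon> * c \<and> eventually (\<lambda>n. f n \<le> g n) sequentially"
  shows "f \<longlonglongrightarrow> 0"
proof (rule LIMSEQ_I)
  fix e :: real assume e: "0 < e"
  define \<epsilon> where "\<epsilon> = e / (c + 1)"
  have \<epsilon>: "0 < \<epsilon>" "\<epsilon> * c < e" using e assms(2) by (auto simp: \<epsilon>_def field_simps)
  obtain g where g: "g \<longlonglongrightarrow> \<epsilon> * c" "eventually (\<lambda>n. f n \<le> g n) sequentially" using assms(3)[OF \<epsilon>(1)] by blast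
  have "eventually (\<lambda>n. g n < e) sequentially" using order_tendstoD(2)[OF g(1) \<epsilon>(2)] .
  with g(2) have "eventually (\<lambda>n. norm (f n - 0) < e) sequentially"
    by eventually_elim (use assms(1) in auto)
  then show "\<exists>n0. \<forall>n\<ge>n0. norm (f n - 0) < e" by (simp add: eventually_sequentially)
qed

text \<open>The supremum lives in \<open>ennreal\<close>, so its finiteness carries integrability,
  which a bound on Bochner integrals alone would not.\<close>

lemma moments_le_SUP:
  fixes F :: "nat \<Rightarrow> nat \<Rightarrow> 'w \<Rightarrow> real"
  assumes i: "i \<in> I n" and F: "F n i \<in> borel_measurable (M n)" "\<And>w. 0 \<le> F n i w"
    and fin: "(SUP n. SUP i\<in>I n. \<integral>\<^sup>+ w. ennreal (F n i w) \<partial>M n) < \<infinity>"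
  shows "integrable (M n) (F n i)"
    and "integral\<^sup>L (M n) (F n i) \<le> enn2real (SUP n. SUP i\<in>I n. \<integral>\<^sup>+ w. ennreal (F n i w) \<partial>M n)"
proof -
  let ?S = "SUP n. SUP i\<in>I n. \<integral>\<^sup>+ w. ennreal (F n i w) \<partial>M n"
  have le: "(\<integral>\<^sup>+ w. ennreal (F n i w) \<partial>M n) \<le> ?S"
    by (rule SUP_upper2[of n]) (auto intro: SUP_upper i)
  show "integrable (M n) (F n i)"
    using F le fin by (intro integrableI_nonneg) (auto intro: order.strict_trans1)
  have "integral\<^sup>L (M n) (F n i) = enn2real (\<integral>\<^sup>+ w. ennreal (F n i w) \<partial>M n)"
    using F by (intro integral_eq_nn_integral) auto
  also have "\<dots> \<le> enn2real ?S" using le fin by (intro enn2real_mono) auto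
  finally show "integral\<^sup>L (M n) (F n i) \<le> enn2real ?S" .
qed

lemma norm_le_sum_vec_nth:
  fixes W :: "real ^ 'd ^ 'k" shows "norm W \<le> (\<Sum>l\<in>UNIV. \<Sum>i\<in>UNIV. \<bar>W $ l $ i\<bar>)"
proof -
  have "norm W \<le> (\<Sum>l\<in>UNIV. norm (W $ l))" unfolding norm_vec_def by (rule L2_set_le_sum) simp
  also have "\<dots> \<le> (\<Sum>l\<in>UNIV. \<Sum>i\<in>UNIV. \<bar>W $ l $ i\<bar>)" by (intro sum_mono norm_le_l1_cart)
  finally show ?thesis .
qed

theorem theorem3p2:
  fixes M :: "nat \<Rightarrow> 'w measure"
    and X :: "nat \<Rightarrow> nat \<Rightarrow> 'w \<Rightarrow> real ^ 'd"
    and k :: "nat \<Rightarrow> nat"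
    and \<gamma> \<alpha> :: real
  assumes prob: "\<And>n. prob_space (M n)"
    and rv: "\<And>n i. i \<in> {1..k n} \<Longrightarrow> X n i \<in> borel_measurable (M n)"
    and k_lim: "filterlim k at_top sequentially"
    and \<gamma>: "\<gamma> > 2"
    and \<alpha>: "\<alpha> < (\<gamma> - 2) / (2 * (\<gamma> - 1))"
    and cov_bound: "\<exists>K. \<forall>n l1 l2.
          (1 / real (k n)) * (\<Sum>i\<in>{1..k n}. \<Sum>j\<in>{1..k n}.
             \<bar>covar (M n) (\<lambda>w. X n i w $ l1) (\<lambda>w. X n j w $ l2)\<bar>) \<le> K"
    and moments: "\<And>l. (SUP n. SUP i\<in>{1..k n}.
          \<integral>\<^sup>+ w. ennreal (\<bar>X n i w $ l\<bar> powr \<gamma>) \<partial>M n) < \<infinity>"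
    and mixing: "(\<lambda>n. real (k n) *
          row_beta (M n) (X n) (k n) (nat \<lfloor>real (k n) powr \<alpha>\<rfloor>) powr ((\<gamma> - 2) / \<gamma>)) \<longlonglongrightarrow> 0"
  shows "relative_CLT M (\<lambda>n w. (1 / sqrt (real (k n))) *\<^sub>R
           (\<Sum>i\<in>{1..k n}. X n i w - integral\<^sup>L (M n) (X n i)))"
proof -
  obtain K where K: "(1 / real (k n)) * (\<Sum>i\<in>{1..k n}. \<Sum>j\<in>{1..k n}.
             \<bar>covar (M n) (\<lambda>w. X n i w $ l1) (\<lambda>w. X n j w $ l2)\<bar>) \<le> K" for n l1 l2
    using cov_bound by blast
  have "0 \<le> K" by (rule order_trans[OF _ K]) (simp add: sum_nonneg)
  define S where "S l = enn2real (SUP n. SUP i\<in>{1..k n}. \<integral>\<^sup>+ w. ennreal (\<bar>X n i w $ l\<bar> powr \<gamma>) \<partial>M n)" for l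
  define C where "C = (\<Sum>l\<in>UNIV. S l)"
  have SC: "S l \<le> C" for l unfolding C_def by (rule member_le_sum) (auto simp: S_def)
  have row: "moment_row (M n) (X n) (k n) \<gamma> C" for n
  proof -
    interpret prob_space "M n" by (rule prob)
    show ?thesis
    proof
      fix i l assume i: "i \<in> {1..k n}"
      have m: "(\<lambda>w. \<bar>X n i w $ l\<bar> powr \<gamma>) \<in> borel_measurable (M n)"
        using borel_measurable_vec_nth[OF rv[OF i], of l] by measurable
      note moments_le_SUP[of i "\<lambda>n. {1..k n}" n "\<lambda>n i w. \<bar>X n i w $ l\<bar> powr \<gamma>" M, OF i m _ moments]
      from this[simplified]
      show "integrable (M n) (\<lambda>w. \<bar>X n i w $ l\<bar> powr \<gamma>)" "expectation (\<lambda>w. \<bar>X n i w $ l\<bar> powr \<gamma>) \<le> C"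
        using SC[of l] by (auto simp: S_def)
    qed (use rv \<gamma> in \<open>auto simp: C_def S_def intro: sum_nonneg\<close>)
  qed
  define Y where "Y n = moment_row.scaled_sum (M n) (X n) (k n)" for n
  define cov where "cov n = moment_row.row_cov (M n) (X n) (k n)" for n
  have Y_eq: "(\<lambda>n w. (1 / sqrt (real (k n))) *\<^sub>R (\<Sum>i\<in>{1..k n}. X n i w - integral\<^sup>L (M n) (X n i))) = Y"
    by (intro ext) (simp add: Y_def moment_row.scaled_sum_def[OF row] moment_row.Xc_def[OF row])
  have cov_le: "cov n l1 l2 \<le> K" for n l1 l2
  proof -
    have "cov n l1 l2 \<le> (1 / real (k n)) * (\<Sum>i\<in>{1..k n}. \<Sum>j\<in>{1..k n}.
             \<bar>covar (M n) (\<lambda>w. X n i w $ l1) (\<lambda>w. X n j w $ l2)\<bar>)"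
      unfolding cov_def moment_row.row_cov_def[OF row]
      by (intro mult_left_mono sum_mono abs_ge_self) simp
    then show ?thesis using K[of n l1 l2] by linarith
  qed
  have "\<forall>n. \<exists>V. \<forall>l1 l2. cov n l1 l2 = (\<Sum>l\<in>(UNIV :: 'd set). V l l1 * V l l2)"
    using moment_row.row_cov_gram[OF row] unfolding cov_def by blast
  then obtain V where V: "cov n l1 l2 = (\<Sum>l\<in>(UNIV :: 'd set). V n l l1 * V n l l2)" for n l1 l2 by metis
  define W :: "nat \<Rightarrow> real ^ 'd ^ 'd" where "W n = (\<chi> l i. V n l i)" for n
  have VW: "cov n i j = (\<Sum>l\<in>UNIV. W n $ l $ i * W n $ l $ j)" for n i j by (simp add: V W_def)
  define G where "G n = gaussian_vector_law (\<lambda>l. W n $ l)" for n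
  have G_moments: "(\<integral>y. y $ i \<partial>G n) = 0" "integrable (G n) (\<lambda>y. y $ i * y $ j)"
    "(\<integral>y. y $ i * y $ j \<partial>G n) = cov n i j" for n i j
    unfolding G_def VW by (rule gaussian_vector_law_moments)+
  \<comment> \<open>Column \<open>i\<close> of \<open>W n\<close> has squared length
    \<open>cov n i i\<close>, at most \<open>K\<close>. Hence any choice of Gram factors is bounded,
    and no regularity of the choice in \<open>n\<close> is required.\<close>
  have W_bounded: "bounded (range W)"
  proof (rule boundedI, clarify)
    fix n
    have "\<bar>V n l i\<bar> \<le> 1 + K" for l i
    proof -
      have "(V n l i)\<^sup>2 \<le> (\<Sum>l\<in>UNIV. V n l i * V n l i)"
        unfolding power2_eq_square by (rule member_le_sum) auto
      then have "(V n l i)\<^sup>2 \<le> K" using cov_le[of n i i] V[of n i i] by linarith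
      moreover have "\<bar>V n l i\<bar> \<le> 1 + (V n l i)\<^sup>2"
        using abs_mult_le_sum_squares[of "V n l i" 1] by simp
      ultimately show ?thesis by linarith
    qed
    then have "(\<Sum>l\<in>UNIV. \<Sum>i\<in>UNIV. \<bar>W n $ l $ i\<bar>) \<le> (\<Sum>l\<in>(UNIV::'d set). \<Sum>i\<in>(UNIV::'d set). 1 + K)"
      unfolding W_def by (intro sum_mono) simp
    then show "norm (W n) \<le> (\<Sum>l\<in>(UNIV::'d set). \<Sum>i\<in>(UNIV::'d set). 1 + K)"
      using norm_le_sum_vec_nth[of "W n"] by linarith
  qed
  have Y_meas: "Y n \<in> borel_measurable (M n)" for n
    unfolding Y_def by (rule moment_row.measurable_scaled_sum[OF row])
  have Y_sq: "integrable (M n) (\<lambda>w. (norm (Y n w))\<^sup>2)" "integral\<^sup>L (M n) (\<lambda>w. (norm (Y n w))\<^sup>2) = (\<Sum>l\<in>UNIV. cov n l l)" for n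
    unfolding Y_def cov_def
    by (rule moment_row.integral_norm_scaled_sum[OF row])+
  have trace: "(\<Sum>l\<in>UNIV. cov n l l) \<le> real CARD('d) * K" for n
    using sum_mono[of UNIV "\<lambda>l. cov n l l" "\<lambda>_. K"] cov_le by simp
  have G_char: "(\<integral>y. iexp (t \<bullet> y) \<partial>G n) = complex_of_real (exp (- (quad_form (cov n) (\<lambda>l. t $ l) / 2)))" for n t
  proof -
    have "(\<Sum>l\<in>UNIV. (t \<bullet> W n $ l)\<^sup>2) = (\<Sum>l\<in>UNIV. \<Sum>i\<in>UNIV. \<Sum>j\<in>UNIV. t $ i * (V n l i * V n l j) * t $ j)"
      by (simp add: inner_vec_def power2_eq_square sum_product W_def mult_ac)
    also have "\<dots> = (\<Sum>i\<in>UNIV. \<Sum>j\<in>UNIV. \<Sum>l\<in>UNIV. t $ i * (V n l i * V n l j) * t $ j)"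
      by (rule sum_swap3)
    also have "\<dots> = quad_form (cov n) (\<lambda>l. t $ l)"
      unfolding quad_form_def V by (simp only: sum_distrib_left sum_distrib_right)
    finally show ?thesis unfolding G_def char_gaussian_vector_law by simp
  qed

  have char: "(\<lambda>n. (\<integral>w. iexp (t \<bullet> Y n w) \<partial>M n) - (\<integral>y. iexp (t \<bullet> y) \<partial>G n)) \<longlonglongrightarrow> 0" for t
  proof -
    define p where "p n = nat \<lfloor>real (k n) powr \<alpha>\<rfloor>" for n
    define K' where "K' = (\<Sum>l1\<in>UNIV. \<Sum>l2\<in>UNIV. \<bar>t $ l1\<bar> * \<bar>t $ l2\<bar>) * K"
    define C' where "C' = moment_row.projected_moment_bound \<gamma> C t"
    define \<delta> where "\<delta> = (\<gamma> - 2) / \<gamma>"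
    have \<delta>: "0 < \<delta>" "\<delta> \<le> 1" using \<gamma> by (auto simp: \<delta>_def)
    have K'0: "0 \<le> K'" unfolding K'_def using \<open>0 \<le> K\<close> by (intro mult_nonneg_nonneg sum_nonneg) auto
    obtain q where q: "\<And>n. 1 \<le> q n"
      and P: "(\<lambda>n. real (p n) / real (p n + q n)) \<longlonglongrightarrow> 0"
      and Q: "(\<lambda>n. real (q n) powr (\<gamma> - 1) * real (k n) powr (1 - \<gamma> / 2)) \<longlonglongrightarrow> 0"
      and R: "(\<lambda>n. (real (q n))\<^sup>2 / real (k n)) \<longlonglongrightarrow> 0"
      using block_length_sequence[OF k_lim \<gamma> \<alpha>] unfolding p_def by blast
    define \<beta> where "\<beta> n = row_beta (M n) (X n) (k n) (p n)" for n
    have beta_lim: "(\<lambda>n. real (k n) * \<beta> n powr \<delta>) \<longlonglongrightarrow> 0"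
      using mixing by (simp add: \<beta>_def p_def \<delta>_def)
    have beta0: "0 \<le> \<beta> n" for n
      unfolding \<beta>_def by (rule prob_space.row_beta_nonneg[OF prob]) (rule rv)
    obtain b where b: "\<And>n. 1 \<le> k n \<Longrightarrow> 0 < b n" "\<And>n. 2 * row_beta (M n) (X n) (k n) (p n) \<le> b n"
      and bk: "(\<lambda>n. real (k n) * b n powr \<delta>) \<longlonglongrightarrow> 0" "(\<lambda>n. real (k n + 1) * b n) \<longlonglongrightarrow> 0"
      using positive_mixing_rate[where \<beta> = \<beta>, OF k_lim \<delta> beta0 beta_lim] unfolding \<beta>_def by blast
    have k1: "eventually (\<lambda>n. 1 \<le> k n) sequentially"
      using k_lim unfolding filterlim_at_top by blast
    let ?d = "\<lambda>n. cmod ((\<integral>w. iexp (t \<bullet> Y n w) \<partial>M n) - (\<integral>y. iexp (t \<bullet> y) \<partial>G n))"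
    have "?d \<longlonglongrightarrow> 0"
    proof (rule tendsto_zero_if_eventually_le_linear)
      show "0 \<le> 1 + K'" using K'0 by simp
      fix \<epsilon> :: real assume \<epsilon>: "0 < \<epsilon>"
      \<comment> \<open>The terms with \<open>p\<close>, \<open>q\<close> and \<open>b\<close>
        vanish in the limit; what survives is \<open>\<epsilon>\<close> from deleting the gaps and
        \<open>\<epsilon> * K'\<close> from the Taylor remainder.\<close>
      define g where "g n = \<epsilon> + real (p n) / real (p n + q n) * K' / \<epsilon> + 16 * (real (k n + 1) * b n)
        + (\<epsilon> * K' + \<epsilon> powr (2 - \<gamma>) * (C' * (real (q n) powr (\<gamma> - 1) * real (k n) powr (1 - \<gamma> / 2))))
        + K' * ((real (q n))\<^sup>2 / real (k n) * (1 + C'))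
        + (real (p n) / real (p n + q n) * K' + (4 + 3 * C') * (real (k n) * b n powr \<delta>) / 2)" for n
      have "g \<longlonglongrightarrow> \<epsilon> + 0 * K' / \<epsilon> + 16 * 0 + (\<epsilon> * K' + \<epsilon> powr (2 - \<gamma>) * (C' * 0)) + K' * (0 * (1 + C'))
          + (0 * K' + (4 + 3 * C') * 0 / 2)"
        unfolding g_def by (intro tendsto_intros P Q R bk) (use \<epsilon> in auto)
      then have "g \<longlonglongrightarrow> \<epsilon> * (1 + K')" by (simp add: distrib_left)
      moreover have "eventually (\<lambda>n. ?d n \<le> g n) sequentially"
        using k1
      proof eventually_elim
        case (elim n)
        have "?d n \<le> \<epsilon> + real (p n) / real (p n + q n) * K' / \<epsilon> + 16 * real (k n + 1) * b n
          + (\<epsilon> * K' + \<epsilon> powr (2 - \<gamma>) * (C' * (real (q n) powr (\<gamma> - 1) * real (k n) powr (1 - \<gamma> / 2))))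
          + K' * ((real (q n))\<^sup>2 * (1 + C') / real (k n))
          + (real (p n) / real (p n + q n) * K' + real (k n) * ((4 + 3 * C') * b n powr \<delta>) / 2)"
          using moment_row.char_scaled_sum_bound[OF row elim b(1)[OF elim] b(2) K q \<epsilon>, of t]
          unfolding G_char Y_def cov_def K'_def C'_def \<delta>_def .
        also have "\<dots> = g n" by (simp add: g_def mult_ac)
        finally show ?case .
      qed
      ultimately show "\<exists>g. g \<longlonglongrightarrow> \<epsilon> * (1 + K') \<and> eventually (\<lambda>n. ?d n \<le> g n) sequentially" by blast
    qed simp
    then show ?thesis by (rule tendsto_norm_zero_cancel)
  qed

  \<comment> \<open>Both laws have as second moment the trace of the common covariance matrix, which
    explains the bound \<open>real CARD('d) * K\<close>.\<close>
  have weak: "relatively_weakly_convergent (\<lambda>n. distr (M n) borel (Y n)) G"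
  proof (rule relatively_weakly_convergent_char[where C = "real CARD('d) * K"])
    have nm: "(\<lambda>x::real ^ 'd. (norm x)\<^sup>2) \<in> borel_measurable borel" by measurable
    fix n
    show "prob_space (distr (M n) borel (Y n))" by (rule prob_space.prob_space_distr[OF prob Y_meas])
    show "integrable (distr (M n) borel (Y n)) (\<lambda>x. (norm x)\<^sup>2)"
      unfolding integrable_distr_eq[OF Y_meas nm] by (rule Y_sq)
    show "(\<integral>x. (norm x)\<^sup>2 \<partial>distr (M n) borel (Y n)) \<le> real CARD('d) * K"
      unfolding integral_distr[OF Y_meas nm] Y_sq by (rule trace)
    show "prob_space (G n)" "sets (G n) = sets borel"
      unfolding G_def by (simp_all add: prob_space_gaussian_vector_law)
    show "integrable (G n) (\<lambda>x. (norm x)\<^sup>2)" "(\<integral>x. (norm x)\<^sup>2 \<partial>G n) \<le> real CARD('d) * K"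
      unfolding power2_norm_eq_inner inner_vec_def inner_real_def
      using trace[of n] by (simp_all add: G_moments Bochner_Integration.integral_sum)
    fix t :: "real ^ 'd"
    have im: "(\<lambda>x. iexp (t \<bullet> x)) \<in> borel_measurable borel" by measurable
    show "(\<lambda>n. (\<integral>x. iexp (t \<bullet> x) \<partial>distr (M n) borel (Y n)) - (\<integral>x. iexp (t \<bullet> x) \<partial>G n)) \<longlonglongrightarrow> 0"
      unfolding integral_distr[OF Y_meas im] by (rule char)
  qed simp
  show ?thesis
    unfolding Y_eq relative_CLT_def
  proof (intro conjI allI exI[of _ G] Y_meas Y_sq weak)
    fix n
    show "centered_gaussian_law (G n)" unfolding G_def by (rule centered_gaussian_gaussian_vector_law)
    show "cov_matrix (G n) (\<lambda>x. x) = cov_matrix (M n) (Y n)"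
      by (simp add: vec_eq_iff cov_def Y_def moment_row.cov_matrix_scaled_sum[OF row])
        (simp add: cov_matrix_def covar_def G_moments cov_def)
    show "relatively_compact_laws G"
      unfolding G_def[abs_def] by (rule relatively_compact_gaussian_vector_laws[OF W_bounded])
  qed
qed

end
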